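(* Suppose $X$ possesses a first positive element $\chi_1$. Let $\mu$ be a generalized semi-character of $X_+$ and $a:X_+\setminus\{\chi_0\}\to\mathbb{C}$ a function such that the $\mu$-Hankel operator $A=A_{\mu,a}:H^2(G)\to H^2_-(G)$ is bounded, and let $q:=\mu(\chi_1)$ with $0<|q|<1$. Then $$A=\sum_{n=0}^\infty q^n\,\varphi_n\otimes\chi_1^n,\qquad(1)$$ where $(\varphi_n)_{n\ge 0}$ is a sequence of functions from $H^2_-(G)$ with Fourier coefficients $$\langle\varphi_n,\overline{\xi}\rangle=a(\chi_1^n\xi)\quad\forall n\in\mathbb{Z}_+,\ \xi\in X_+\setminus\{\chi_0\},\qquad(2)$$ that is uniformly bounded in norm. Moreover, $A|H^2(\chi_1)^\bot=0$, the operator $A$ is nuclear, and its norm satisfies $\|A\|\le\|\varphi_0\|/(1-|q|)$. Conversely, if a sequence $(\varphi_n)_{n\ge0}$ in $H^2_-(G)$ is uniformly bounded in norm and (2) holds for some function $a$, then each operator $A$ of the form (1) with some $q\in\mathbb{D}$ is nuclear and equals $A_{\mu,a}$, where $\mu$ is the generalized semi-character of $X_+$ with $\mu(\chi_1)=q$ and $\mu(\chi)=0$ for all $\chi\in X_+\setminus X^i$.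
   Context: $G$ is a compact connected Abelian group with normalized Haar measure, $X$ is its (discrete, multiplicatively written) dual group of continuous characters, viewed as functions on $G$, and a total order compatible with the group structure is fixed on $X$. $\chi_0\equiv 1$ is the unit character, $X_+=\{\chi\in X:\chi\ge\chi_0\}$ and $X_-=X\setminus X_+=\{\overline{\xi}:\xi\in X_+\setminus\{\chi_0\}\}$, where the bar is complex conjugation (so $\overline{\xi}=\xi^{-1}$). $H^2(G)=\{f\in L^2(G):\widehat f(\chi)=0\ \forall\chi\in X_-\}$, where $\widehat f$ is the Fourier transform, and $H^2_-(G)=L^2(G)\ominus H^2(G)$; $X_+$ and $X_-$ are orthonormal bases of $H^2(G)$ and $H^2_-(G)$ respectively. $\langle\cdot,\cdot\rangle$ and $\|\cdot\|$ are the inner product and norm of $L^2(G)$ (and $\|\cdot\|$ also denotes the operator norm). A first positive element $\chi_1$ is a least element of $X_+\setminus\{\chi_0\}$; $\chi_1^0:=\chi_0$; $X^i$ is the infinite cyclic subgroup of $X$ generated by $\chi_1$. $H^2(\chi_1)$ is the Hilbert subspace of $H^2(G)$ with orthonormal basis $\{\chi_1^n:n\in\mathbb{Z}_+\}$, $\mathbb{Z}_+=\{0,1,2,\dots\}$, and $H^2(\chi_1)^\bot$ is its orthogonal complement in $H^2(G)$. $\mathbb{D}$ is the open unit disk of $\mathbb{C}$; $q^0=1$ for every $q\in\mathbb{D}$. For $y\in H_1$, $f\in H_2$ ($H_1,H_2$ Hilbert spaces), $f\otimes y:H_1\to H_2$ is the rank-one operator $(f\otimes y)x=\langle x,y\rangle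 f$. Series of operators converge in operator norm. A generalized semi-character of $X_+$ is a non-null (not identically zero) homomorphism $\mu$ of the semigroup $X_+$ into the multiplicative semigroup $\mathbb{C}$. Given such $\mu$ and $a:X_+\setminus\{\chi_0\}\to\mathbb{C}$, a $\mu$-Hankel operator $A_{\mu,a}$ is a linear operator from $H^2(G)$ to $H^2_-(G)$, defined at least on $\mathrm{span}(X_+)$, such that $\langle A_{\mu,a}\chi,\overline{\xi}\rangle=\mu(\chi)a(\chi\xi)$ for all $\chi\in X_+$, $\xi\in X_+\setminus\{\chi_0\}$; it is called bounded if it is a bounded operator on all of $H^2(G)$. *)

theory Defs
  imports "HOL-Analysis.Analysis" "HOL-Library.Function_Algebras"
begin

section \<open>Compact connected abelian groups with normalized Haar measure\<close>

text \<open>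
  The group is written additively. The parameter \<open>haar\<close> is the Haar measure: the translation
  invariant Radon probability measure on the Borel sets. Inner regularity has to be required,
  because the group need not be metrizable; on a compact Hausdorff space it yields outer
  regularity by passing to complements.
\<close>

class compact_connected_ab_group = topological_ab_group_add + t2_space +
  fixes haar :: "'a measure"
  assumes compact_UNIV_group: "compact (UNIV :: 'a set)"
    and connected_UNIV_group: "connected (UNIV :: 'a set)"
    and sets_haar: "sets haar = sets borel"
    and emeasure_haar_UNIV: "emeasure haar UNIV = 1"
    and haar_translation: "B \<in> sets borel \<Longrightarrow> emeasure haar ((+) x ` B) = emeasure haar B"
    and haar_inner_regular:
      "B \<in> sets borel \<Longrightarrow> emeasure haar B = (SUP K\<in>{K. K \<subseteq> B \<and> compact K}. emeasure haar K)"


section \<open>The Hilbert space \<open>L\<^sup>2(G)\<close>\<close>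

lemma cnj_borel_measurable [measurable]: "cnj \<in> borel_measurable borel"
  by (intro borel_measurable_continuous_onI continuous_intros)

definition sq_integrable :: "('g::compact_connected_ab_group \<Rightarrow> complex) \<Rightarrow> bool" where
  "sq_integrable f \<longleftrightarrow>
     f \<in> borel_measurable haar \<and> integrable haar (\<lambda>x. (cmod (f x))\<^sup>2)"

lemma sq_integrable_measurable: "sq_integrable f \<Longrightarrow> f \<in> borel_measurable haar"
  by (simp add: sq_integrable_def)

lemma sq_integrable_zero: "sq_integrable (\<lambda>_. 0)"
  by (simp add: sq_integrable_def)

lemma sq_integrable_scale:
  assumes "sq_integrable f"
  shows "sq_integrable (\<lambda>x. c * f x)"
  using assms by (auto simp: sq_integrable_def norm_mult power_mult_distrib)

lemma sq_integrable_add: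
  assumes "sq_integrable f" "sq_integrable g"
  shows "sq_integrable (\<lambda>x. f x + g x)"
proof -
  have m [measurable]: "f \<in> borel_measurable haar" "g \<in> borel_measurable haar"
    using assms by (auto simp: sq_integrable_def)
  have "integrable haar (\<lambda>x. 2 * (cmod (f x))\<^sup>2 + 2 * (cmod (g x))\<^sup>2)"
    using assms by (auto simp: sq_integrable_def)
  moreover have "(cmod (f x + g x))\<^sup>2 \<le> 2 * (cmod (f x))\<^sup>2 + 2 * (cmod (g x))\<^sup>2" for x
  proof -
    have "(cmod (f x + g x))\<^sup>2 \<le> (cmod (f x) + cmod (g x))\<^sup>2"
      by (intro power_mono norm_triangle_ineq) auto
    also have "\<dots> \<le> 2 * (cmod (f x))\<^sup>2 + 2 * (cmod (g x))\<^sup>2"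
      using sum_squares_bound[of "cmod (f x)" "cmod (g x)"] by (simp add: power2_sum)
    finally show ?thesis .
  qed
  moreover have "(\<lambda>x. (cmod (f x + g x))\<^sup>2) \<in> borel_measurable haar"
    by measurable
  ultimately have "integrable haar (\<lambda>x. (cmod (f x + g x))\<^sup>2)"
    by (elim Bochner_Integration.integrable_bound) (auto intro!: AE_I2 simp: abs_of_nonneg)
  then show ?thesis
    by (simp add: sq_integrable_def)
qed

lemma integrable_mult_cnj:
  assumes "sq_integrable f" "sq_integrable g"
  shows "integrable haar (\<lambda>x. f x * cnj (g x))"
proof -
  have m [measurable]: "f \<in> borel_measurable haar" "g \<in> borel_measurable haar"
    using assms by (auto simp: sq_integrable_def)
  have "integrable haar (\<lambda>x. (cmod (f x))\<^sup>2 + (cmod (g x))\<^sup>2)"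
    using assms by (auto simp: sq_integrable_def)
  moreover have "cmod (f x * cnj (g x)) \<le> (cmod (f x))\<^sup>2 + (cmod (g x))\<^sup>2" for x
  proof -
    have "0 \<le> cmod (f x) * cmod (g x)"
      by simp
    moreover have "2 * (cmod (f x) * cmod (g x)) \<le> (cmod (f x))\<^sup>2 + (cmod (g x))\<^sup>2"
      using sum_squares_bound[of "cmod (f x)" "cmod (g x)"] by (simp add: mult.assoc)
    ultimately show ?thesis
      unfolding norm_mult complex_mod_cnj by linarith
  qed
  moreover have "(\<lambda>x. f x * cnj (g x)) \<in> borel_measurable haar"
    by measurable
  ultimately show ?thesis
    by (elim Bochner_Integration.integrable_bound) (auto intro!: AE_I2 simp: abs_of_nonneg)
qed

definition L2_rel ::
    "('g::compact_connected_ab_group \<Rightarrow> complex) \<Rightarrow> ('g \<Rightarrow> complex) \<Rightarrow> bool" where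
  "L2_rel f g \<longleftrightarrow> sq_integrable f \<and> sq_integrable g \<and> (AE x in haar. f x = g x)"

lemma part_equivp_L2_rel:
  "part_equivp (L2_rel :: ('g::compact_connected_ab_group \<Rightarrow> complex) \<Rightarrow> _)"
proof (rule part_equivpI)
  show "\<exists>f :: 'g \<Rightarrow> complex. L2_rel f f"
    using sq_integrable_zero by (auto simp: L2_rel_def)
  show "symp (L2_rel :: ('g \<Rightarrow> complex) \<Rightarrow> _)"
    by (auto simp: symp_def L2_rel_def elim: AE_mp)
  show "transp (L2_rel :: ('g \<Rightarrow> complex) \<Rightarrow> _)"
  proof (rule transpI)
    fix f g h :: "'g \<Rightarrow> complex"
    assume *: "L2_rel f g" "L2_rel g h"
    have "AE x in haar. f x = h x"
      using conjunct2[OF conjunct2[OF *(1)[unfolded L2_rel_def]]]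
        conjunct2[OF conjunct2[OF *(2)[unfolded L2_rel_def]]]
      by eventually_elim simp
    with * show "L2_rel f h"
      by (simp add: L2_rel_def)
  qed
qed

quotient_type (overloaded) 'g L2 =
  "'g::compact_connected_ab_group \<Rightarrow> complex" / partial: L2_rel
  morphisms rep_L2 L2_of
  by (rule part_equivp_L2_rel)

lift_definition cscale :: "complex \<Rightarrow> 'g::compact_connected_ab_group L2 \<Rightarrow> 'g L2"
  is "\<lambda>c f x. c * f x"
  by (auto simp: L2_rel_def intro: sq_integrable_scale)

text \<open>The inner product is linear in the first argument.\<close>

lift_definition cinner :: "'g::compact_connected_ab_group L2 \<Rightarrow> 'g L2 \<Rightarrow> complex"
  is "\<lambda>f g. integral\<^sup>L haar (\<lambda>x. f x * cnj (g x))"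
proof -
  fix f f' g g' :: "'g \<Rightarrow> complex"
  assume "L2_rel f f'" "L2_rel g g'"
  then have [measurable]: "f \<in> borel_measurable haar" "f' \<in> borel_measurable haar"
      "g \<in> borel_measurable haar" "g' \<in> borel_measurable haar"
    and ae: "AE x in haar. f x = f' x" "AE x in haar. g x = g' x"
    by (auto simp: L2_rel_def sq_integrable_def)
  from ae have "AE x in haar. f x * cnj (g x) = f' x * cnj (g' x)"
    by eventually_elim simp
  then show "integral\<^sup>L haar (\<lambda>x. f x * cnj (g x)) = integral\<^sup>L haar (\<lambda>x. f' x * cnj (g' x))"
    by (intro integral_cong_AE) auto
qed

instantiation L2 :: (compact_connected_ab_group) real_inner
begin

lift_definition zero_L2 :: "'a L2" is "\<lambda>_. 0"
  by (simp add: L2_rel_def sq_integrable_zero)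

lift_definition plus_L2 :: "'a L2 \<Rightarrow> 'a L2 \<Rightarrow> 'a L2" is "\<lambda>f g x. f x + g x"
  by (auto simp: L2_rel_def intro: sq_integrable_add)

definition scaleR_L2 :: "real \<Rightarrow> 'a L2 \<Rightarrow> 'a L2"
  where "scaleR_L2 r f = cscale (complex_of_real r) f"

definition uminus_L2 :: "'a L2 \<Rightarrow> 'a L2"
  where "uminus_L2 f = cscale (-1) f"

definition minus_L2 :: "'a L2 \<Rightarrow> 'a L2 \<Rightarrow> 'a L2"
  where "minus_L2 f g = f + (- g)" for f g :: "'a L2"

definition inner_L2 :: "'a L2 \<Rightarrow> 'a L2 \<Rightarrow> real"
  where "inner_L2 f g = Re (cinner f g)"

definition norm_L2 :: "'a L2 \<Rightarrow> real"
  where "norm_L2 f = sqrt (inner f f)" for f :: "'a L2"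

definition sgn_L2 :: "'a L2 \<Rightarrow> 'a L2"
  where "sgn_L2 f = scaleR (inverse (norm f)) f" for f :: "'a L2"

definition dist_L2 :: "'a L2 \<Rightarrow> 'a L2 \<Rightarrow> real"
  where "dist_L2 f g = norm (f - g)" for f g :: "'a L2"

definition uniformity_L2 :: "('a L2 \<times> 'a L2) filter"
  where "uniformity_L2 = (INF e\<in>{0<..}. principal {(x :: 'a L2, y). dist x y < e})"

definition open_L2 :: "'a L2 set \<Rightarrow> bool"
  where "open_L2 U \<longleftrightarrow> (\<forall>x\<in>U. eventually (\<lambda>(x', y). x' = x \<longrightarrow> y \<in> U) uniformity)"
    for U :: "'a L2 set"

instance
proof
  fix f g h :: "'a L2" and r s :: real
  show "f + g + h = f + (g + h)"
    by transfer (auto simp: L2_rel_def add.assoc intro!: sq_integrable_add)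
  show "f + g = g + f"
    by transfer (auto simp: L2_rel_def add.commute intro!: sq_integrable_add)
  show "0 + f = f"
    by transfer (auto simp: L2_rel_def)
  show "- f + f = 0"
    unfolding uminus_L2_def
    by transfer (auto simp: L2_rel_def sq_integrable_zero)
  show "f - g = f + - g"
    by (simp add: minus_L2_def)
  show "r *\<^sub>R (f + g) = r *\<^sub>R f + r *\<^sub>R g"
    unfolding scaleR_L2_def
    by transfer (auto simp: L2_rel_def distrib_left intro!: sq_integrable_add sq_integrable_scale)
  show "(r + s) *\<^sub>R f = r *\<^sub>R f + s *\<^sub>R f"
    unfolding scaleR_L2_def
    by transfer (auto simp: L2_rel_def distrib_right intro!: sq_integrable_add sq_integrable_scale)
  show "r *\<^sub>R s *\<^sub>R f = (r * s) *\<^sub>R f"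
    unfolding scaleR_L2_def
    by transfer (auto simp: L2_rel_def mult.assoc intro!: sq_integrable_scale)
  show "1 *\<^sub>R f = f"
    unfolding scaleR_L2_def
    by transfer (auto simp: L2_rel_def)
  show "inner f g = inner g f"
    unfolding inner_L2_def
  proof transfer
    fix f g :: "'a \<Rightarrow> complex"
    assume "L2_rel f f" "L2_rel g g"
    have "integral\<^sup>L haar (\<lambda>x. g x * cnj (f x)) = integral\<^sup>L haar (\<lambda>x. cnj (f x * cnj (g x)))"
      by (simp add: mult.commute)
    also have "\<dots> = cnj (integral\<^sup>L haar (\<lambda>x. f x * cnj (g x)))"
      by (rule Bochner_Integration.integral_cnj)
    finally show "Re (integral\<^sup>L haar (\<lambda>x. f x * cnj (g x))) =
        Re (integral\<^sup>L haar (\<lambda>x. g x * cnj (f x)))"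
      by simp
  qed
  show "inner (f + g) h = inner f h + inner g h"
    unfolding inner_L2_def
    by transfer (simp add: L2_rel_def distrib_right integrable_mult_cnj)
  show "inner (r *\<^sub>R f) g = r * inner f g"
    unfolding inner_L2_def scaleR_L2_def
    by transfer (simp add: mult.assoc)
  have sq: "integral\<^sup>L haar (\<lambda>x. u x * cnj (u x)) =
      complex_of_real (integral\<^sup>L haar (\<lambda>x. (cmod (u x))\<^sup>2))" for u :: "'a \<Rightarrow> complex"
    by (simp only: complex_norm_square[symmetric] integral_complex_of_real)
  show "0 \<le> inner f f"
    unfolding inner_L2_def by transfer (simp add: sq)
  show "inner f f = 0 \<longleftrightarrow> f = 0"
    unfolding inner_L2_def
  proof transfer
    fix f :: "'a \<Rightarrow> complex"
    assume "L2_rel f f"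
    then have "integrable haar (\<lambda>x. (cmod (f x))\<^sup>2)" "sq_integrable f"
      by (auto simp: L2_rel_def sq_integrable_def)
    then show "Re (integral\<^sup>L haar (\<lambda>x. f x * cnj (f x))) = 0 \<longleftrightarrow> L2_rel f (\<lambda>_. 0)"
      by (simp add: sq integral_nonneg_eq_0_iff_AE L2_rel_def sq_integrable_zero)
  qed
qed (simp_all add: norm_L2_def sgn_L2_def dist_L2_def uniformity_L2_def open_L2_def)

end


lemma vector_space_cscale:
  "vector_space (cscale :: complex \<Rightarrow> 'g::compact_connected_ab_group L2 \<Rightarrow> 'g L2)"
proof
  fix a b :: complex and f g :: "'g L2"
  show "cscale a (f + g) = cscale a f + cscale a g"
    by transfer (auto simp: L2_rel_def distrib_left intro!: sq_integrable_add sq_integrable_scale)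
  show "cscale (a + b) f = cscale a f + cscale b f"
    by transfer (auto simp: L2_rel_def distrib_right intro!: sq_integrable_add sq_integrable_scale)
  show "cscale a (cscale b f) = cscale (a * b) f"
    by transfer (auto simp: L2_rel_def mult.assoc intro!: sq_integrable_scale)
  show "cscale 1 f = f"
    by transfer (auto simp: L2_rel_def)
qed

lemma cinner_self: "cinner f f = complex_of_real ((norm f)\<^sup>2)"
proof -
  have "Im (cinner f f) = 0"
    by transfer (simp only: complex_norm_square[symmetric] integral_complex_of_real Im_complex_of_real)
  moreover have "Re (cinner f f) = (norm f)\<^sup>2"
    by (simp add: power2_norm_eq_inner inner_L2_def)
  ultimately show ?thesis
    by (simp add: complex_eq_iff)
qed


section \<open>The ordered dual group and Hardy spaces\<close>

text \<open>
  The group operation of the dual is pointwise multiplication of functions, so that \<open>\<psi> * \<xi>\<close>,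
  \<open>1\<close> and \<open>\<psi> ^ n\<close> are the product, the unit character and the powers.
\<close>

definition characters :: "('g::compact_connected_ab_group \<Rightarrow> complex) set" where
  "characters = {\<psi>. continuous_on UNIV \<psi> \<and> (\<forall>x. cmod (\<psi> x) = 1) \<and>
     (\<forall>x y. \<psi> (x + y) = \<psi> x * \<psi> y)}"

text \<open>Hence \<open>L2_of \<psi>\<close> is the class of \<open>\<psi>\<close> for every character \<open>\<psi>\<close>.\<close>

lemma sq_integrable_character:
  assumes "\<psi> \<in> characters"
  shows "sq_integrable \<psi>"
proof -
  have "space haar = (UNIV :: 'a set)"
    using sets_eq_imp_space_eq[OF sets_haar] by simp
  then have "emeasure (haar :: 'a measure) (space haar) = 1"
    by (simp add: emeasure_haar_UNIV)
  then have "finite_measure (haar :: 'a measure)"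
    by (intro finite_measureI) simp
  moreover have "\<psi> \<in> borel_measurable haar"
    using assms borel_measurable_continuous_onI[of \<psi>]
    by (simp add: characters_def measurable_cong_sets[OF sets_haar refl])
  ultimately show ?thesis
    using assms by (simp add: sq_integrable_def characters_def finite_measure.integrable_const)
qed

definition cnj_char :: "('g \<Rightarrow> complex) \<Rightarrow> ('g \<Rightarrow> complex)" where
  "cnj_char \<psi> = (\<lambda>x. cnj (\<psi> x))"

text \<open>\<open>(\<psi>, \<xi>) \<in> R\<close> means \<open>\<psi> \<le> \<xi>\<close>.\<close>

definition group_order :: "('g::compact_connected_ab_group \<Rightarrow> complex) rel \<Rightarrow> bool" where
  "group_order R \<longleftrightarrow> linear_order_on characters R \<and>
     (\<forall>\<psi> \<xi> \<eta>. (\<psi>, \<xi>) \<in> R \<longrightarrow> \<eta> \<in> characters \<longrightarrow> (\<psi> * \<eta>, \<xi> * \<eta>) \<in> R)"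

definition Xplus :: "('g::compact_connected_ab_group \<Rightarrow> complex) rel \<Rightarrow> ('g \<Rightarrow> complex) set" where
  "Xplus R = {\<psi> \<in> characters. (1, \<psi>) \<in> R}"

definition Xminus :: "('g::compact_connected_ab_group \<Rightarrow> complex) rel \<Rightarrow> ('g \<Rightarrow> complex) set" where
  "Xminus R = characters - Xplus R"

definition first_positive ::
    "('g::compact_connected_ab_group \<Rightarrow> complex) rel \<Rightarrow> ('g \<Rightarrow> complex) \<Rightarrow> bool" where
  "first_positive R \<chi>1 \<longleftrightarrow> \<chi>1 \<in> Xplus R - {1} \<and> (\<forall>\<xi> \<in> Xplus R - {1}. (\<chi>1, \<xi>) \<in> R)"

definition cyclic_subgroup :: "('g \<Rightarrow> complex) \<Rightarrow> ('g \<Rightarrow> complex) set" where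
  "cyclic_subgroup \<psi> = range (\<lambda>k::int. (\<lambda>x. \<psi> x powi k))"

definition fourier ::
    "'g::compact_connected_ab_group L2 \<Rightarrow> ('g \<Rightarrow> complex) \<Rightarrow> complex" where
  "fourier f \<psi> = cinner f (L2_of \<psi>)"

definition H2 :: "('g::compact_connected_ab_group \<Rightarrow> complex) rel \<Rightarrow> 'g L2 set" where
  "H2 R = {f. \<forall>\<psi> \<in> Xminus R. fourier f \<psi> = 0}"

definition H2m :: "('g::compact_connected_ab_group \<Rightarrow> complex) rel \<Rightarrow> 'g L2 set" where
  "H2m R = {f. \<forall>g \<in> H2 R. cinner f g = 0}"

definition H2_cyclic :: "('g::compact_connected_ab_group \<Rightarrow> complex) \<Rightarrow> 'g L2 set" where
  "H2_cyclic \<chi>1 = closure (module.span cscale (range (\<lambda>n::nat. L2_of (\<chi>1 ^ n))))"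

definition H2_cyclic_perp ::
    "('g::compact_connected_ab_group \<Rightarrow> complex) rel \<Rightarrow> ('g \<Rightarrow> complex) \<Rightarrow> 'g L2 set" where
  "H2_cyclic_perp R \<chi>1 = {f \<in> H2 R. \<forall>g \<in> H2_cyclic \<chi>1. cinner f g = 0}"


section \<open>Operators between subspaces of \<open>L\<^sup>2(G)\<close>\<close>

text \<open>
  An operator with domain \<open>V\<close> is a function on the whole type \<open>'g L2\<close>, whose values outside \<open>V\<close>
  are irrelevant.
\<close>

definition linear_op ::
    "'g::compact_connected_ab_group L2 set \<Rightarrow> 'g L2 set \<Rightarrow> ('g L2 \<Rightarrow> 'g L2) \<Rightarrow> bool" where
  "linear_op V W A \<longleftrightarrow> A ` V \<subseteq> W \<and> (\<forall>f\<in>V. \<forall>g\<in>V. A (f + g) = A f + A g) \<and>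
     (\<forall>c. \<forall>f\<in>V. A (cscale c f) = cscale c (A f))"

definition bounded_op ::
    "'g::compact_connected_ab_group L2 set \<Rightarrow> 'g L2 set \<Rightarrow> ('g L2 \<Rightarrow> 'g L2) \<Rightarrow> bool" where
  "bounded_op V W A \<longleftrightarrow> linear_op V W A \<and> (\<exists>K. \<forall>f\<in>V. norm (A f) \<le> K * norm f)"

definition op_norm ::
    "'g::compact_connected_ab_group L2 set \<Rightarrow> ('g L2 \<Rightarrow> 'g L2) \<Rightarrow> real" where
  "op_norm V A = (SUP f\<in>{f \<in> V. norm f \<le> 1}. norm (A f))"

text \<open>\<open>op_sums V W S A\<close>: the series \<open>\<Sum>n. S n\<close> of bounded operators from \<open>V\<close> to \<open>W\<close> converges
  in operator norm to the bounded operator \<open>A\<close>.\<close>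

definition op_sums ::
    "'g::compact_connected_ab_group L2 set \<Rightarrow> 'g L2 set \<Rightarrow> (nat \<Rightarrow> 'g L2 \<Rightarrow> 'g L2) \<Rightarrow>
      ('g L2 \<Rightarrow> 'g L2) \<Rightarrow> bool" where
  "op_sums V W S A \<longleftrightarrow> (\<forall>n. bounded_op V W (S n)) \<and> bounded_op V W A \<and>
     (\<lambda>N. op_norm V (\<lambda>f. A f - (\<Sum>n<N. S n f))) \<longlonglongrightarrow> 0"

definition rank_one ::
    "'g::compact_connected_ab_group L2 \<Rightarrow> 'g L2 \<Rightarrow> 'g L2 \<Rightarrow> 'g L2" where
  "rank_one f y = (\<lambda>x. cscale (cinner x y) f)"

definition nuclear_op ::
    "'g::compact_connected_ab_group L2 set \<Rightarrow> 'g L2 set \<Rightarrow> ('g L2 \<Rightarrow> 'g L2) \<Rightarrow> bool" where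
  "nuclear_op V W A \<longleftrightarrow> (\<exists>f y. (\<forall>n. f n \<in> W) \<and> (\<forall>n. y n \<in> V) \<and>
     summable (\<lambda>n. norm (f n) * norm (y n)) \<and> op_sums V W (\<lambda>n. rank_one (f n) (y n)) A)"


section \<open>Generalized semi-characters and \<open>\<mu>\<close>-Hankel operators\<close>

definition gen_semichar ::
    "('g::compact_connected_ab_group \<Rightarrow> complex) rel \<Rightarrow> (('g \<Rightarrow> complex) \<Rightarrow> complex) \<Rightarrow> bool" where
  "gen_semichar R \<mu> \<longleftrightarrow> (\<forall>\<psi> \<in> Xplus R. \<forall>\<xi> \<in> Xplus R. \<mu> (\<psi> * \<xi>) = \<mu> \<psi> * \<mu> \<xi>) \<and>
     (\<exists>\<psi> \<in> Xplus R. \<mu> \<psi> \<noteq> 0)"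

text \<open>\<open>D\<close> is the domain of the operator \<open>A\<close>. Only the values of \<open>a\<close> on \<open>Xplus R - {1}\<close> matter.\<close>

definition mu_Hankel ::
    "('g::compact_connected_ab_group \<Rightarrow> complex) rel \<Rightarrow> (('g \<Rightarrow> complex) \<Rightarrow> complex) \<Rightarrow>
      (('g \<Rightarrow> complex) \<Rightarrow> complex) \<Rightarrow> 'g L2 set \<Rightarrow> ('g L2 \<Rightarrow> 'g L2) \<Rightarrow> bool" where
  "mu_Hankel R \<mu> a D A \<longleftrightarrow>
     module.subspace cscale D \<and> module.span cscale (L2_of ` Xplus R) \<subseteq> D \<and> D \<subseteq> H2 R \<and>
     linear_op D (H2m R) A \<and>
     (\<forall>\<psi> \<in> Xplus R. \<forall>\<xi> \<in> Xplus R - {1}.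
        cinner (A (L2_of \<psi>)) (L2_of (cnj_char \<xi>)) = \<mu> \<psi> * a (\<psi> * \<xi>))"

definition bounded_mu_Hankel ::
    "('g::compact_connected_ab_group \<Rightarrow> complex) rel \<Rightarrow> (('g \<Rightarrow> complex) \<Rightarrow> complex) \<Rightarrow>
      (('g \<Rightarrow> complex) \<Rightarrow> complex) \<Rightarrow> ('g L2 \<Rightarrow> 'g L2) \<Rightarrow> bool" where
  "bounded_mu_Hankel R \<mu> a A \<longleftrightarrow> mu_Hankel R \<mu> a (H2 R) A \<and> bounded_op (H2 R) (H2m R) A"

text \<open>The hypotheses on \<open>(\<phi>\<^sub>n)\<close>: a norm bounded sequence in \<open>H2m R\<close> with
  \<open>\<langle>\<phi>\<^sub>n, cnj \<xi>\<rangle> = a (\<chi>1\<^sup>n \<xi>)\<close>.\<close>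

definition coeff_seq ::
    "('g::compact_connected_ab_group \<Rightarrow> complex) rel \<Rightarrow> ('g \<Rightarrow> complex) \<Rightarrow>
      (('g \<Rightarrow> complex) \<Rightarrow> complex) \<Rightarrow> (nat \<Rightarrow> 'g L2) \<Rightarrow> bool" where
  "coeff_seq R \<chi>1 a \<phi> \<longleftrightarrow> (\<forall>n. \<phi> n \<in> H2m R) \<and> bounded (range \<phi>) \<and>
     (\<forall>n. \<forall>\<xi> \<in> Xplus R - {1}.
        cinner (\<phi> n) (L2_of (cnj_char \<xi>)) = a (\<chi>1 ^ n * \<xi>))"

definition cyclic_semichar ::
    "('g::compact_connected_ab_group \<Rightarrow> complex) rel \<Rightarrow> ('g \<Rightarrow> complex) \<Rightarrow> complex \<Rightarrow>
      (('g \<Rightarrow> complex) \<Rightarrow> complex) \<Rightarrow> bool" where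
  "cyclic_semichar R \<chi>1 q \<mu> \<longleftrightarrow> gen_semichar R \<mu> \<and> \<mu> \<chi>1 = q \<and>
     (\<forall>\<psi> \<in> Xplus R - cyclic_subgroup \<chi>1. \<mu> \<psi> = 0)"

end

theory Submission
  imports Defs
begin

text \<open>
  Write \<open>q = \<mu> \<chi>1\<close>. The coefficients of \<open>A (\<chi>1 ^ n)\<close> are \<open>q ^ n * a (\<chi>1 ^ n * \<xi>)\<close>, so
  \<open>\<phi> n = A (\<chi>1 ^ n) / q ^ n\<close> has the required coefficients. The coefficients of \<open>\<phi> n\<close> are those of
  \<open>\<phi> 0\<close>, shifted by \<open>\<chi>1 ^ n\<close>; hence \<open>\<phi> n\<close> is the orthogonal projection of \<open>\<chi>1 ^ n * \<phi> 0\<close> to \<open>H2m R\<close>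
  and \<open>norm (\<phi> n) \<le> norm (\<phi> 0)\<close> (\<open>norm_shifted_coefficients\<close>). A positive character \<open>\<psi>\<close> that is not
  a power of \<open>\<chi>1\<close> is divisible by every power of \<open>\<chi>1\<close>, because \<open>\<chi>1\<close> is the least positive element.
  Each coefficient of \<open>A \<psi>\<close> is therefore \<open>q ^ n\<close> times a coefficient bounded by the norm of \<open>A\<close>, for
  every \<open>n\<close>, and so \<open>A \<psi> = 0\<close> (\<open>mu_Hankel_vanishes\<close>).

  Thus \<open>A\<close> is known on all positive characters. To conclude that \<open>A\<close> is the sum of the series, one
  needs that the characters span a dense subspace of \<open>L\<^sup>2(G)\<close> (\<open>characters_complete\<close>). Then \<open>A\<close> and the
  series are compared on partial Fourier sums, where the geometric decay of \<open>q ^ n\<close> controls the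
  remainder (\<open>operator_series_estimate\<close>). This estimate gives the convergence in operator norm, the
  bound of the norm, and the vanishing on the complement of \<open>H2_cyclic \<chi>1\<close>.

  For the converse, absolutely convergent series converge in \<open>L\<^sup>2(G)\<close>
  (\<open>L2_absolutely_summable\<close>), which yields the operator \<open>A\<close>. On a character at most one term of the
  series survives, and its coefficients are those of the operator \<open>A\<^bsub>\<mu>,a\<^esub>\<close> for the semi-character
  that vanishes outside the powers of \<open>\<chi>1\<close>. That this function is multiplicative
  (\<open>cyclic_semichar_unique_existence\<close>) holds because a product of positive characters is a power of
  \<open>\<chi>1\<close> only if both factors are.

  The density of the characters is the main analytic ingredient. By the Stone--Weierstrass theorem
  it reduces to the separation of points, and this to the statement that a nonzero continuous
  function \<open>k\<close> is not orthogonal to all characters (\<open>character_not_orthogonal\<close>). The proof is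
  variational. For a continuous \<open>f\<close> with \<open>\<integral>|f|\<^sup>2 = 1\<close> let \<open>p\<close> be its autocorrelation, and let \<open>u\<close> be the
  correlation of \<open>k\<close> with \<open>p\<close>, whose Fourier coefficients are those of \<open>k\<close> times the squared moduli
  of those of \<open>f\<close>. Since \<open>\<integral>|u|\<^sup>2\<close> is a convex function of \<open>p\<close>, a maximising \<open>f\<close> has to concentrate
  at a single character. Quantitatively, testing maximality with \<open>f(y) \<plusminus> c * f(x + y)\<close> shows that
  \<open>u(x + w)\<close> is close to \<open>p(x) * u(w)\<close> (\<open>extremal_estimate\<close>), and a limit of \<open>u\<close> along a maximising
  sequence is a multiple of a character.
\<close>

section \<open>The Haar integral\<close>

lemma space_haar [simp]: "space haar = (UNIV :: 'g::compact_connected_ab_group set)"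
  using sets_eq_imp_space_eq[OF sets_haar] by simp

lemma finite_measure_haar: "finite_measure haar"
  by (intro finite_measureI) (simp add: emeasure_haar_UNIV)

lemma measure_haar_UNIV [simp]: "measure haar UNIV = 1"
  by (simp add: measure_def emeasure_haar_UNIV)

lemma borel_measurable_haar_iff: "f \<in> borel_measurable haar \<longleftrightarrow> f \<in> borel_measurable borel"
  by (simp add: measurable_cong_sets[OF sets_haar refl])

lemma continuous_measurable_haar:
  fixes f :: "'g::compact_connected_ab_group \<Rightarrow> 'b::topological_space"
  assumes "continuous_on UNIV f"
  shows "f \<in> borel_measurable haar"
  using borel_measurable_continuous_onI[OF assms] by (simp add: borel_measurable_haar_iff)

lemma integrable_const_haar [simp]: "integrable haar (\<lambda>x. c :: 'b::{banach, second_countable_topology})"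
  using finite_measure.integrable_const[OF finite_measure_haar] .

lemma norm_integral_le_integral:
  fixes f :: "'a \<Rightarrow> 'b::{banach, second_countable_topology}"
  assumes "integrable M f" "integrable M g" "\<And>x. norm (f x) \<le> g x"
  shows "norm (integral\<^sup>L M f) \<le> integral\<^sup>L M g"
  by (rule order_trans[OF integral_norm_bound integral_mono]) (use assms in auto)

lemma continuous_bounded_haar:
  fixes f :: "'g::compact_connected_ab_group \<Rightarrow> 'b::real_normed_vector"
  assumes "continuous_on UNIV f"
  obtains C where "C \<ge> 0" "\<And>x. norm (f x) \<le> C"
proof -
  have "bounded (range f)"
    using assms compact_UNIV_group compact_continuous_image compact_imp_bounded by blast
  then obtain C where "\<And>x. norm (f x) \<le> C"
    by (auto simp: bounded_iff)
  then show ?thesis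
    using that[of "max C 0"] by (simp add: le_max_iff_disj)
qed

lemma integrable_continuous_mult_haar:
  fixes f g :: "'g::compact_connected_ab_group \<Rightarrow> complex"
  assumes "continuous_on UNIV f" "integrable haar g"
  shows "integrable haar (\<lambda>x. f x * g x)"
proof -
  obtain C where C: "C \<ge> 0" "\<And>x. norm (f x) \<le> C"
    using continuous_bounded_haar[OF assms(1)] by blast
  have [measurable]: "f \<in> borel_measurable haar" "g \<in> borel_measurable haar"
    using continuous_measurable_haar[OF assms(1)] assms(2) by auto
  show ?thesis
  proof (rule Bochner_Integration.integrable_bound)
    show "integrable haar (\<lambda>x. C * norm (g x))"
      using assms(2) by auto
    show "AE x in haar. norm (f x * g x) \<le> norm (C * norm (g x))"
      using C by (auto simp: norm_mult intro!: mult_right_mono)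
  qed measurable
qed

lemma integrable_continuous_haar:
  fixes f :: "'g::compact_connected_ab_group \<Rightarrow> 'b::{banach, second_countable_topology}"
  assumes "continuous_on UNIV f"
  shows "integrable haar f"
proof -
  obtain C where C: "C \<ge> 0" "\<And>x. norm (f x) \<le> C"
    using continuous_bounded_haar[OF assms(1)] by blast
  show ?thesis
    by (rule Bochner_Integration.integrable_bound[of haar "\<lambda>_. C"])
      (use C continuous_measurable_haar[OF assms] in auto)
qed

lemma integral_haar_translation:
  fixes f :: "'g::compact_connected_ab_group \<Rightarrow> 'b::{banach, second_countable_topology}"
  assumes "f \<in> borel_measurable haar"
  shows "(LINT y|haar. f (x + y)) = (LINT y|haar. f y)"
proof -
  have cont: "continuous_on UNIV ((+) x)"
    by (intro continuous_intros)
  have m: "(+) x \<in> measurable haar (haar :: 'g measure)"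
    using borel_measurable_continuous_onI[OF cont]
    by (simp add: measurable_cong_sets[OF sets_haar sets_haar])
  have "distr haar haar ((+) x) = haar"
  proof (rule measure_eqI)
    fix B assume "B \<in> sets (distr haar haar ((+) x))"
    then have B: "B \<in> sets haar" "B \<in> sets borel"
      by (auto simp: sets_haar)
    have "(+) x -` B = (+) (- x) ` B"
    proof safe
      show "y \<in> (+) (- x) ` B" if "x + y \<in> B" for y
        using that by (intro image_eqI[of _ _ "x + y"]) auto
    qed simp
    then show "emeasure (distr haar haar ((+) x)) B = emeasure haar B"
      using B m haar_translation[of B "- x"] by (simp add: emeasure_distr)
  qed simp
  then have "(LINT y|haar. f y) = (LINT y|distr haar haar ((+) x). f y)"
    by simp
  also have "\<dots> = (LINT y|haar. f (x + y))"
    by (rule integral_distr[OF m assms])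
  finally show ?thesis
    by simp
qed

text \<open>A null open set would have finitely many null translates covering the group.\<close>

lemma emeasure_haar_open_pos:
  fixes U :: "'g::compact_connected_ab_group set"
  assumes "open U" "U \<noteq> {}"
  shows "emeasure haar U \<noteq> 0"
proof
  assume 0: "emeasure haar U = 0"
  obtain u where u: "u \<in> U"
    using assms by auto
  have tr: "(+) x ` U = (\<lambda>y. y - x) -` U" for x
  proof safe
    show "y \<in> (+) x ` U" if "y - x \<in> U" for y
      using that by (intro image_eqI[of _ _ "y - x"]) auto
  qed simp
  have op: "open ((+) x ` U)" for x
    unfolding tr by (rule open_vimage[OF assms(1)]) (intro continuous_intros)
  have "UNIV \<subseteq> (\<Union>x\<in>UNIV. (+) x ` U)"
  proof
    fix y show "y \<in> (\<Union>x\<in>UNIV. (+) x ` U)"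
      using u by (intro UN_I[of "y - u"] image_eqI[of _ _ u]) auto
  qed
  then obtain F where F: "finite F" "UNIV \<subseteq> (\<Union>x\<in>F. (+) x ` U)"
    using compactE_image[OF compact_UNIV_group, of UNIV "\<lambda>x. (+) x ` U"] op
    by (metis UNIV_I)
  have "emeasure haar (\<Union>x\<in>F. (+) x ` U) \<le> (\<Sum>x\<in>F. emeasure haar ((+) x ` U))"
    by (rule emeasure_subadditive_finite[OF F(1)]) (use op in \<open>auto simp: sets_haar\<close>)
  also have "\<dots> = 0"
    using assms(1) 0 by (simp add: haar_translation)
  finally have "emeasure haar (UNIV :: 'g set) = 0"
    using F(2) by (simp add: top.extremum_unique)
  then show False
    by (simp add: emeasure_haar_UNIV)
qed

lemma continuous_integral_square_eq_0:
  fixes f :: "'g::compact_connected_ab_group \<Rightarrow> complex"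
  assumes f: "continuous_on UNIV f" and 0: "(LINT x|haar. (cmod (f x))\<^sup>2) = 0"
  shows "f x = 0"
proof -
  have "integrable haar (\<lambda>x. (cmod (f x))\<^sup>2)"
    by (intro integrable_continuous_haar continuous_intros f)
  then have ae: "AE x in haar. f x = 0"
    using 0 by (simp add: integral_nonneg_eq_0_iff_AE)
  have op: "open (f -` (- {0}))"
    by (rule open_vimage) (use f in auto)
  have "f -` (- {0}) \<in> sets haar"
    using op by (simp add: sets_haar)
  then have "emeasure haar (f -` (- {0})) = 0"
    using ae AE_iff_measurable[of "f -` (- {0})" haar "\<lambda>x. f x = 0"] by (simp add: vimage_def)
  then have "f -` (- {0}) = {}"
    using emeasure_haar_open_pos[OF op] by blast
  then show ?thesis
    by blast
qed


section \<open>Integral operators with continuous kernels\<close>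

lemma continuous_section:
  fixes K :: "'g::topological_space \<Rightarrow> 'h::topological_space \<Rightarrow> complex"
  assumes "continuous_on UNIV (\<lambda>(x, y). K x y)"
  shows "continuous_on UNIV (K x)" "continuous_on UNIV (\<lambda>x. K x y)"
proof -
  have "continuous_on UNIV (\<lambda>y. (x, y))" "continuous_on UNIV (\<lambda>x. (x, y))"
    by (intro continuous_intros)+
  then show "continuous_on UNIV (K x)" "continuous_on UNIV (\<lambda>x. K x y)"
    using continuous_on_compose2[OF assms, of UNIV "\<lambda>y. (x, y)"]
      continuous_on_compose2[OF assms, of UNIV "\<lambda>x. (x, y)"] by auto
qed

lemma kernel_swap_continuous:
  fixes K :: "'g::topological_space \<Rightarrow> 'h::topological_space \<Rightarrow> complex"
  assumes "continuous_on UNIV (\<lambda>(x, y). K x y)"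
  shows "continuous_on UNIV (\<lambda>(y, x). K x y)"
proof -
  have "continuous_on UNIV (\<lambda>p. (\<lambda>(x, y). K x y) (snd p, fst p))"
    by (rule continuous_on_compose2[OF assms]) (auto intro!: continuous_intros)
  then show ?thesis
    by (simp add: case_prod_beta')
qed

lemma kernel_uniform_nhd:
  fixes K :: "'g::compact_connected_ab_group \<Rightarrow> 'g \<Rightarrow> complex"
  assumes K: "continuous_on UNIV (\<lambda>(x, y). K x y)" and "e > 0"
  obtains U where "x0 \<in> U" "open U" "\<And>x y. x \<in> U \<Longrightarrow> cmod (K x y - K x0 y) \<le> e"
proof -
  have "continuous_on (UNIV \<times> UNIV) (\<lambda>(x, y). K x y)"
    using K by simp
  from continuous_on_prod_compactE[OF this compact_UNIV_group UNIV_I[of x0] \<open>e > 0\<close>]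
  obtain U where U: "x0 \<in> U" "open U"
      "\<forall>x\<in>U \<inter> UNIV. \<forall>t\<in>UNIV. dist (case (x, t) of (x, y) \<Rightarrow> K x y) (case (x0, t) of (x, y) \<Rightarrow> K x y) \<le> e"
    by blast
  show ?thesis
    by (rule that[OF U(1,2)]) (use U(3) in \<open>simp add: dist_norm\<close>)
qed

text \<open>
  The group need not be second countable, so a continuous kernel need not be measurable for the
  product of the Borel algebras. A finite Borel partition on whose cells the kernel is almost
  constant in \<open>y\<close>, uniformly in \<open>x\<close>, replaces the theory of product measures.
\<close>

lemma kernel_partition:
  fixes K :: "'g::compact_connected_ab_group \<Rightarrow> 'g \<Rightarrow> complex"
  assumes K: "continuous_on UNIV (\<lambda>(x, y). K x y)" and e: "e > 0"
  obtains n :: nat and z :: "nat \<Rightarrow> 'g" and B :: "nat \<Rightarrow> 'g set"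
  where "range B \<subseteq> sets haar" "disjoint_family B" "(\<Union>i<n. B i) = UNIV"
    "\<forall>i<n. \<forall>y\<in>B i. \<forall>x. cmod (K x y - K x (z i)) \<le> e"
proof -
  have "\<exists>U. y0 \<in> U \<and> open U \<and> (\<forall>y\<in>U. \<forall>x. cmod (K x y - K x y0) \<le> e)" for y0
    by (rule kernel_uniform_nhd[OF kernel_swap_continuous[OF K] e, of y0]) blast
  then obtain U where U: "\<And>y. y \<in> U y" "\<And>y. open (U y)"
      "\<And>y0 y x. y \<in> U y0 \<Longrightarrow> cmod (K x y - K x y0) \<le> e"
    by metis
  have "UNIV \<subseteq> (\<Union>y\<in>UNIV. U y)"
    using U(1) by blast
  then obtain F where F: "finite F" "UNIV \<subseteq> (\<Union>y\<in>F. U y)"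
    using compactE_image[OF compact_UNIV_group, of UNIV U] U(2) by (metis UNIV_I)
  obtain z :: "nat \<Rightarrow> 'g" and n where z: "F = z ` {i. i < n}"
    using finite_imp_nat_seg_image_inj_on[OF F(1)] by blast
  define V where "V i = (if i < n then U (z i) else {})" for i
  have V: "V i \<in> sets haar" for i
    using U(2) by (auto simp: V_def sets_haar)
  show ?thesis
  proof
    show "range (disjointed V) \<subseteq> sets haar"
      using V by (auto simp: disjointed_def)
    show "disjoint_family (disjointed V)"
      by (rule disjoint_family_disjointed)
    have "(\<Union>i<n. disjointed V i) = (\<Union>i<n. V i)"
      using finite_UN_disjointed_eq[of V n] by (simp add: atLeast0LessThan)
    also have "\<dots> = UNIV"
      using F(2) unfolding z V_def by auto
    finally show "(\<Union>i<n. disjointed V i) = UNIV" .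
    show "\<forall>i<n. \<forall>y\<in>disjointed V i. \<forall>x. cmod (K x y - K x (z i)) \<le> e"
      using U(3) disjointed_subset[of V] by (fastforce simp: V_def)
  qed
qed

lemma riemann_sum_bound:
  fixes L g :: "'g::compact_connected_ab_group \<Rightarrow> complex" and n :: nat
  assumes B: "range B \<subseteq> sets haar" "disjoint_family B" "(\<Union>i<n. B i) = UNIV"
    and L: "continuous_on UNIV L" and g: "integrable haar g"
    and c: "\<And>i y. i < n \<Longrightarrow> y \<in> B i \<Longrightarrow> cmod (L y - L (z i)) \<le> c"
  shows "cmod ((LINT y|haar. L y * g y) - (\<Sum>i<n. L (z i) * (LINT y:B i|haar. g y)))
    \<le> c * (LINT y|haar. cmod (g y))"
proof -
  have gi: "integrable haar (\<lambda>y. indicator (B i) y *\<^sub>R g y)" for i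
    using B(1) g by (intro integrable_mult_indicator) auto
  have Lg: "integrable haar (\<lambda>y. L y * g y)"
    by (rule integrable_continuous_mult_haar[OF L g])
  have "(\<Sum>i<n. L (z i) * (LINT y:B i|haar. g y)) =
      (LINT y|haar. (\<Sum>i<n. L (z i) * (indicator (B i) y *\<^sub>R g y)))"
    using gi by (simp add: set_lebesgue_integral_def del: mult_scaleR_right)
  then have "(LINT y|haar. L y * g y) - (\<Sum>i<n. L (z i) * (LINT y:B i|haar. g y)) =
      (LINT y|haar. L y * g y - (\<Sum>i<n. L (z i) * (indicator (B i) y *\<^sub>R g y)))"
    using gi Lg by (simp del: mult_scaleR_right)
  also have "cmod \<dots> \<le> (LINT y|haar. c * cmod (g y))"
  proof (rule norm_integral_le_integral)
    show "integrable haar (\<lambda>y. L y * g y - (\<Sum>i<n. L (z i) * (indicator (B i) y *\<^sub>R g y)))"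
      using gi Lg by (simp del: mult_scaleR_right)
    show "integrable haar (\<lambda>y. c * cmod (g y))"
      using g by simp
    fix y :: 'g
    obtain i where i: "i < n" "y \<in> B i"
      using B(3) by blast
    have "(\<Sum>j<n. L (z j) * (indicator (B j) y *\<^sub>R g y)) = (\<Sum>j<n. if j = i then L (z i) * g y else 0)"
      using B(2) i by (intro sum.cong refl) (auto simp: disjoint_family_on_def indicator_def)
    also have "\<dots> = L (z i) * g y"
      using i(1) by (subst sum.delta) auto
    finally have "cmod (L y * g y - (\<Sum>j<n. L (z j) * (indicator (B j) y *\<^sub>R g y))) =
        cmod (L y - L (z i)) * cmod (g y)"
      by (simp add: norm_mult left_diff_distrib[symmetric])
    also have "\<dots> \<le> c * cmod (g y)"
      using c[OF i] by (intro mult_right_mono) auto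
    finally show "cmod (L y * g y - (\<Sum>j<n. L (z j) * (indicator (B j) y *\<^sub>R g y))) \<le> c * cmod (g y)" .
  qed
  finally show ?thesis
    by simp
qed

lemma kernel_integral_diff:
  fixes K :: "'g::compact_connected_ab_group \<Rightarrow> 'g \<Rightarrow> complex"
  assumes K: "continuous_on UNIV (\<lambda>(x, y). K x y)" and g: "integrable haar g"
    and c: "\<And>y. cmod (K x y - K x' y) \<le> c"
  shows "cmod ((LINT y|haar. K x y * g y) - (LINT y|haar. K x' y * g y)) \<le> c * (LINT y|haar. cmod (g y))"
proof -
  have i: "integrable haar (\<lambda>y. K x y * g y)" for x
    by (rule integrable_continuous_mult_haar[OF continuous_section(1)[OF K] g])
  have "(LINT y|haar. K x y * g y) - (LINT y|haar. K x' y * g y) =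
      (LINT y|haar. (K x y - K x' y) * g y)"
    using i by (simp add: left_diff_distrib)
  also have "cmod \<dots> \<le> (LINT y|haar. c * cmod (g y))"
  proof (rule norm_integral_le_integral)
    show "integrable haar (\<lambda>y. (K x y - K x' y) * g y)"
      using i by (simp add: left_diff_distrib)
    show "integrable haar (\<lambda>y. c * cmod (g y))"
      using g by simp
    show "cmod ((K x y - K x' y) * g y) \<le> c * cmod (g y)" for y
      using c by (simp add: norm_mult mult_right_mono)
  qed
  finally show ?thesis
    by simp
qed

lemma kernel_integral_continuous:
  fixes K :: "'g::compact_connected_ab_group \<Rightarrow> 'g \<Rightarrow> complex"
  assumes K: "continuous_on UNIV (\<lambda>(x, y). K x y)" and g: "integrable haar g"
  shows "continuous_on UNIV (\<lambda>x. LINT y|haar. K x y * g y)"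
  unfolding continuous_on_def
proof (intro ballI tendstoI)
  fix x0 :: 'g and e :: real
  assume e: "e > 0"
  let ?I = "LINT y|haar. cmod (g y)"
  have I: "?I \<ge> 0"
    by simp
  have "e / (?I + 1) > 0"
    using e I by (intro divide_pos_pos add_nonneg_pos) auto
  then obtain U where U: "x0 \<in> U" "open U" "\<And>x y. x \<in> U \<Longrightarrow> cmod (K x y - K x0 y) \<le> e / (?I + 1)"
    using kernel_uniform_nhd[OF K, of "e / (?I + 1)" x0] by blast
  have "dist (LINT y|haar. K x y * g y) (LINT y|haar. K x0 y * g y) < e" if "x \<in> U" for x
  proof -
    have "dist (LINT y|haar. K x y * g y) (LINT y|haar. K x0 y * g y) \<le> e / (?I + 1) * ?I"
      unfolding dist_norm by (rule kernel_integral_diff[OF K g U(3)[OF that]])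
    also have "\<dots> < e"
      using e I by (simp add: field_simps add_pos_nonneg)
    finally show ?thesis .
  qed
  with U(1,2) show "\<forall>\<^sub>F x in at x0 within UNIV. dist (LINT y|haar. K x y * g y) (LINT y|haar. K x0 y * g y) < e"
    unfolding eventually_at_topological by blast
qed

text \<open>
  Both iterated integrals are close to the same Riemann sum over a partition that is adapted to
  the kernel.
\<close>

lemma kernel_fubini:
  fixes K :: "'g::compact_connected_ab_group \<Rightarrow> 'g \<Rightarrow> complex"
  assumes K: "continuous_on UNIV (\<lambda>(x, y). K x y)"
    and g: "integrable haar g" and h: "integrable haar h"
  shows "(LINT x|haar. (LINT y|haar. K x y * g y) * h x) = (LINT y|haar. (LINT x|haar. K x y * h x) * g y)"
    (is "?l = ?r")
proof -
  let ?G = "LINT y|haar. cmod (g y)" and ?H = "LINT x|haar. cmod (h x)"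
  have bd: "cmod (?l - ?r) \<le> e * (2 * ?G * ?H)" if e: "e > 0" for e
  proof -
    obtain n :: nat and z :: "nat \<Rightarrow> 'g" and B :: "nat \<Rightarrow> 'g set" where B: "range B \<subseteq> sets (haar :: 'g measure)" "disjoint_family B" "(\<Union>i<n. B i) = UNIV"
      "\<forall>i<n. \<forall>y\<in>B i. \<forall>x. cmod (K x y - K x (z i)) \<le> e"
      by (rule kernel_partition[OF K e]) (rule that; assumption)
    define w where "w i = (LINT y:B i|haar. g y)" for i
    let ?F = "\<lambda>x. LINT y|haar. K x y * g y" and ?L = "\<lambda>y. LINT x|haar. K x y * h x"
    let ?s = "\<Sum>i<n. ?L (z i) * w i"
    have Kh: "integrable haar (\<lambda>x. K x y * h x)" for y
      by (rule integrable_continuous_mult_haar[OF continuous_section(2)[OF K] h])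
    have Fh: "integrable haar (\<lambda>x. ?F x * h x)"
      by (rule integrable_continuous_mult_haar[OF kernel_integral_continuous[OF K g] h])
    have "?l - ?s = (LINT x|haar. ?F x * h x - (\<Sum>i<n. (K x (z i) * h x) * w i))"
      using Kh Fh by simp
    also have "cmod \<dots> \<le> (LINT x|haar. (e * ?G) * cmod (h x))"
    proof (rule norm_integral_le_integral)
      show "integrable haar (\<lambda>x. ?F x * h x - (\<Sum>i<n. (K x (z i) * h x) * w i))"
        using Kh Fh by simp
      show "integrable haar (\<lambda>x. (e * ?G) * cmod (h x))"
        using h by simp
      fix x
      have "?F x * h x - (\<Sum>i<n. (K x (z i) * h x) * w i) = (?F x - (\<Sum>i<n. K x (z i) * w i)) * h x"
        by (simp add: algebra_simps sum_distrib_left)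
      moreover have "cmod (?F x - (\<Sum>i<n. K x (z i) * w i)) \<le> e * ?G"
        unfolding w_def by (rule riemann_sum_bound[OF B(1-3) continuous_section(1)[OF K] g])
          (use B(4) in blast)
      ultimately show "cmod (?F x * h x - (\<Sum>i<n. (K x (z i) * h x) * w i)) \<le> (e * ?G) * cmod (h x)"
        by (simp add: norm_mult mult_right_mono)
    qed
    finally have 1: "cmod (?l - ?s) \<le> e * ?G * ?H"
      by simp
    have sw: "continuous_on UNIV (\<lambda>(y, x). K x y)"
      by (rule kernel_swap_continuous[OF K])
    have "cmod (?r - ?s) \<le> e * ?H * ?G"
      unfolding w_def
    proof (rule riemann_sum_bound[OF B(1-3) _ g])
      show "continuous_on UNIV ?L"
        by (rule kernel_integral_continuous[OF sw h])
      show "cmod (?L y - ?L (z i)) \<le> e * ?H" if "i < n" "y \<in> B i" for i y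
        by (rule kernel_integral_diff[OF sw h]) (use B(4) that in blast)
    qed
    with 1 have "cmod ((?l - ?s) - (?r - ?s)) \<le> e * ?G * ?H + e * ?H * ?G"
      by (meson add_mono norm_triangle_ineq4 order_trans)
    then show ?thesis
      by (simp add: algebra_simps)
  qed
  have "cmod (?l - ?r) \<le> 0 + e" if "e > 0" for e
  proof -
    have GH: "2 * ?G * ?H \<ge> 0"
      by simp
    have "cmod (?l - ?r) \<le> e / (2 * ?G * ?H + 1) * (2 * ?G * ?H)"
      using GH that by (intro bd divide_pos_pos add_nonneg_pos) auto
    also have "\<dots> \<le> e"
      using GH that by (simp add: field_simps add_pos_nonneg del: mult_nonneg_nonneg)
    finally show ?thesis by simp
  qed
  then have "cmod (?l - ?r) \<le> 0"
    by (rule field_le_epsilon)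
  then show ?thesis
    by simp
qed


section \<open>Correlations of continuous functions\<close>

definition correlation ::
    "('g::compact_connected_ab_group \<Rightarrow> complex) \<Rightarrow> ('g \<Rightarrow> complex) \<Rightarrow> 'g \<Rightarrow> complex" where
  "correlation f g x = (LINT y|haar. f (x + y) * cnj (g y))"

definition energy :: "('g::compact_connected_ab_group \<Rightarrow> complex) \<Rightarrow> real" where
  "energy f = (LINT x|haar. (cmod (f x))\<^sup>2)"

lemma continuous_translate:
  fixes f :: "'g::topological_ab_group_add \<Rightarrow> 'b::topological_space"
  assumes "continuous_on UNIV f"
  shows "continuous_on UNIV (\<lambda>y. f (x + y))"
  by (rule continuous_on_compose2[OF assms]) (auto intro!: continuous_intros)

lemma translate_kernel_continuous:
  fixes f :: "'g::topological_ab_group_add \<Rightarrow> complex"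
  assumes "continuous_on UNIV f"
  shows "continuous_on UNIV (\<lambda>(x, y). f (x + y))"
  unfolding case_prod_beta'
  by (rule continuous_on_compose2[OF assms]) (auto intro!: continuous_intros)

lemma correlation_integrable:
  assumes "continuous_on UNIV f" "continuous_on UNIV g"
  shows "integrable haar (\<lambda>y. f (x + y) * cnj (g y))"
  by (intro integrable_continuous_haar continuous_intros continuous_translate assms)

lemma correlation_continuous:
  assumes "continuous_on UNIV f" "continuous_on UNIV g"
  shows "continuous_on UNIV (correlation f g)"
  unfolding correlation_def
  by (rule kernel_integral_continuous[OF translate_kernel_continuous[OF assms(1)]])
    (intro integrable_continuous_haar continuous_intros assms)

lemma correlation_add_left:
  assumes "continuous_on UNIV f" "continuous_on UNIV f'" "continuous_on UNIV g"
  shows "correlation (\<lambda>y. f y + c * f' y) g x = correlation f g x + c * correlation f' g x"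
proof -
  have "correlation (\<lambda>y. f y + c * f' y) g x =
      (LINT y|haar. f (x + y) * cnj (g y) + c * (f' (x + y) * cnj (g y)))"
    unfolding correlation_def by (simp add: algebra_simps)
  then show ?thesis
    using correlation_integrable[OF assms(1,3)] correlation_integrable[OF assms(2,3)]
    by (simp add: correlation_def)
qed

lemma correlation_add_right:
  assumes "continuous_on UNIV f" "continuous_on UNIV g" "continuous_on UNIV g'"
  shows "correlation f (\<lambda>y. g y + c * g' y) x = correlation f g x + cnj c * correlation f g' x"
proof -
  have "correlation f (\<lambda>y. g y + c * g' y) x =
      (LINT y|haar. f (x + y) * cnj (g y) + cnj c * (f (x + y) * cnj (g' y)))"
    unfolding correlation_def by (simp add: algebra_simps)
  then show ?thesis
    using correlation_integrable[OF assms(1,2)] correlation_integrable[OF assms(1,3)]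
    by (simp add: correlation_def)
qed

lemma correlation_scale_left: "correlation (\<lambda>y. c * f y) g x = c * correlation f g x"
  by (simp add: correlation_def mult.assoc)

lemma correlation_scale_right: "correlation f (\<lambda>y. c * g y) x = cnj c * correlation f g x"
  by (simp add: correlation_def mult.left_commute)

lemma correlation_translate_left: "correlation (\<lambda>y. f (z + y)) g x = correlation f g (z + x)"
  by (simp add: correlation_def add.assoc)

lemma correlation_translate_right:
  assumes "continuous_on UNIV f" "continuous_on UNIV g"
  shows "correlation f (\<lambda>y. g (z + y)) x = correlation f g (x - z)"
proof -
  have "(LINT y|haar. (\<lambda>y. f (x - z + y) * cnj (g y)) (z + y)) =
      (LINT y|haar. (\<lambda>y. f (x - z + y) * cnj (g y)) y)"
    by (rule integral_haar_translation)
      (intro continuous_measurable_haar continuous_intros continuous_translate assms)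
  then show ?thesis
    by (simp add: correlation_def add.assoc[symmetric])
qed

lemma correlation_self_0: "correlation f f 0 = complex_of_real (energy f)"
  unfolding correlation_def energy_def integral_complex_of_real[symmetric]
  by (simp only: complex_norm_square add_0_left)

lemma correlation_self_minus:
  assumes "continuous_on UNIV f"
  shows "correlation f f (- x) = cnj (correlation f f x)"
proof -
  have "correlation f f (- x) = correlation f (\<lambda>y. f (x + y)) 0"
    using correlation_translate_right[OF assms assms, of x 0] by simp
  also have "\<dots> = (LINT y|haar. cnj (f (x + y) * cnj (f y)))"
    by (simp add: correlation_def mult.commute)
  also have "\<dots> = cnj (correlation f f x)"
    unfolding correlation_def by (rule Bochner_Integration.integral_cnj)
  finally show ?thesis .
qed

lemma energy_nonneg [simp]: "0 \<le> energy f"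
  by (simp add: energy_def)

lemma energy_integrable:
  "continuous_on UNIV f \<Longrightarrow> integrable haar (\<lambda>x. (cmod (f x))\<^sup>2)"
  by (intro integrable_continuous_haar continuous_intros)

lemma energy_eq_0: "continuous_on UNIV f \<Longrightarrow> energy f = 0 \<Longrightarrow> f x = 0"
  unfolding energy_def by (rule continuous_integral_square_eq_0)

lemma energy_scale: "energy (\<lambda>x. c * f x) = (cmod c)\<^sup>2 * energy f"
  by (simp add: energy_def norm_mult power_mult_distrib)

lemma energy_translate: "continuous_on UNIV f \<Longrightarrow> energy (\<lambda>y. f (x + y)) = energy f"
  unfolding energy_def
  by (rule integral_haar_translation[of "\<lambda>y. (cmod (f y))\<^sup>2" x])
    (intro continuous_measurable_haar continuous_intros)

lemma correlation_self_bound: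
  assumes "continuous_on UNIV f"
  shows "cmod (correlation f f x) \<le> energy f"
proof -
  note i = energy_integrable[OF assms] energy_integrable[OF continuous_translate[OF assms]]
  have "cmod (correlation f f x) \<le> (LINT y|haar. ((cmod (f (x + y)))\<^sup>2 + (cmod (f y))\<^sup>2) / 2)"
    unfolding correlation_def
  proof (rule norm_integral_le_integral)
    show "integrable haar (\<lambda>y. f (x + y) * cnj (f y))"
      by (rule correlation_integrable[OF assms assms])
    show "integrable haar (\<lambda>y. ((cmod (f (x + y)))\<^sup>2 + (cmod (f y))\<^sup>2) / 2)"
      using i by simp
    show "cmod (f (x + y) * cnj (f y)) \<le> ((cmod (f (x + y)))\<^sup>2 + (cmod (f y))\<^sup>2) / 2" for y
      using sum_squares_bound[of "cmod (f (x + y))" "cmod (f y)"] by (simp add: norm_mult)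
  qed
  also have "\<dots> = (energy (\<lambda>y. f (x + y)) + energy f) / 2"
    using i by (simp add: energy_def)
  finally show ?thesis
    by (simp add: energy_translate[OF assms])
qed


section \<open>An extremal problem solved by characters\<close>

text \<open>
  The Fourier coefficients of \<open>response k f\<close> are those of \<open>k\<close> times the squared moduli of those
  of \<open>f\<close>. With \<open>energy f\<close> fixed, these squared moduli are nonnegative weights of fixed total mass, and
  the energy of the response is largest when they sit at one character at which the coefficient of
  \<open>k\<close> has maximal modulus. The lemmas of this section extract such a character without
  presupposing that there are any.
\<close>

definition response ::
    "('g::compact_connected_ab_group \<Rightarrow> complex) \<Rightarrow> ('g \<Rightarrow> complex) \<Rightarrow> 'g \<Rightarrow> complex" where
  "response k f = correlation k (correlation f f)"

lemma response_continuous: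
  "continuous_on UNIV k \<Longrightarrow> continuous_on UNIV f \<Longrightarrow> continuous_on UNIV (response k f)"
  unfolding response_def by (intro correlation_continuous)

lemma correlation_self_perturbed:
  assumes f: "continuous_on UNIV f" and c: "cmod c = 1"
  shows "correlation (\<lambda>y. f y + c * f (x + y)) (\<lambda>y. f y + c * f (x + y)) z =
    2 * correlation f f z + (c * correlation f f (x + z) + cnj c * correlation f f (- x + z))"
proof -
  note t = continuous_translate[OF f, of x]
  have "c * cnj c = 1"
    using c complex_norm_square[of c] by simp
  then have cc: "c * (cnj c * w) = w" for w
    by (simp only: mult.assoc[symmetric] mult_1)
  let ?h = "\<lambda>y. f y + c * f (x + y)"
  have h: "continuous_on UNIV ?h"
    by (intro continuous_intros f t)
  have r: "correlation f ?h z = correlation f f z + cnj c * correlation f f (z - x)" for z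
    by (simp only: correlation_add_right[OF f f t] correlation_translate_right[OF f f])
  have "correlation ?h ?h z = correlation f ?h z + c * correlation f ?h (x + z)"
    by (simp only: correlation_add_left[OF f t h] correlation_translate_left)
  also have "\<dots> = 2 * correlation f f z + (c * correlation f f (x + z) + cnj c * correlation f f (- x + z))"
    by (simp only: r distrib_left cc) simp
  finally show ?thesis .
qed

lemma energy_perturbed:
  assumes f: "continuous_on UNIV f" and c: "cmod c = 1"
  shows "energy (\<lambda>y. f y + c * f (x + y)) = 2 * energy f + 2 * Re (c * correlation f f x)"
proof -
  have "complex_of_real (energy (\<lambda>y. f y + c * f (x + y))) =
      2 * complex_of_real (energy f) + (c * correlation f f x + cnj (c * correlation f f x))"
    unfolding correlation_self_0[symmetric]
    by (simp add: correlation_self_perturbed[OF f c] correlation_self_minus[OF f])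
  then have "Re (complex_of_real (energy (\<lambda>y. f y + c * f (x + y)))) =
      Re (2 * complex_of_real (energy f) + (c * correlation f f x + cnj (c * correlation f f x)))"
    by simp
  then show ?thesis
    by simp
qed

lemma response_perturbed:
  assumes k: "continuous_on UNIV k" and f: "continuous_on UNIV f" and c: "cmod c = 1"
  shows "response k (\<lambda>y. f y + c * f (x + y)) w =
    2 * response k f w + (c * response k f (x + w) + cnj c * response k f (- x + w))"
proof -
  define p where "p = correlation f f"
  have p: "continuous_on UNIV p"
    unfolding p_def by (rule correlation_continuous[OF f f])
  have eq: "correlation (\<lambda>y. f y + c * f (x + y)) (\<lambda>y. f y + c * f (x + y)) =
      (\<lambda>z. (c * p (x + z) + cnj c * p (- x + z)) + 2 * p z)"
    by (rule ext) (simp add: correlation_self_perturbed[OF f c] p_def)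
  have "correlation k (\<lambda>z. c * p (x + z)) w = cnj c * correlation k p (w - x)"
    using correlation_add_right[OF k, of "\<lambda>_. 0" "\<lambda>z. p (x + z)" c w]
      correlation_translate_right[OF k p, of x w] continuous_translate[OF p, of x]
    by (simp add: correlation_def)
  moreover have "correlation k (\<lambda>z. c * p (x + z) + cnj c * p (- x + z)) w =
      correlation k (\<lambda>z. c * p (x + z)) w + cnj (cnj c) * correlation k (\<lambda>z. p (- x + z)) w"
    by (intro correlation_add_right continuous_intros continuous_translate k p)
  moreover have "correlation k (\<lambda>z. p (- x + z)) w = correlation k p (w + x)"
    by (simp only: correlation_translate_right[OF k p] diff_minus_eq_add)
  moreover have "response k (\<lambda>y. f y + c * f (x + y)) w =
      correlation k (\<lambda>z. c * p (x + z) + cnj c * p (- x + z)) w + cnj 2 * correlation k p w"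
    unfolding response_def eq
    by (intro correlation_add_right continuous_intros continuous_translate k p)
  ultimately show ?thesis
    by (simp add: response_def p_def algebra_simps)
qed

text \<open>
  Replacing \<open>f\<close> by \<open>f \<plusminus> c \<cdot> f(x + \<cdot>)\<close> splits the autocorrelation of \<open>f\<close>, and with it the
  response, into a convex combination, and the energy is strictly convex. The identity
  \<open>|U - 2ru|\<^sup>2 = (1-r)/2 |2u+U|\<^sup>2 + (1+r)/2 |2u-U|\<^sup>2 - 4(1-r\<^sup>2)|u|\<^sup>2\<close> turns near-maximality into
  near-equality.
\<close>

lemma extremal_estimate_symmetric:
  assumes k: "continuous_on UNIV k" and f: "continuous_on UNIV f" and e: "energy f = 1"
    and S: "\<And>f. continuous_on UNIV f \<Longrightarrow> energy (response k f) \<le> S * (energy f)\<^sup>2"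
    and c: "cmod c = 1"
  shows "energy (\<lambda>w. c * response k f (x + w) + cnj c * response k f (- x + w)
      - complex_of_real (2 * Re (c * correlation f f x)) * response k f w) \<le>
    4 * (S - energy (response k f))"
proof -
  define u where "u = response k f"
  define r where "r = Re (c * correlation f f x)"
  define U where "U w = c * u (x + w) + cnj c * u (- x + w)" for w
  have u: "continuous_on UNIV u"
    unfolding u_def by (rule response_continuous[OF k f])
  have U: "continuous_on UNIV U"
    unfolding U_def by (intro continuous_intros continuous_translate u)
  have "\<bar>r\<bar> \<le> cmod (c * correlation f f x)"
    unfolding r_def by (rule abs_Re_le_cmod)
  also have "\<dots> \<le> 1"
    using correlation_self_bound[OF f, of x] e c by (simp add: norm_mult)
  finally have r: "\<bar>r\<bar> \<le> 1" .
  have resp: "energy (\<lambda>w. 2 * u w + U w) \<le> S * (2 + 2 * r)\<^sup>2" "energy (\<lambda>w. 2 * u w - U w) \<le> S * (2 - 2 * r)\<^sup>2"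
  proof -
    have *: "energy (response k (\<lambda>y. f y + d * f (x + y))) \<le> S * (2 + 2 * Re (d * correlation f f x))\<^sup>2"
      if "cmod d = 1" for d
    proof -
      have "continuous_on UNIV (\<lambda>y. f y + d * f (x + y))"
        by (intro continuous_intros continuous_translate f)
      from S[OF this] show ?thesis
        by (simp add: energy_perturbed[OF f that] e)
    qed
    have "response k (\<lambda>y. f y + c * f (x + y)) = (\<lambda>w. 2 * u w + U w)"
      by (rule ext) (simp add: response_perturbed[OF k f c] u_def U_def)
    then show "energy (\<lambda>w. 2 * u w + U w) \<le> S * (2 + 2 * r)\<^sup>2"
      using *[OF c] by (simp add: r_def)
    have minus: "2 + 2 * Re (- c * correlation f f x) = 2 - 2 * r"
      by (simp add: r_def)
    have "response k (\<lambda>y. f y + (- c) * f (x + y)) = (\<lambda>w. 2 * u w - U w)"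
      by (rule ext, subst response_perturbed[OF k f]) (use c in \<open>simp_all add: u_def U_def\<close>)
    then show "energy (\<lambda>w. 2 * u w - U w) \<le> S * (2 - 2 * r)\<^sup>2"
      using *[of "- c"] c unfolding minus by (simp only: norm_minus_cancel)
  qed
  have pt: "(cmod (U w - complex_of_real (2 * r) * u w))\<^sup>2 =
      (1 - r) / 2 * (cmod (2 * u w + U w))\<^sup>2 + (1 + r) / 2 * (cmod (2 * u w - U w))\<^sup>2
      - 4 * (1 - r\<^sup>2) * (cmod (u w))\<^sup>2" for w
    unfolding cmod_power2 by (simp add: power2_eq_square field_simps)
  have "energy (\<lambda>w. U w - complex_of_real (2 * r) * u w) =
      (1 - r) / 2 * energy (\<lambda>w. 2 * u w + U w) + (1 + r) / 2 * energy (\<lambda>w. 2 * u w - U w)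
      - 4 * (1 - r\<^sup>2) * energy u"
  proof -
    have "integrable haar (\<lambda>w. (cmod (2 * u w + U w))\<^sup>2)" "integrable haar (\<lambda>w. (cmod (2 * u w - U w))\<^sup>2)"
        "integrable haar (\<lambda>w. (cmod (u w))\<^sup>2)"
      by (intro energy_integrable continuous_intros u U)+
    then show ?thesis
      unfolding energy_def pt by simp
  qed
  also have "\<dots> \<le> (1 - r) / 2 * (S * (2 + 2 * r)\<^sup>2) + (1 + r) / 2 * (S * (2 - 2 * r)\<^sup>2) - 4 * (1 - r\<^sup>2) * energy u"
    using resp r by (intro diff_right_mono add_mono mult_left_mono) auto
  also have "\<dots> = 4 * ((1 - r\<^sup>2) * (S - energy u))"
    by (simp add: power2_eq_square field_simps)
  also have "\<dots> \<le> 4 * (1 * (S - energy u))"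
  proof -
    have "energy u \<le> S"
      using S[OF f] e by (simp add: u_def)
    then show ?thesis
      by (intro mult_left_mono mult_right_mono) auto
  qed
  finally show ?thesis
    by (simp add: U_def u_def r_def)
qed

lemma extremal_estimate:
  assumes k: "continuous_on UNIV k" and f: "continuous_on UNIV f" and e: "energy f = 1"
    and S: "\<And>f. continuous_on UNIV f \<Longrightarrow> energy (response k f) \<le> S * (energy f)\<^sup>2"
  shows "energy (\<lambda>w. response k f (x + w) - correlation f f x * response k f w) \<le>
    4 * (S - energy (response k f))"
proof -
  define u where "u = response k f"
  define p where "p = correlation f f x"
  define V where "V c w = c * u (x + w) + cnj c * u (- x + w) - complex_of_real (2 * Re (c * p)) * u w" for c w
  have u: "continuous_on UNIV u"
    unfolding u_def by (rule response_continuous[OF k f])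
  have V: "continuous_on UNIV (V c)" for c
    unfolding V_def by (intro continuous_intros continuous_translate u)
  have le: "energy (V c) \<le> 4 * (S - energy u)" if "cmod c = 1" for c
    unfolding V_def u_def p_def by (rule extremal_estimate_symmetric[OF k f e S that])
  (* V c is the sum of a part proportional to c and a part proportional to the conjugate of c;
     the values 1 and i of c isolate the former *)
  have "2 * (u (x + w) - p * u w) = V 1 w - \<i> * V \<i> w" for w
    unfolding V_def by (simp add: complex_eq_iff algebra_simps)
  then have "4 * (cmod (u (x + w) - p * u w))\<^sup>2 = (cmod (V 1 w - \<i> * V \<i> w))\<^sup>2" for w
    by (metis norm_mult norm_numeral power_mult_distrib power2_eq_square num_double numeral_times_numeral)
  moreover have "(cmod (V 1 w - \<i> * V \<i> w))\<^sup>2 \<le> 2 * (cmod (V 1 w))\<^sup>2 + 2 * (cmod (V \<i> w))\<^sup>2" for w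
  proof -
    have "(cmod (V 1 w - \<i> * V \<i> w))\<^sup>2 \<le> (cmod (V 1 w) + cmod (V \<i> w))\<^sup>2"
      using norm_triangle_ineq4[of "V 1 w" "\<i> * V \<i> w"] by (intro power_mono) (auto simp: norm_mult)
    also have "\<dots> \<le> 2 * (cmod (V 1 w))\<^sup>2 + 2 * (cmod (V \<i> w))\<^sup>2"
      using sum_squares_bound[of "cmod (V 1 w)" "cmod (V \<i> w)"] by (simp add: power2_sum)
    finally show ?thesis .
  qed
  ultimately have pt: "4 * (cmod (u (x + w) - p * u w))\<^sup>2 \<le> 2 * (cmod (V 1 w))\<^sup>2 + 2 * (cmod (V \<i> w))\<^sup>2" for w
    by simp
  have "4 * energy (\<lambda>w. u (x + w) - p * u w) = (LINT w|haar. 4 * (cmod (u (x + w) - p * u w))\<^sup>2)"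
    by (simp add: energy_def)
  also have "\<dots> \<le> (LINT w|haar. 2 * (cmod (V 1 w))\<^sup>2 + 2 * (cmod (V \<i> w))\<^sup>2)"
    using pt by (intro integral_mono integrable_continuous_haar continuous_intros continuous_translate u V) auto
  also have "\<dots> = 2 * energy (V 1) + 2 * energy (V \<i>)"
    using energy_integrable[OF V] by (simp add: energy_def)
  also have "\<dots> \<le> 2 * (4 * (S - energy u)) + 2 * (4 * (S - energy u))"
    using le by (intro add_mono mult_left_mono) auto
  finally show ?thesis
    by (simp add: u_def p_def)
qed


section \<open>Existence of characters\<close>

text \<open>
  The compact spaces below are products of uncountably many factors, in which a sequence need not
  have a convergent subsequence. Passing to a finer filter on the index set replaces the
  subsequence.
\<close>

lemma filter_cluster_pullback:
  fixes T :: "'i \<Rightarrow> 'b::topological_space"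
  assumes "compact C" "\<And>n. T n \<in> C" "F \<noteq> bot"
  obtains F' l where "F' \<le> F" "F' \<noteq> bot" "(T \<longlongrightarrow> l) F'"
proof -
  have "filtermap T F \<noteq> bot" "eventually (\<lambda>x. x \<in> C) (filtermap T F)"
    using assms(2,3) by (auto simp: filtermap_bot_iff eventually_filtermap)
  then obtain l where l: "inf (nhds l) (filtermap T F) \<noteq> bot"
    using assms(1) unfolding compact_filter by blast
  define F' where "F' = inf (filtercomap T (nhds l)) F"
  have "F' \<noteq> bot"
  proof
    assume "F' = bot"
    then have "eventually (\<lambda>_. False) F'"
      by simp
    then obtain P Q where P: "eventually P (nhds l)" and Q: "eventually Q F"
        and PQ: "\<And>n. P (T n) \<Longrightarrow> Q n \<Longrightarrow> False"
      unfolding F'_def eventually_inf eventually_filtercomap by blast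
    have "eventually (\<lambda>y. \<exists>n. y = T n \<and> Q n) (filtermap T F)"
      unfolding eventually_filtermap using Q by (rule eventually_mono) blast
    with P have "eventually (\<lambda>_. False) (inf (nhds l) (filtermap T F))"
      unfolding eventually_inf using PQ by blast
    with l show False
      by (simp add: eventually_False)
  qed
  moreover have "(T \<longlongrightarrow> l) F'"
    unfolding F'_def filterlim_iff_le_filtercomap by simp
  moreover have "F' \<le> F"
    by (simp add: F'_def)
  ultimately show ?thesis
    using that by blast
qed

lemma compact_Pi_UNIV:
  fixes S :: "'i \<Rightarrow> 'b::topological_space set"
  assumes "\<And>i. compact (S i)"
  shows "compact (Pi UNIV S)"
proof -
  have "compactin (product_topology (\<lambda>_. euclidean) UNIV) (PiE UNIV S)"
    using assms by (simp add: compactin_PiE)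
  then show ?thesis
    by (simp add: euclidean_product_topology PiE_UNIV_domain)
qed

text \<open>
  A compactness principle of Arzela--Ascoli type for an arbitrary compact group: Tychonoff's
  theorem gives pointwise limits along a finer filter, and the common modulus of continuity
  coming from the kernel makes the convergence of the integrals uniform.
\<close>

lemma kernel_integral_cluster:
  fixes K :: "'g::compact_connected_ab_group \<Rightarrow> 'g \<Rightarrow> complex"
  assumes K: "continuous_on UNIV (\<lambda>(x, y). K x y)"
    and g: "\<And>n. integrable haar (g n)" "\<And>n y. cmod (g n y) \<le> 1"
    and F: "F \<noteq> bot"
  obtains F' u c where "F' \<le> F" "F' \<noteq> bot"
    "uniform_limit UNIV (\<lambda>n x. LINT y|haar. K x y * g n y) u F'" "\<forall>y. ((\<lambda>n. g n y) \<longlongrightarrow> c y) F'"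
proof -
  define v where "v n x = (LINT y|haar. K x y * g n y)" for n x
  obtain C where C: "\<And>x y. cmod (K x y) \<le> C"
  proof -
    have "compact ((\<lambda>(x, y). K x y) ` (UNIV \<times> UNIV))"
      using K compact_Times[OF compact_UNIV_group compact_UNIV_group]
      by (intro compact_continuous_image) auto
    then have "bounded ((\<lambda>(x, y). K x y) ` UNIV)"
      by (simp add: compact_imp_bounded)
    then obtain C where "\<forall>z\<in>(\<lambda>(x, y). K x y) ` UNIV. cmod z \<le> C"
      unfolding bounded_iff by blast
    then have "cmod (K x y) \<le> C" for x y
      by (force simp: image_iff)
    then show ?thesis
      by (rule that)
  qed
  have gint: "(LINT y|haar. cmod (g n y)) \<le> 1" for n
  proof -
    have "(LINT y|haar. cmod (g n y)) \<le> (LINT y|(haar :: 'g measure). 1)"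
      using g by (intro integral_mono) auto
    then show ?thesis
      by simp
  qed
  have v: "cmod (v n x) \<le> C" for n x
  proof -
    have "cmod (v n x) \<le> (LINT y|(haar :: 'g measure). C)"
      unfolding v_def
    proof (rule norm_integral_le_integral)
      show "integrable haar (\<lambda>y. K x y * g n y)"
        by (rule integrable_continuous_mult_haar[OF continuous_section(1)[OF K] g(1)])
      show "cmod (K x y * g n y) \<le> C" for y
        using mult_mono[OF C[of x y] g(2)[of n y]] C[of x y] norm_ge_zero[of "K x y"] by (simp add: norm_mult)
    qed simp
    then show ?thesis
      by simp
  qed
  have comp: "compact (Pi UNIV (\<lambda>_ :: 'g. cball (0 :: complex) C \<times> cball (0 :: complex) 1))"
    by (intro compact_Pi_UNIV compact_Times compact_cball)
  have mem: "(\<lambda>x. (v n x, g n x)) \<in> Pi UNIV (\<lambda>_. cball 0 C \<times> cball 0 1)" for n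
    using v g(2) by auto
  obtain F' l where F': "F' \<le> F" "F' \<noteq> bot" and l: "((\<lambda>n x. (v n x, g n x)) \<longlongrightarrow> l) F'"
    by (rule filter_cluster_pullback[OF comp mem F])
  have lx: "((\<lambda>n. (v n x, g n x)) \<longlongrightarrow> l x) F'" for x
  proof (rule topological_tendstoI)
    fix S :: "(complex \<times> complex) set"
    assume S: "open S" "l x \<in> S"
    have "open ((\<lambda>h. h x) -` S)"
      by (rule open_vimage[OF S(1) continuous_on_product_coordinates])
    from topological_tendstoD[OF l this] S(2) show "\<forall>\<^sub>F n in F'. (v n x, g n x) \<in> S"
      by simp
  qed
  define u where "u x = fst (l x)" for x
  define c where "c x = snd (l x)" for x
  have ptu: "((\<lambda>n. v n x) \<longlongrightarrow> u x) F'" for x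
    using tendsto_fst[OF lx[of x]] by (simp add: u_def)
  have ptc: "((\<lambda>n. g n x) \<longlongrightarrow> c x) F'" for x
    using tendsto_snd[OF lx[of x]] by (simp add: c_def)
  have "uniform_limit UNIV v u F'"
  proof (rule uniform_limitI)
    fix e :: real
    assume e: "e > 0"
    then have e4: "e / 4 > 0"
      by simp
    obtain N :: nat and z :: "nat \<Rightarrow> 'g" and B :: "nat \<Rightarrow> 'g set" where
      B: "range B \<subseteq> sets (haar :: 'g measure)" "disjoint_family B" "(\<Union>i<N. B i) = UNIV"
      "\<forall>i<N. \<forall>x\<in>B i. \<forall>y. cmod (K x y - K (z i) y) \<le> e / 4"
      by (rule kernel_partition[OF kernel_swap_continuous[OF K] e4]) (rule that; assumption)
    have close: "cmod (v n x - v n (z i)) \<le> e / 4" if "i < N" "x \<in> B i" for n x i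
    proof -
      have "cmod (v n x - v n (z i)) \<le> e / 4 * (LINT y|haar. cmod (g n y))"
        unfolding v_def by (rule kernel_integral_diff[OF K g(1)]) (use B(4) that in blast)
      also have "\<dots> \<le> e / 4 * 1"
        using gint e by (intro mult_left_mono) auto
      finally show ?thesis by simp
    qed
    have closeu: "cmod (u x - u (z i)) \<le> e / 4" if "i < N" "x \<in> B i" for x i
      by (rule tendsto_upperbound[OF tendsto_norm[OF tendsto_diff[OF ptu ptu]] _ F'(2)])
        (use close[OF that] in simp)
    have "eventually (\<lambda>n. \<forall>i\<in>{..<N}. dist (v n (z i)) (u (z i)) < e / 4) F'"
      using e by (intro eventually_ball_finite ballI tendstoD[OF ptu]) auto
    then show "\<forall>\<^sub>F n in F'. \<forall>x\<in>UNIV. dist (v n x) (u x) < e"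
    proof eventually_elim
      case (elim n)
      show ?case
      proof
        fix x :: 'g
        obtain i where i: "i < N" "x \<in> B i"
          using B(3) by blast
        have "cmod (v n x - u x) \<le> cmod (v n x - v n (z i)) + cmod (v n (z i) - u (z i)) + cmod (u x - u (z i))"
          using norm_triangle_ineq[of "v n x - v n (z i)" "v n (z i) - u (z i)"]
            norm_triangle_ineq4[of "v n x - u (z i)" "u x - u (z i)"] by (simp add: algebra_simps)
        moreover have "cmod (v n (z i) - u (z i)) < e / 4"
          using elim i(1) by (simp add: dist_norm)
        ultimately show "dist (v n x) (u x) < e"
          unfolding dist_norm using close[OF i, of n] closeu[OF i] e by linarith
      qed
    qed
  qed
  then show ?thesis
    using that[OF F'] ptc unfolding v_def by blast
qed

lemma uniform_limit_integral_haar: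
  fixes v :: "'i \<Rightarrow> 'g::compact_connected_ab_group \<Rightarrow> complex"
  assumes "uniform_limit UNIV v u F" "\<And>n. integrable haar (v n)" "integrable haar u"
  shows "((\<lambda>n. LINT x|haar. v n x) \<longlongrightarrow> (LINT x|haar. u x)) F"
proof (rule tendstoI)
  fix e :: real
  assume "e > 0"
  then have "\<forall>\<^sub>F n in F. \<forall>x\<in>UNIV. dist (v n x) (u x) < e / 2"
    using assms(1) by (intro uniform_limitD) auto
  then show "\<forall>\<^sub>F n in F. dist (LINT x|haar. v n x) (LINT x|haar. u x) < e"
  proof eventually_elim
    case (elim n)
    have "cmod (LINT x|haar. v n x - u x) \<le> (LINT x|(haar :: 'g measure). e / 2)"
      using elim assms(2,3) by (intro norm_integral_le_integral) (auto simp: dist_norm less_imp_le)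
    then show ?case
      using assms(2,3) \<open>e > 0\<close> by (simp add: dist_norm)
  qed
qed

lemma energy_as_integral: "complex_of_real (energy f) = (LINT x|haar. f x * cnj (f x))"
  unfolding energy_def integral_complex_of_real[symmetric] by (simp only: complex_norm_square)

lemma uniform_limit_energy:
  fixes v :: "'i \<Rightarrow> 'g::compact_connected_ab_group \<Rightarrow> complex"
  assumes lim: "uniform_limit UNIV v u F" and v: "\<And>n. continuous_on UNIV (v n)" and u: "continuous_on UNIV u"
  shows "((\<lambda>n. energy (v n)) \<longlongrightarrow> energy u) F"
proof -
  have "bounded (range u)" "bounded (range (\<lambda>x. cnj (u x)))"
    by (intro compact_imp_bounded compact_continuous_image compact_UNIV_group continuous_intros u)+
  then have "uniform_limit UNIV (\<lambda>n x. v n x * cnj (v n x)) (\<lambda>x. u x * cnj (u x)) F"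
    by (intro uniform_limit_intros lim) auto
  then have "((\<lambda>n. LINT x|haar. v n x * cnj (v n x)) \<longlongrightarrow> (LINT x|haar. u x * cnj (u x))) F"
    by (rule uniform_limit_integral_haar) (intro integrable_continuous_haar continuous_intros u v)+
  from tendsto_Re[OF this] show ?thesis
    by (simp flip: energy_as_integral)
qed

lemma character_continuous: "\<psi> \<in> characters \<Longrightarrow> continuous_on UNIV \<psi>"
  by (simp add: characters_def)

lemma character_add: "\<psi> \<in> characters \<Longrightarrow> \<psi> (x + y) = \<psi> x * \<psi> y"
  by (simp add: characters_def)

lemma character_norm: "\<psi> \<in> characters \<Longrightarrow> cmod (\<psi> x) = 1"
  by (simp add: characters_def)

lemma character_cnj_mult [simp]: "\<psi> \<in> characters \<Longrightarrow> \<psi> x * cnj (\<psi> x) = 1"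
  using complex_norm_square[of "\<psi> x"] by (simp add: character_norm)

text \<open>
  The eigenvalues are unimodular because translations preserve the energy, and \<open>u\<close> is their multiple
  by \<open>u 0\<close>, so that they inherit the continuity of \<open>u\<close>.
\<close>

lemma simultaneous_eigenfunction_character:
  fixes u :: "'g::compact_connected_ab_group \<Rightarrow> complex"
  assumes u: "continuous_on UNIV u" "u \<noteq> (\<lambda>_. 0)" and c: "\<And>x w. u (x + w) = c x * u w"
  shows "c \<in> characters" "u x = u 0 * c x" "u 0 \<noteq> 0"
proof -
  have ux: "u x = u 0 * c x" for x
    using c[of x 0] by (simp add: mult.commute)
  show u0: "u 0 \<noteq> 0"
  proof
    assume "u 0 = 0"
    then have "u x = 0" for x
      by (subst ux) simp
    with u(2) show False
      by blast
  qed
  show "u x = u 0 * c x"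
    by (rule ux)
  have cc: "c = (\<lambda>x. u x / u 0)"
  proof
    show "c x = u x / u 0" for x
      by (subst ux[of x]) (use u0 in simp)
  qed
  have "continuous_on UNIV c"
    unfolding cc by (intro continuous_intros u) (use u0 in auto)
  moreover have "cmod (c x) = 1" for x
  proof -
    have "energy u = energy (\<lambda>w. u (x + w))"
      using energy_translate[OF u(1)] by simp
    also have "\<dots> = (cmod (c x))\<^sup>2 * energy u"
      by (simp only: c energy_scale)
    finally have "energy u = 0 \<or> (cmod (c x))\<^sup>2 = 1"
      by auto
    moreover have "energy u \<noteq> 0"
      using energy_eq_0[OF u(1)] u(2) by blast
    ultimately show ?thesis
      by (simp add: power2_eq_1_iff) (use norm_ge_zero[of "c x"] in linarith)
  qed
  moreover have "c (x + y) = c x * c y" for x y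
  proof -
    have "u 0 * c (x + y) = u 0 * (c x * c y)"
      using c[of x y] ux[of "x + y"] ux[of y] by simp
    with u0 show ?thesis
      by simp
  qed
  ultimately show "c \<in> characters"
    by (simp add: characters_def)
qed

text \<open>
  Among the normalised continuous \<open>f\<close>, an almost maximal energy of the response forces the response to
  be almost an eigenfunction of every translation, with eigenvalues close to the autocorrelation
  of \<open>f\<close>. A cluster point of a maximising sequence is therefore a nonzero multiple of a character. If
  this character were orthogonal to \<open>k\<close>, it would be orthogonal to all responses, and thus to the
  cluster point.
\<close>

theorem character_not_orthogonal:
  fixes k :: "'g::compact_connected_ab_group \<Rightarrow> complex"
  assumes k: "continuous_on UNIV k" and nz: "k x0 \<noteq> 0"
  obtains \<psi> where "\<psi> \<in> characters" "(LINT x|haar. k x * cnj (\<psi> x)) \<noteq> 0"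
proof -
  let ?A = "{energy (response k f) | f. continuous_on UNIV f \<and> energy f = 1}"
  define S where "S = Sup ?A"
  have Ek: "energy k > 0"
    using energy_eq_0[OF k] nz energy_nonneg[of k] by (metis order_le_less)
  obtain C where C: "C \<ge> 0" "\<And>x. cmod (k x) \<le> C"
    using continuous_bounded_haar[OF k] by blast
  have pf: "cmod (correlation f f x) \<le> 1" if "continuous_on UNIV f" "energy f = 1"
    for f :: "'g \<Rightarrow> complex" and x
    using correlation_self_bound[OF that(1), of x] that(2) by simp
  have "energy (response k f) \<le> C\<^sup>2" if f: "continuous_on UNIV f" "energy f = 1" for f
  proof -
    have "cmod (response k f x) \<le> C" for x
    proof -
      have "cmod (response k f x) \<le> (LINT y|(haar :: 'g measure). C)"
        unfolding response_def correlation_def[of k]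
      proof (rule norm_integral_le_integral)
        show "integrable haar (\<lambda>y. k (x + y) * cnj (correlation f f y))"
          by (intro correlation_integrable k correlation_continuous f)
        show "cmod (k (x + y) * cnj (correlation f f y)) \<le> C" for y
          using mult_mono[OF C(2)[of "x + y"] pf[OF f, of y]] C(1) by (simp add: norm_mult)
      qed simp
      then show ?thesis
        by simp
    qed
    then have "energy (response k f) \<le> (LINT y|(haar :: 'g measure). C\<^sup>2)"
      unfolding energy_def
      by (intro integral_mono energy_integrable response_continuous k f power_mono) auto
    then show ?thesis
      by simp
  qed
  then have bdd: "bdd_above ?A"
    by (intro bdd_aboveI[of _ "C\<^sup>2"]) auto
  have le_S: "energy (response k f) \<le> S" if "continuous_on UNIV f" "energy f = 1" for f
    unfolding S_def by (rule cSup_upper[OF _ bdd]) (use that in auto)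
  have scale: "response k (\<lambda>x. complex_of_real t * f x) w = complex_of_real (t\<^sup>2) * response k f w" for t f w
  proof -
    have "correlation (\<lambda>x. complex_of_real t * f x) (\<lambda>x. complex_of_real t * f x) =
        (\<lambda>x. complex_of_real (t\<^sup>2) * correlation f f x)"
      by (simp add: fun_eq_iff correlation_scale_left correlation_scale_right power2_eq_square)
    then show ?thesis
      unfolding response_def by (simp add: correlation_scale_right)
  qed
  have S: "energy (response k f) \<le> S * (energy f)\<^sup>2" if f: "continuous_on UNIV f" for f
  proof (cases "energy f = 0")
    case True
    then have "f = (\<lambda>_. 0)"
      using energy_eq_0[OF f] by auto
    then show ?thesis
      by (simp add: response_def correlation_def energy_def)
  next
    case False
    define t where "t = inverse (sqrt (energy f))"
    have E: "energy f > 0"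
      using False energy_nonneg[of f] by linarith
    have t2: "t\<^sup>2 = inverse (energy f)"
      using E by (simp add: t_def power_inverse)
    have "energy (response k (\<lambda>x. complex_of_real t * f x)) \<le> S"
    proof (rule le_S)
      show "continuous_on UNIV (\<lambda>x. complex_of_real t * f x)"
        by (intro continuous_intros f)
      show "energy (\<lambda>x. complex_of_real t * f x) = 1"
        using E t2 by (simp add: energy_scale)
    qed
    then have "(t\<^sup>2)\<^sup>2 * energy (response k f) \<le> S"
      unfolding scale energy_scale by (simp only: norm_of_real abs_power2)
    then show ?thesis
      using E unfolding t2 by (simp add: field_simps power2_eq_square)
  qed
  (* if the response of k to k vanished, so would its pairing with k, which is the energy of the
     autocorrelation of k *)
  have Spos: "S > 0"
  proof (rule ccontr)
    assume "\<not> S > 0"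
    then have "S * (energy k)\<^sup>2 \<le> 0"
      by (simp add: mult_nonpos_nonneg)
    then have "energy (response k k) = 0"
      using S[OF k] energy_nonneg[of "response k k"] by linarith
    then have u0: "response k k x = 0" for x
      using energy_eq_0[OF response_continuous[OF k k]] by blast
    define p where "p = correlation k k"
    have p: "continuous_on UNIV p"
      unfolding p_def by (rule correlation_continuous[OF k k])
    have "complex_of_real (energy p) = (LINT x|haar. (LINT y|haar. k (x + y) * cnj (k y)) * cnj (p x))"
      unfolding energy_as_integral by (simp add: p_def correlation_def)
    also have "\<dots> = (LINT y|haar. (LINT x|haar. k (x + y) * cnj (p x)) * cnj (k y))"
      by (rule kernel_fubini[OF translate_kernel_continuous[OF k]])
        (intro integrable_continuous_haar continuous_intros k p)+
    also have "\<dots> = (LINT y|haar. response k k y * cnj (k y))"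
      by (simp add: response_def correlation_def[of k "correlation k k"] p_def add.commute)
    also have "\<dots> = 0"
      by (simp add: u0)
    finally have "p 0 = 0"
      using energy_eq_0[OF p] by simp
    with Ek show False
      by (simp add: p_def correlation_self_0)
  qed
  have "\<exists>f. continuous_on UNIV f \<and> energy f = 1 \<and> energy (response k f) > S - inverse (real (Suc n))" for n
  proof -
    have "?A \<noteq> {}"
    proof -
      have "energy (\<lambda>x::'g. 1) = 1"
        by (simp add: energy_def)
      then show ?thesis
        by (auto intro!: exI[of _ "\<lambda>x. 1"])
    qed
    moreover have "S - inverse (real (Suc n)) < Sup ?A"
      unfolding S_def[symmetric] by simp
    ultimately obtain a where "a \<in> ?A" "S - inverse (real (Suc n)) < a"
      using less_cSup_iff[OF _ bdd] by blast
    then show ?thesis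
      by auto
  qed
  then obtain f where f: "\<And>n. continuous_on UNIV (f n)" "\<And>n. energy (f n) = 1"
      "\<And>n. energy (response k (f n)) > S - inverse (real (Suc n))"
    by metis
  define p where "p n = correlation (f n) (f n)" for n
  define v where "v n = response k (f n)" for n
  have p: "continuous_on UNIV (p n)" "cmod (p n y) \<le> 1" for n y
    unfolding p_def using correlation_continuous[OF f(1) f(1)] pf[OF f(1,2)] by auto
  have vc: "continuous_on UNIV (v n)" for n
    unfolding v_def by (rule response_continuous[OF k f(1)])
  have v_eq: "v n = (\<lambda>x. LINT y|haar. k (x + y) * cnj (p n y))" for n
    by (simp add: v_def response_def correlation_def[of k] p_def fun_eq_iff)
  obtain F' u d where F': "F' \<le> sequentially" "F' \<noteq> bot" and lim: "uniform_limit UNIV v u F'"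
      and d: "\<forall>y. ((\<lambda>n. cnj (p n y)) \<longlongrightarrow> d y) F'"
  proof -
    have gi: "integrable haar (\<lambda>y. cnj (p n y))" for n
      by (intro integrable_continuous_haar continuous_intros p)
    have gb: "cmod (cnj (p n y)) \<le> 1" for n y
      using p(2) by simp
    have v_fun: "v = (\<lambda>n x. LINT y|haar. k (x + y) * cnj (p n y))"
      by (rule ext) (rule v_eq)
    show ?thesis
      by (rule kernel_integral_cluster[OF translate_kernel_continuous[OF k] gi gb sequentially_bot])
        (rule that[unfolded v_fun]; assumption)
  qed
  define c where "c y = cnj (d y)" for y
  have c: "((\<lambda>n. p n y) \<longlongrightarrow> c y) F'" for y
    using tendsto_cnj[OF d[rule_format, of y]] by (simp add: c_def)
  have u: "continuous_on UNIV u"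
    by (rule uniform_limit_theorem[OF _ lim F'(2)]) (use vc in simp)
  have inv0: "((\<lambda>n. inverse (real (Suc n))) \<longlongrightarrow> 0) F'"
    using LIMSEQ_inverse_real_of_nat F'(1) by (rule tendsto_mono[rotated])
  have Eu: "energy u = S"
  proof (rule tendsto_unique[OF F'(2) uniform_limit_energy[OF lim vc u]])
    have lo: "((\<lambda>n. S - inverse (real (Suc n))) \<longlongrightarrow> S) F'"
      using tendsto_diff[OF tendsto_const inv0, of S] by simp
    show "((\<lambda>n. energy (v n)) \<longlongrightarrow> S) F'"
    proof (rule tendsto_sandwich[OF _ _ lo tendsto_const])
      show "\<forall>\<^sub>F n in F'. S - inverse (real (Suc n)) \<le> energy (v n)"
        using f(3) by (intro always_eventually allI) (simp only: v_def less_imp_le)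
      show "\<forall>\<^sub>F n in F'. energy (v n) \<le> S"
        using le_S[OF f(1,2)] by (intro always_eventually allI) (simp only: v_def)
    qed
  qed
  have eig: "u (x + w) = c x * u w" for x w
  proof -
    have lim1: "uniform_limit UNIV (\<lambda>n w. v n (x + w) - p n x * v n w) (\<lambda>w. u (x + w) - c x * u w) F'"
    proof (intro uniform_limit_intros lim)
      show "uniform_limit UNIV (\<lambda>n w. v n (x + w)) (\<lambda>w. u (x + w)) F'"
      proof (rule uniform_limitI)
        fix e :: real
        assume "e > 0"
        from uniform_limitD[OF lim this] show "\<forall>\<^sub>F n in F'. \<forall>w\<in>UNIV. dist (v n (x + w)) (u (x + w)) < e"
          by (rule eventually_mono) simp
      qed
      show "uniform_limit UNIV (\<lambda>n w. p n x) (\<lambda>w. c x) F'"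
        using tendstoD[OF c[of x]] by (auto simp: uniform_limit_iff)
      show "bounded (range u)"
        by (intro compact_imp_bounded compact_continuous_image compact_UNIV_group u)
    qed auto
    have vv: "continuous_on UNIV (\<lambda>w. v n (x + w) - p n x * v n w)" for n
      by (intro continuous_intros continuous_translate vc)
    have uu: "continuous_on UNIV (\<lambda>w. u (x + w) - c x * u w)"
      by (intro continuous_intros continuous_translate u)
    have "((\<lambda>n. energy (\<lambda>w. v n (x + w) - p n x * v n w)) \<longlongrightarrow> 0) F'"
    proof (rule tendsto_sandwich[OF _ _ tendsto_const])
      show "((\<lambda>n. 4 * inverse (real (Suc n))) \<longlongrightarrow> 0) F'"
        using tendsto_mult_right_zero[OF inv0] .
      have "energy (\<lambda>w. v n (x + w) - p n x * v n w) \<le> 4 * inverse (real (Suc n))" for n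
      proof -
        have "energy (\<lambda>w. v n (x + w) - p n x * v n w) \<le> 4 * (S - energy (v n))"
          unfolding v_def p_def by (rule extremal_estimate[OF k f(1) f(2)]) (rule S)
        moreover have "S - energy (v n) \<le> inverse (real (Suc n))"
          using less_imp_le[OF f(3)[of n]] unfolding v_def by (simp only: diff_le_eq add.commute)
        ultimately show ?thesis
          by (meson mult_left_mono order_trans zero_le_numeral)
      qed
      then show "\<forall>\<^sub>F n in F'. energy (\<lambda>w. v n (x + w) - p n x * v n w) \<le> 4 * inverse (real (Suc n))"
        by simp
    qed simp
    from tendsto_unique[OF F'(2) uniform_limit_energy[OF lim1 vv uu] this]
    have "u (x + w) - c x * u w = 0"
      by (rule energy_eq_0[OF uu])
    then show ?thesis
      by simp
  qed
  have "u \<noteq> (\<lambda>_. 0)"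
    using Eu Spos by (auto simp: energy_def)
  note char = simultaneous_eigenfunction_character[OF u this eig]
  note cc = character_continuous[OF char(1)]
  have "(LINT x|haar. k x * cnj (c x)) \<noteq> 0"
  proof
    assume 0: "(LINT x|haar. k x * cnj (c x)) = 0"
    have trans: "(LINT x|haar. k (x + y) * cnj (c x)) = 0" for y
    proof -
      have "(LINT x|haar. (\<lambda>x. k x * cnj (c (- y + x))) (y + x)) = (LINT x|haar. k x * cnj (c (- y + x)))"
        by (rule integral_haar_translation)
          (intro continuous_measurable_haar continuous_intros continuous_translate k cc)
      also have "\<dots> = (LINT x|haar. cnj (c (- y)) * (k x * cnj (c x)))"
        by (simp add: character_add[OF char(1), of "- y"] mult_ac del: add_uminus_conv_diff uminus_add_conv_diff)
      also have "\<dots> = 0"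
        by (simp add: 0)
      finally show ?thesis
        by (simp add: add.commute)
    qed
    have "(LINT x|haar. v n x * cnj (c x)) = 0" for n
    proof -
      have "(LINT x|haar. v n x * cnj (c x)) = (LINT y|haar. (LINT x|haar. k (x + y) * cnj (c x)) * cnj (p n y))"
        unfolding v_eq by (rule kernel_fubini[OF translate_kernel_continuous[OF k]])
          (intro integrable_continuous_haar continuous_intros p cc)+
      then show ?thesis
        by (simp add: trans)
    qed
    moreover have "((\<lambda>n. LINT x|haar. v n x * cnj (c x)) \<longlongrightarrow> (LINT x|haar. u x * cnj (c x))) F'"
    proof (rule uniform_limit_integral_haar)
      show "uniform_limit UNIV (\<lambda>n x. v n x * cnj (c x)) (\<lambda>x. u x * cnj (c x)) F'"
        by (intro uniform_limit_intros lim compact_imp_bounded compact_continuous_image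
            compact_UNIV_group continuous_intros u cc)
    qed (intro integrable_continuous_haar continuous_intros vc u cc)+
    ultimately have "((\<lambda>n. 0) \<longlongrightarrow> (LINT x|haar. u x * cnj (c x))) F'"
      by simp
    then have "(LINT x|haar. u x * cnj (c x)) = 0"
      by (rule tendsto_unique[OF F'(2) _ tendsto_const])
    moreover have "(LINT x|haar. u x * cnj (c x)) = u 0"
    proof -
      have "u x * cnj (c x) = u 0" for x
        using character_cnj_mult[OF char(1), of x] char(2)[of x] by (simp add: mult.assoc)
      then show ?thesis
        by simp
    qed
    ultimately show False
      using char(3) by simp
  qed
  with char(1) show ?thesis
    using that by blast
qed


section \<open>Characters separate points\<close>

lemma character_one: "1 \<in> characters"
  by (simp add: characters_def one_fun_def)

lemma character_mult: "\<psi> \<in> characters \<Longrightarrow> \<xi> \<in> characters \<Longrightarrow> \<psi> * \<xi> \<in> characters"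
  by (auto simp: characters_def times_fun_def norm_mult intro!: continuous_intros)

lemma character_cnj: "\<psi> \<in> characters \<Longrightarrow> cnj_char \<psi> \<in> characters"
  by (auto simp: characters_def cnj_char_def intro!: continuous_intros)

lemma continuous_Urysohn:
  fixes S T :: "'g::compact_connected_ab_group set"
  assumes "closed S" "closed T" "S \<inter> T = {}"
  obtains f :: "'g \<Rightarrow> real" where "continuous_on UNIV f" "\<And>x. 0 \<le> f x" "\<And>x. f x \<le> 1"
    "\<And>x. x \<in> S \<Longrightarrow> f x = 0" "\<And>x. x \<in> T \<Longrightarrow> f x = 1"
proof -
  have "Hausdorff_space (euclidean :: 'g topology)"
    unfolding Hausdorff_space_def disjnt_def using hausdorff by auto
  moreover have "compact_space (euclidean :: 'g topology)"
    using compact_UNIV_group by (simp add: compact_space_def compactin_euclidean_iff)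
  ultimately have "normal_space (euclidean :: 'g topology)"
    by (simp add: compact_Hausdorff_or_regular_imp_normal_space)
  then obtain f where f: "continuous_map euclidean (top_of_set {0..1::real}) f" "f ` S \<subseteq> {0}" "f ` T \<subseteq> {1}"
    using Urysohn_lemma[of euclidean S T 0 1] assms by (auto simp: disjnt_def)
  show ?thesis
  proof
    show "continuous_on UNIV f"
      using f(1) by (simp add: continuous_map_in_subtopology)
    show "0 \<le> f x" "f x \<le> 1" for x
      using f(1) by (auto simp: continuous_map_in_subtopology)
  qed (use f(2,3) in auto)
qed

text \<open>
  Apply the existence theorem to the difference of a function and its translate: a character that
  takes the value one at the translation would be orthogonal to that difference.
\<close>

lemma characters_separate:
  fixes x y :: "'g::compact_connected_ab_group"
  assumes "x \<noteq> y"
  obtains \<psi> where "\<psi> \<in> characters" "\<psi> x \<noteq> \<psi> y"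
proof -
  obtain h0 :: "'g \<Rightarrow> real" where h0: "continuous_on UNIV h0" "h0 x = 0" "h0 y = 1"
    by (rule continuous_Urysohn[of "{x}" "{y}"]) (use assms in auto)
  define h where "h z = complex_of_real (h0 z)" for z
  define d where "d = x - y"
  have h: "continuous_on UNIV h"
    unfolding h_def by (intro continuous_intros h0)
  have k: "continuous_on UNIV (\<lambda>z. h (d + z) - h z)"
    by (intro continuous_intros continuous_translate h)
  have ky: "h (d + y) - h y \<noteq> 0"
    using h0 by (simp add: h_def d_def)
  obtain \<psi> where \<psi>: "\<psi> \<in> characters" "(LINT z|haar. (h (d + z) - h z) * cnj (\<psi> z)) \<noteq> 0"
    by (rule character_not_orthogonal[of _ y, OF k ky])
  have \<psi>c: "continuous_on UNIV \<psi>"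
    by (rule character_continuous[OF \<psi>(1)])
  have i: "integrable haar (\<lambda>z. h (d + z) * cnj (\<psi> z))" "integrable haar (\<lambda>z. h z * cnj (\<psi> z))"
    by (intro integrable_continuous_haar continuous_intros continuous_translate h \<psi>c)+
  have "(LINT z|haar. h (d + z) * cnj (\<psi> z)) = (LINT z|haar. (\<lambda>z. h z * cnj (\<psi> (- d + z))) (d + z))"
    by (simp del: add_uminus_conv_diff uminus_add_conv_diff add: add.assoc[symmetric])
  also have "\<dots> = (LINT z|haar. h z * cnj (\<psi> (- d + z)))"
    by (rule integral_haar_translation)
      (intro continuous_measurable_haar continuous_intros continuous_translate h \<psi>c)
  also have "\<dots> = (LINT z|haar. cnj (\<psi> (- d)) * (h z * cnj (\<psi> z)))"
    by (simp add: character_add[OF \<psi>(1), of "- d"] mult_ac del: add_uminus_conv_diff uminus_add_conv_diff)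
  finally have "(LINT z|haar. (h (d + z) - h z) * cnj (\<psi> z)) =
      (cnj (\<psi> (- d)) - 1) * (LINT z|haar. h z * cnj (\<psi> z))"
    using i by (simp add: left_diff_distrib)
  with \<psi>(2) have "\<psi> (- d) \<noteq> 1"
    by auto
  moreover have "\<psi> y = \<psi> (- d) * \<psi> x"
    using character_add[OF \<psi>(1), of "- d" x] by (simp add: d_def)
  ultimately have "\<psi> x \<noteq> \<psi> y"
    using character_norm[OF \<psi>(1), of x] by auto
  with \<psi>(1) show ?thesis
    by (rule that)
qed


section \<open>Trigonometric polynomials are dense\<close>

inductive trig_poly :: "('g::compact_connected_ab_group \<Rightarrow> complex) \<Rightarrow> bool" where
  character: "\<psi> \<in> characters \<Longrightarrow> trig_poly \<psi>"
| scale: "trig_poly f \<Longrightarrow> trig_poly (\<lambda>x. c * f x)"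
| add: "trig_poly f \<Longrightarrow> trig_poly g \<Longrightarrow> trig_poly (\<lambda>x. f x + g x)"

lemma trig_poly_continuous: "trig_poly f \<Longrightarrow> continuous_on UNIV f"
proof (induction rule: trig_poly.induct)
  case (character \<psi>)
  then show ?case
    by (rule character_continuous)
next
  case (scale f c)
  then show ?case
    by (intro continuous_intros)
next
  case (add f g)
  then show ?case
    by (intro continuous_intros)
qed

lemma trig_poly_cnj: "trig_poly f \<Longrightarrow> trig_poly (\<lambda>x. cnj (f x))"
proof (induction rule: trig_poly.induct)
  case (character \<psi>)
  then show ?case
    using trig_poly.character[OF character_cnj[OF character]] by (simp add: cnj_char_def)
next
  case (scale f c)
  from trig_poly.scale[OF scale.IH, of "cnj c"] show ?case
    by simp
next
  case (add f g)
  from trig_poly.add[OF add.IH] show ?case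
    by simp
qed

lemma trig_poly_mult_character:
  assumes "trig_poly f" "\<psi> \<in> characters"
  shows "trig_poly (\<lambda>x. \<psi> x * f x)"
  using assms(1)
proof (induction rule: trig_poly.induct)
  case (character \<xi>)
  then show ?case
    using trig_poly.character[OF character_mult[OF assms(2) character]] by (simp add: times_fun_def)
next
  case (scale f c)
  from trig_poly.scale[OF scale.IH, of c] show ?case
    by (simp add: mult.left_commute)
next
  case (add f g)
  from trig_poly.add[OF add.IH] show ?case
    by (simp add: distrib_left)
qed

lemma trig_poly_mult:
  assumes "trig_poly f" "trig_poly g"
  shows "trig_poly (\<lambda>x. f x * g x)"
  using assms(1)
proof (induction rule: trig_poly.induct)
  case (character \<psi>)
  then show ?case
    by (rule trig_poly_mult_character[OF assms(2)])
next
  case (scale f c)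
  from trig_poly.scale[OF scale.IH, of c] show ?case
    by (simp add: mult.assoc)
next
  case (add f h)
  from trig_poly.add[OF add.IH] show ?case
    by (simp add: distrib_right)
qed

lemma trig_poly_const: "trig_poly (\<lambda>x. c)"
  using trig_poly.scale[OF trig_poly.character[OF character_one], of c] by simp

lemma trig_poly_Re_Im:
  assumes "trig_poly f"
  shows "trig_poly (\<lambda>x. complex_of_real (Re (f x)))" "trig_poly (\<lambda>x. complex_of_real (Im (f x)))"
proof -
  have eq: "complex_of_real (Re z) = 1 / 2 * (z + cnj z)"
    "complex_of_real (Im z) = (- \<i> / 2) * (z + (- 1) * cnj z)" for z
    by (simp_all add: complex_eq_iff)
  show "trig_poly (\<lambda>x. complex_of_real (Re (f x)))" "trig_poly (\<lambda>x. complex_of_real (Im (f x)))"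
    unfolding eq by (intro trig_poly.scale trig_poly.add trig_poly_cnj assms)+
qed

lemma trig_poly_dense_real:
  fixes f :: "'g::compact_connected_ab_group \<Rightarrow> real"
  assumes "continuous_on UNIV f" "e > 0"
  obtains g :: "'g \<Rightarrow> real" where "trig_poly (\<lambda>x. complex_of_real (g x))" "\<forall>x. \<bar>f x - g x\<bar> < e"
proof -
  let ?P = "\<lambda>g :: 'g \<Rightarrow> real. trig_poly (\<lambda>x. complex_of_real (g x))"
  have "\<exists>g. ?P g \<and> (\<forall>x\<in>UNIV. \<bar>f x - g x\<bar> < e)"
  proof (rule Stone_Weierstrass_HOL[where P = ?P and S = UNIV and f = f and e = e])
    show "continuous_on UNIV g" if "?P g" for g
    proof -
      have "continuous_on UNIV (\<lambda>x. Re (complex_of_real (g x)))"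
        by (rule continuous_on_Re[OF trig_poly_continuous[OF that]])
      then show ?thesis
        by simp
    qed
    show "?P g \<and> ?P h \<Longrightarrow> ?P (\<lambda>x. g x + h x)" for g h
      using trig_poly.add[of "\<lambda>x. complex_of_real (g x)" "\<lambda>x. complex_of_real (h x)"] by simp
    show "?P g \<and> ?P h \<Longrightarrow> ?P (\<lambda>x. g x * h x)" for g h
      using trig_poly_mult[of "\<lambda>x. complex_of_real (g x)" "\<lambda>x. complex_of_real (h x)"] by simp
    show "\<exists>g. ?P g \<and> g x \<noteq> g y" if xy: "x \<in> UNIV \<and> y \<in> UNIV \<and> x \<noteq> y" for x y
    proof -
      obtain \<psi> where \<psi>: "\<psi> \<in> characters" "\<psi> x \<noteq> \<psi> y"
        by (rule characters_separate[of x y]) (use xy in auto)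
      then have "Re (\<psi> x) \<noteq> Re (\<psi> y) \<or> Im (\<psi> x) \<noteq> Im (\<psi> y)"
        by (auto simp: complex_eq_iff)
      then show ?thesis
        using trig_poly_Re_Im[OF trig_poly.character[OF \<psi>(1)]]
        by (elim disjE) (rule exI[of _ "\<lambda>x. Re (\<psi> x)"], simp, rule exI[of _ "\<lambda>x. Im (\<psi> x)"], simp)
    qed
    show "trig_poly (\<lambda>x. complex_of_real c)" for c
      by (rule trig_poly_const)
    show "compact (UNIV :: 'g set)"
      by (rule compact_UNIV_group)
    show "continuous_on UNIV f" "0 < e"
      by (rule assms)+
  qed
  then show ?thesis
    using that by blast
qed

lemma trig_poly_dense:
  fixes f :: "'g::compact_connected_ab_group \<Rightarrow> complex"
  assumes f: "continuous_on UNIV f" and e: "e > 0"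
  obtains g where "trig_poly g" "\<And>x. cmod (f x - g x) < e"
proof -
  have e2: "e / 2 > 0"
    using e by simp
  obtain a where a: "trig_poly (\<lambda>x. complex_of_real (a x))" "\<forall>x. \<bar>Re (f x) - a x\<bar> < e / 2"
    by (rule trig_poly_dense_real[OF continuous_on_Re[OF f] e2]) (rule that; assumption)
  obtain b where b: "trig_poly (\<lambda>x. complex_of_real (b x))" "\<forall>x. \<bar>Im (f x) - b x\<bar> < e / 2"
    by (rule trig_poly_dense_real[OF continuous_on_Im[OF f] e2]) (rule that; assumption)
  show ?thesis
  proof
    show "trig_poly (\<lambda>x. complex_of_real (a x) + \<i> * complex_of_real (b x))"
      by (intro trig_poly.add trig_poly.scale a b)
    show "cmod (f x - (complex_of_real (a x) + \<i> * complex_of_real (b x))) < e" for x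
      using cmod_le[of "f x - (complex_of_real (a x) + \<i> * complex_of_real (b x))"] a(2)[rule_format, of x] b(2)[rule_format, of x]
      by simp
  qed
qed


section \<open>The Hilbert space structure\<close>

lemma L2_of_cases: obtains f where "sq_integrable f" "F = L2_of f"
proof -
  have "\<exists>f. sq_integrable f \<and> F = L2_of f"
    by (induction F rule: L2.abs_induct) (auto simp: L2_rel_def)
  then show ?thesis
    using that by blast
qed

lemma L2_rel_self: "sq_integrable f \<Longrightarrow> L2_rel f f"
  by (simp add: L2_rel_def)

lemma L2_of_add: "sq_integrable f \<Longrightarrow> sq_integrable g \<Longrightarrow> L2_of (\<lambda>x. f x + g x) = L2_of f + L2_of g"
  by (simp add: plus_L2.abs_eq L2_rel_self)

lemma L2_of_scale: "sq_integrable f \<Longrightarrow> L2_of (\<lambda>x. c * f x) = cscale c (L2_of f)"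
  by (simp add: cscale.abs_eq L2_rel_self)

lemma L2_of_zero: "L2_of (\<lambda>_. 0) = 0"
  by (simp add: zero_L2.abs_eq)

lemma uminus_eq_cscale: "- f = cscale (- 1) (f :: 'g::compact_connected_ab_group L2)"
  by (simp add: uminus_L2_def)

lemma sq_integrable_diff: "sq_integrable f \<Longrightarrow> sq_integrable g \<Longrightarrow> sq_integrable (\<lambda>x. f x - g x)"
  using sq_integrable_add[of f "\<lambda>x. - 1 * g x"] sq_integrable_scale[of g "- 1"] by simp

lemma L2_of_diff:
  assumes "sq_integrable f" "sq_integrable g"
  shows "L2_of (\<lambda>x. f x - g x) = L2_of f - L2_of g"
proof -
  have "L2_of (\<lambda>x. f x + (- 1) * g x) = L2_of f + cscale (- 1) (L2_of g)"
    using assms by (simp only: L2_of_add L2_of_scale sq_integrable_scale)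
  then show ?thesis
    by (simp add: uminus_eq_cscale[symmetric])
qed

lemma cinner_L2_of:
  "sq_integrable f \<Longrightarrow> sq_integrable g \<Longrightarrow> cinner (L2_of f) (L2_of g) = (LINT x|haar. f x * cnj (g x))"
  by (simp add: cinner.abs_eq L2_rel_self)

lemma norm_L2_of: "sq_integrable f \<Longrightarrow> (norm (L2_of f))\<^sup>2 = (LINT x|haar. (cmod (f x))\<^sup>2)"
proof -
  assume f: "sq_integrable f"
  have "complex_of_real ((norm (L2_of f))\<^sup>2) = (LINT x|haar. f x * cnj (f x))"
    using cinner_self[of "L2_of f"] cinner_L2_of[OF f f] by simp
  also have "\<dots> = complex_of_real (LINT x|haar. (cmod (f x))\<^sup>2)"
    unfolding integral_complex_of_real[symmetric] by (simp only: complex_norm_square)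
  finally show ?thesis
    by (simp only: of_real_eq_iff)
qed

lemma sq_integrable_continuous: "continuous_on UNIV f \<Longrightarrow> sq_integrable f"
  unfolding sq_integrable_def
  by (intro conjI continuous_measurable_haar integrable_continuous_haar continuous_intros)

interpretation cs: vector_space "cscale :: complex \<Rightarrow> 'g::compact_connected_ab_group L2 \<Rightarrow> 'g L2"
  by (rule vector_space_cscale)

lemma cinner_add_left: "cinner (f + g) h = cinner f h + cinner g h"
  by transfer (simp add: L2_rel_def distrib_right integrable_mult_cnj)

lemma cinner_cscale_left: "cinner (cscale c f) h = c * cinner f h"
  by transfer (simp add: mult.assoc)

lemma cinner_cnj: "cinner g f = cnj (cinner f g)"
proof transfer
  fix f g :: "'a \<Rightarrow> complex"
  have "integral\<^sup>L haar (\<lambda>x. g x * cnj (f x)) = integral\<^sup>L haar (\<lambda>x. cnj (f x * cnj (g x)))"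
    by (simp add: mult.commute)
  also have "\<dots> = cnj (integral\<^sup>L haar (\<lambda>x. f x * cnj (g x)))"
    by (rule Bochner_Integration.integral_cnj)
  finally show "integral\<^sup>L haar (\<lambda>x. g x * cnj (f x)) = cnj (integral\<^sup>L haar (\<lambda>x. f x * cnj (g x)))" .
qed

lemma cinner_zero_left [simp]: "cinner 0 h = 0"
  using cinner_cscale_left[of 0 h h] by simp

lemma cinner_zero_right [simp]: "cinner h 0 = 0"
  using cinner_cnj[of h 0] by simp

lemma cinner_diff_left: "cinner (f - g) h = cinner f h - cinner g h"
proof -
  have "f - g = f + cscale (- 1) g"
    by (simp add: uminus_eq_cscale[symmetric])
  then show ?thesis
    by (simp only: cinner_add_left cinner_cscale_left) simp
qed

lemma cinner_sum_left: "cinner (sum f I) h = (\<Sum>i\<in>I. cinner (f i) h)"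
  by (induction I rule: infinite_finite_induct) (auto simp: cinner_add_left)

lemma cinner_add_right: "cinner h (f + g) = cinner h f + cinner h g"
  by (simp only: cinner_cnj[of h "f + g"] cinner_cnj[of h f] cinner_cnj[of h g] cinner_add_left complex_cnj_add)

lemma cinner_cscale_right: "cinner h (cscale c f) = cnj c * cinner h f"
  by (simp only: cinner_cnj[of h "cscale c f"] cinner_cnj[of h f] cinner_cscale_left complex_cnj_mult)

lemma norm_cscale [simp]: "norm (cscale c f) = cmod c * norm f"
proof -
  have "complex_of_real ((norm (cscale c f))\<^sup>2) = (c * cnj c) * cinner f f"
    by (simp only: cinner_self[symmetric] cinner_cscale_left cinner_cscale_right mult.assoc
        mult.left_commute[of "cnj c" c])
  also have "\<dots> = complex_of_real ((cmod c * norm f)\<^sup>2)"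
    by (simp only: complex_norm_square[symmetric] cinner_self power_mult_distrib of_real_mult)
  finally have "complex_of_real ((norm (cscale c f))\<^sup>2) = complex_of_real ((cmod c * norm f)\<^sup>2)" .
  then show ?thesis
    by (simp only: of_real_eq_iff) (simp add: power2_eq_iff_nonneg)
qed

lemma cinner_bound: "cmod (cinner f g) \<le> norm f * norm g"
proof (cases "cinner f g = 0")
  case False
  define c where "c = cnj (cinner f g) / cmod (cinner f g)"
  have "cmod c = 1"
    using False by (simp add: c_def norm_divide)
  have "cinner (cscale c f) g = complex_of_real (cmod (cinner f g))"
  proof -
    have "c * cinner f g = complex_of_real ((cmod (cinner f g))\<^sup>2) / complex_of_real (cmod (cinner f g))"
      by (simp only: complex_norm_square c_def) (simp add: mult.commute)
    then show ?thesis
      using False by (simp add: cinner_cscale_left power2_eq_square)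
  qed
  then have "cmod (cinner f g) = inner (cscale c f) g"
    by (simp add: inner_L2_def)
  also have "\<dots> \<le> norm (cscale c f) * norm g"
    by (rule norm_cauchy_schwarz)
  finally show ?thesis
    using \<open>cmod c = 1\<close> by simp
qed simp

lemma bounded_linear_cinner_left: "bounded_linear (\<lambda>f. cinner f h)"
proof (rule bounded_linear_intro[where K = "norm h"])
  show "cinner (r *\<^sub>R f) h = r *\<^sub>R cinner f h" for r f
    by (simp add: scaleR_L2_def cinner_cscale_left scaleR_conv_of_real)
qed (auto simp: cinner_add_left cinner_bound)

lemma bounded_linear_cscale: "bounded_linear (cscale c)"
  by (rule bounded_linear_intro[where K = "cmod c"])
    (auto simp: cs.scale_right_distrib scaleR_L2_def mult.commute)

lemma subspace_closure:
  fixes V :: "'g::compact_connected_ab_group L2 set"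
  assumes V: "module.subspace cscale V"
  shows "module.subspace cscale (closure V)"
proof (rule cs.subspaceI)
  show "0 \<in> closure V"
    using cs.subspace_0[OF V] closure_subset by blast
  fix f g assume "f \<in> closure V" "g \<in> closure V"
  then obtain a b where "\<And>n. a n \<in> V" "a \<longlonglongrightarrow> f" "\<And>n. b n \<in> V" "b \<longlonglongrightarrow> g"
    unfolding closure_sequential by blast
  then have "(\<lambda>n. a n + b n) \<longlonglongrightarrow> f + g" "\<And>n. a n + b n \<in> V"
    by (auto intro: tendsto_add cs.subspace_add[OF V])
  then show "f + g \<in> closure V"
    unfolding closure_sequential by (intro exI[of _ "\<lambda>n. a n + b n"]) simp
next
  fix c f assume "f \<in> closure V"
  then obtain a where "\<And>n. a n \<in> V" "a \<longlonglongrightarrow> f"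
    unfolding closure_sequential by blast
  then have "(\<lambda>n. cscale c (a n)) \<longlonglongrightarrow> cscale c f" "\<And>n. cscale c (a n) \<in> V"
    by (auto intro: bounded_linear.tendsto[OF bounded_linear_cscale] cs.subspace_scale[OF V])
  then show "cscale c f \<in> closure V"
    unfolding closure_sequential by (intro exI[of _ "\<lambda>n. cscale c (a n)"]) simp
qed


section \<open>Completeness of the characters\<close>

interpretation haar_finite: finite_measure "haar :: 'g::compact_connected_ab_group measure"
  by (rule finite_measure_haar)

lemma compact_sets_haar: "compact (K :: 'g::compact_connected_ab_group set) \<Longrightarrow> K \<in> sets haar"
  by (simp add: sets_haar compact_imp_closed)

lemma haar_inner_approximation:
  fixes B :: "'g::compact_connected_ab_group set"
  assumes B: "B \<in> sets haar" and e: "e > 0"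
  obtains K where "compact K" "K \<subseteq> B" "measure haar (B - K) < e"
proof (rule ccontr)
  assume neg: "\<not> thesis"
  note found = that
  have ge: "measure haar (B - K) \<ge> e" if K: "compact K" "K \<subseteq> B" for K
    using neg found[OF K] by (rule contrapos_np) simp
  have le: "emeasure haar K \<le> ennreal (measure haar B - e)" if K: "compact K" "K \<subseteq> B" for K
    using ge[OF K] haar_finite.finite_measure_Diff[OF B compact_sets_haar[OF K(1)] K(2)]
    unfolding haar_finite.emeasure_eq_measure by (intro ennreal_leI) linarith
  have "emeasure haar B = (SUP K\<in>{K. K \<subseteq> B \<and> compact K}. emeasure haar K)"
    using B by (intro haar_inner_regular) (simp add: sets_haar)
  also have "\<dots> \<le> ennreal (measure haar B - e)"
    using le by (intro SUP_least) auto
  finally have "measure haar B \<le> measure haar B - e"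
    using ge[of "{}"] by (simp add: haar_finite.emeasure_eq_measure)
  with e show False
    by simp
qed

lemma L2_of_in_closure:
  assumes f: "sq_integrable f"
    and approx: "\<And>e. e > 0 \<Longrightarrow>
      \<exists>g. sq_integrable g \<and> L2_of g \<in> closure V \<and> (LINT x|haar. (cmod (f x - g x))\<^sup>2) \<le> e"
  shows "L2_of f \<in> closure V"
proof -
  have "\<exists>h\<in>closure V. dist h (L2_of f) < d" if d: "d > 0" for d
  proof -
    have "d\<^sup>2 / 2 > 0"
      using d by simp
    then obtain g where g: "sq_integrable g" "L2_of g \<in> closure V" "(LINT x|haar. (cmod (f x - g x))\<^sup>2) \<le> d\<^sup>2 / 2"
      using approx by blast
    have "(norm (L2_of f - L2_of g))\<^sup>2 \<le> d\<^sup>2 / 2"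
      using g(3) norm_L2_of[OF sq_integrable_diff[OF f g(1)]] by (simp add: L2_of_diff[OF f g(1)])
    also have "\<dots> < d\<^sup>2"
      using d by simp
    finally have "norm (L2_of f - L2_of g) < d"
      using d by (simp add: power_less_imp_less_base)
    with g(2) show ?thesis
      by (intro bexI[of _ "L2_of g"]) (simp_all add: dist_norm norm_minus_commute)
  qed
  then have "L2_of f \<in> closure (closure V)"
    by (simp only: closure_approachable) blast
  then show ?thesis
    by simp
qed

abbreviation character_hull :: "'g::compact_connected_ab_group L2 set" where
  "character_hull \<equiv> closure (cs.span (L2_of ` characters))"

lemma subspace_character_hull: "cs.subspace character_hull"
  by (intro subspace_closure cs.subspace_span)

lemma trig_poly_in_span: "trig_poly f \<Longrightarrow> L2_of f \<in> cs.span (L2_of ` characters)"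
proof (induction rule: trig_poly.induct)
  case (character \<psi>)
  then show ?case
    by (intro cs.span_base imageI)
next
  case (scale f c)
  then show ?case
    by (simp add: L2_of_scale sq_integrable_continuous trig_poly_continuous cs.span_scale)
next
  case (add f g)
  then show ?case
    by (simp add: L2_of_add sq_integrable_continuous trig_poly_continuous cs.span_add)
qed

lemma continuous_in_character_hull:
  assumes f: "continuous_on UNIV f"
  shows "L2_of f \<in> character_hull"
proof (rule L2_of_in_closure[OF sq_integrable_continuous[OF f]])
  fix e :: real assume e: "e > 0"
  then have "sqrt e > 0"
    by simp
  then obtain g where g: "trig_poly g" "\<And>x. cmod (f x - g x) < sqrt e"
    using trig_poly_dense[OF f] by metis
  have gc: "continuous_on UNIV g"
    by (rule trig_poly_continuous[OF g(1)])
  have pt: "(cmod (f x - g x))\<^sup>2 \<le> e" for x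
    using power_mono[OF less_imp_le[OF g(2)[of x]], of 2] e by simp
  have "(LINT x|haar. (cmod (f x - g x))\<^sup>2) \<le> (LINT x|(haar :: 'a measure). e)"
    using pt by (intro integral_mono integrable_continuous_haar continuous_intros f gc) auto
  then show "\<exists>g. sq_integrable g \<and> L2_of g \<in> character_hull \<and> (LINT x|haar. (cmod (f x - g x))\<^sup>2) \<le> e"
    using g(1) gc trig_poly_in_span closure_subset sq_integrable_continuous
    by (intro exI[of _ g]) auto
qed

lemma sq_integrable_indicator:
  "B \<in> sets haar \<Longrightarrow> sq_integrable (\<lambda>x. complex_of_real (indicator B x))"
proof -
  assume B: "B \<in> sets haar"
  have "(cmod (complex_of_real (indicator B x)))\<^sup>2 = indicator B x" for x
    by (simp add: indicator_def)
  moreover have "integrable haar (indicator B :: _ \<Rightarrow> real)"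
    using B by (intro integrable_real_indicator) (simp_all add: haar_finite.emeasure_eq_measure)
  ultimately show ?thesis
    unfolding sq_integrable_def using B by simp
qed

lemma indicator_compact_in_character_hull:
  fixes K :: "'g::compact_connected_ab_group set"
  assumes K: "compact K"
  shows "L2_of (\<lambda>x. complex_of_real (indicator K x)) \<in> character_hull"
proof (rule L2_of_in_closure[OF sq_integrable_indicator[OF compact_sets_haar[OF K]]])
  fix e :: real assume e: "e > 0"
  have Ks: "K \<in> sets haar"
    by (rule compact_sets_haar[OF K])
  then have "- K \<in> sets haar"
    using sets.compl_sets[OF Ks] by (simp add: Compl_eq_Diff_UNIV)
  then obtain C where C: "compact C" "C \<subseteq> - K" "measure haar (- K - C) < e"
    by (rule haar_inner_approximation[OF _ e])
  obtain h :: "'g \<Rightarrow> real" where h: "continuous_on UNIV h" "\<And>x. 0 \<le> h x" "\<And>x. h x \<le> 1"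
      "\<And>x. x \<in> C \<Longrightarrow> h x = 0" "\<And>x. x \<in> K \<Longrightarrow> h x = 1"
    using continuous_Urysohn[of C K] C K by (metis compact_imp_closed disjoint_eq_subset_Compl)
  let ?h = "\<lambda>x. complex_of_real (h x)"
  have hc: "continuous_on UNIV ?h"
    by (intro continuous_intros h)
  have pt: "(cmod (complex_of_real (indicator K x) - ?h x))\<^sup>2 \<le> indicator (- K - C) x" for x
  proof -
    have "(cmod (complex_of_real (indicator K x) - ?h x))\<^sup>2 = (indicator K x - h x)\<^sup>2"
      by (simp only: of_real_diff[symmetric] norm_of_real power2_abs)
    also have "\<dots> \<le> indicator (- K - C) x"
      using h(2,3)[of x] h(4,5)[of x] by (auto simp: indicator_def power_le_one)
    finally show ?thesis .
  qed
  have "integrable haar (\<lambda>x. (cmod (complex_of_real (indicator K x) - ?h x))\<^sup>2)"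
    using sq_integrable_diff[OF sq_integrable_indicator[OF Ks] sq_integrable_continuous[OF hc]]
    by (simp add: sq_integrable_def)
  moreover have KC: "- K - C \<in> sets haar"
    using \<open>- K \<in> sets haar\<close> compact_sets_haar[OF C(1)] by blast
  ultimately have "(LINT x|haar. (cmod (complex_of_real (indicator K x) - ?h x))\<^sup>2) \<le> (LINT x|haar. indicator (- K - C) x)"
    using pt by (intro integral_mono integrable_real_indicator)
      (simp_all add: haar_finite.emeasure_eq_measure)
  also have "\<dots> \<le> e"
    using C(3) KC by simp
  finally show "\<exists>g. sq_integrable g \<and> L2_of g \<in> character_hull \<and>
      (LINT x|haar. (cmod (complex_of_real (indicator K x) - g x))\<^sup>2) \<le> e"
    using hc continuous_in_character_hull sq_integrable_continuous by blast
qed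

lemma indicator_in_character_hull:
  fixes B :: "'g::compact_connected_ab_group set"
  assumes B: "B \<in> sets haar"
  shows "L2_of (\<lambda>x. complex_of_real (indicator B x)) \<in> character_hull"
proof (rule L2_of_in_closure[OF sq_integrable_indicator[OF B]])
  fix e :: real assume e: "e > 0"
  obtain K where K: "compact K" "K \<subseteq> B" "measure haar (B - K) < e"
    by (rule haar_inner_approximation[OF B e])
  have "(cmod (complex_of_real (indicator B x) - complex_of_real (indicator K x)))\<^sup>2 = indicator (B - K) x" for x
    using K(2) by (auto simp: indicator_def)
  then have "(LINT x|haar. (cmod (complex_of_real (indicator B x) - complex_of_real (indicator K x)))\<^sup>2) = measure haar (B - K)"
    using B compact_sets_haar[OF K(1)] by simp
  then show "\<exists>g. sq_integrable g \<and> L2_of g \<in> character_hull \<and>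
      (LINT x|haar. (cmod (complex_of_real (indicator B x) - g x))\<^sup>2) \<le> e"
    using K sq_integrable_indicator[OF compact_sets_haar[OF K(1)]] indicator_compact_in_character_hull[OF K(1)]
    by (intro exI[of _ "\<lambda>x. complex_of_real (indicator K x)"]) auto
qed

lemma simple_function_in_character_hull:
  fixes s :: "'g::compact_connected_ab_group \<Rightarrow> complex"
  assumes s: "simple_function haar s"
  shows "sq_integrable s \<and> L2_of s \<in> character_hull"
proof -
  have fin: "finite (range s)" and meas: "\<And>c. s -` {c} \<in> sets haar"
    using simple_functionD[OF s] by simp_all
  have part: "sq_integrable (\<lambda>x. \<Sum>c\<in>C. c * complex_of_real (indicator (s -` {c}) x)) \<and>
      L2_of (\<lambda>x. \<Sum>c\<in>C. c * complex_of_real (indicator (s -` {c}) x)) \<in> character_hull"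
    if "finite C" for C
    using that
  proof (induction C rule: finite_induct)
    case empty
    then show ?case
      using cs.subspace_0[OF subspace_character_hull] by (simp add: sq_integrable_zero L2_of_zero)
  next
    case (insert c C)
    note ci = sq_integrable_indicator[OF meas[of c]]
    have "L2_of (\<lambda>x. c * complex_of_real (indicator (s -` {c}) x)) \<in> character_hull"
      using cs.subspace_scale[OF subspace_character_hull indicator_in_character_hull[OF meas[of c]]]
      by (simp only: L2_of_scale[OF ci])
    from cs.subspace_add[OF subspace_character_hull this conjunct2[OF insert.IH]] show ?case
      using insert sq_integrable_scale[OF ci, of c] by (simp add: L2_of_add sq_integrable_add)
  qed
  have eq: "s = (\<lambda>x. \<Sum>c\<in>range s. c * complex_of_real (indicator (s -` {c}) x))"
  proof
    fix x
    have "(\<Sum>c\<in>range s. c * complex_of_real (indicator (s -` {c}) x)) = (\<Sum>c\<in>range s. if s x = c then c else 0)"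
      by (intro sum.cong) (auto simp: indicator_def)
    also have "\<dots> = s x"
      using fin by (subst sum.delta') auto
    finally show "s x = (\<Sum>c\<in>range s. c * complex_of_real (indicator (s -` {c}) x))"
      by simp
  qed
  show ?thesis
    by (subst (1 2) eq) (rule part[OF fin])
qed

text \<open>
  The hull contains the continuous functions by the Stone--Weierstrass theorem, the indicators of
  compact sets by regularity of the measure and Urysohn's lemma, those of Borel sets by inner
  regularity, and hence all simple functions. These approximate every element by dominated
  convergence.
\<close>

theorem characters_complete: "(f :: 'g::compact_connected_ab_group L2) \<in> character_hull"
proof -
  obtain u :: "'g \<Rightarrow> complex" where u: "sq_integrable u" and f: "f = L2_of u"
    by (rule L2_of_cases)
  have um[measurable]: "u \<in> borel_measurable haar" and ui: "integrable haar (\<lambda>x. (cmod (u x))\<^sup>2)"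
    using u by (auto simp: sq_integrable_def)
  obtain s where s: "\<And>i. simple_function haar (s i)" and lim: "\<And>x. (\<lambda>i. s i x) \<longlonglongrightarrow> u x"
      and bd: "\<And>i x. cmod (s i x) \<le> 2 * cmod (u x)"
  proof -
    obtain F where F: "\<forall>i. simple_function haar (F i)" "\<forall>x\<in>space haar. (\<lambda>i. F i x) \<longlonglongrightarrow> u x"
        "\<forall>i. \<forall>x\<in>space haar. dist (F i x) 0 \<le> 2 * dist (u x) 0"
      using borel_measurable_implies_sequence_metric[OF um, of 0] by blast
    show ?thesis
      by (rule that[of F]) (use F in auto)
  qed
  have sm[measurable]: "s i \<in> borel_measurable haar" for i
    using s by (rule borel_measurable_simple_function)
  have "(\<lambda>i. LINT x|haar. (cmod (u x - s i x))\<^sup>2) \<longlonglongrightarrow> (LINT x|(haar :: 'g measure). 0)"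
  proof (rule integral_dominated_convergence[where w = "\<lambda>x. 9 * (cmod (u x))\<^sup>2"])
    show "AE x in haar. (\<lambda>i. (cmod (u x - s i x))\<^sup>2) \<longlonglongrightarrow> 0"
    proof (rule AE_I2)
      fix x
      have "(\<lambda>i. (cmod (u x - s i x))\<^sup>2) \<longlonglongrightarrow> (cmod (u x - u x))\<^sup>2"
        by (intro tendsto_intros lim)
      then show "(\<lambda>i. (cmod (u x - s i x))\<^sup>2) \<longlonglongrightarrow> 0"
        by simp
    qed
    show "AE x in haar. norm ((cmod (u x - s i x))\<^sup>2) \<le> 9 * (cmod (u x))\<^sup>2" for i
    proof (rule AE_I2)
      fix x
      have "cmod (u x - s i x) \<le> 3 * cmod (u x)"
        using norm_triangle_ineq4[of "u x" "s i x"] bd[of i x] by linarith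
      from power_mono[OF this, of 2] show "norm ((cmod (u x - s i x))\<^sup>2) \<le> 9 * (cmod (u x))\<^sup>2"
        by (simp add: power_mult_distrib)
    qed
  qed (use ui in simp_all)
  then have lim0: "(\<lambda>i. LINT x|haar. (cmod (u x - s i x))\<^sup>2) \<longlonglongrightarrow> 0"
    by simp
  show ?thesis
    unfolding f
  proof (rule L2_of_in_closure[OF u])
    fix e :: real assume "e > 0"
    from order_tendstoD(2)[OF lim0 this]
    obtain i where i: "(LINT x|haar. (cmod (u x - s i x))\<^sup>2) < e"
      unfolding eventually_sequentially by blast
    with simple_function_in_character_hull[OF s[of i]]
    show "\<exists>g. sq_integrable g \<and> L2_of g \<in> character_hull \<and> (LINT x|haar. (cmod (u x - g x))\<^sup>2) \<le> e"
      by (intro exI[of _ "s i"]) auto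
  qed
qed


section \<open>Absolutely convergent series\<close>

lemma sq_integrable_sum:
  "(\<And>i. i \<in> I \<Longrightarrow> sq_integrable (f i)) \<Longrightarrow> sq_integrable (\<lambda>x. \<Sum>i\<in>I. f i x)"
  by (induction I rule: infinite_finite_induct) (auto intro: sq_integrable_add sq_integrable_zero)

lemma L2_of_sum:
  "(\<And>i. i \<in> I \<Longrightarrow> sq_integrable (f i)) \<Longrightarrow> L2_of (\<lambda>x. \<Sum>i\<in>I. f i x) = (\<Sum>i\<in>I. L2_of (f i))"
  by (induction I rule: infinite_finite_induct) (auto simp: L2_of_zero L2_of_add sq_integrable_sum)

text \<open>The Riesz--Fischer argument: the sum of the absolute values is square integrable by monotone
  convergence, and it dominates the partial sums.\<close>

theorem L2_absolutely_summable:
  fixes g :: "nat \<Rightarrow> 'g::compact_connected_ab_group L2"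
  assumes sum: "summable (\<lambda>n. norm (g n))"
  shows "summable g"
proof -
  have "\<forall>n. \<exists>f. sq_integrable f \<and> g n = L2_of f"
    by (metis L2_of_cases)
  then obtain f where f: "\<And>n. sq_integrable (f n)" and g: "\<And>n. g n = L2_of (f n)"
    by metis
  have fm[measurable]: "f n \<in> borel_measurable haar" for n
    using f[of n] by (simp add: sq_integrable_def)
  define C where "C = (\<Sum>n. norm (g n))"
  define G where "G N x = (\<Sum>n<N. cmod (f n x))" for N x
  have Gm[measurable]: "G N \<in> borel_measurable haar" for N
    unfolding G_def by measurable
  have absf: "sq_integrable (\<lambda>x. complex_of_real (cmod (f n x)))" for n
    using f[of n] unfolding sq_integrable_def by simp
  have norm_absf: "norm (L2_of (\<lambda>x. complex_of_real (cmod (f n x)))) = norm (g n)" for n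
  proof -
    have "(norm (L2_of (\<lambda>x. complex_of_real (cmod (f n x)))))\<^sup>2 = (norm (g n))\<^sup>2"
      unfolding g norm_L2_of[OF absf] norm_L2_of[OF f] by simp
    then show ?thesis
      by (simp add: power2_eq_iff_nonneg)
  qed
  have G_sq: "sq_integrable (\<lambda>x. complex_of_real (G N x))" for N
    using sq_integrable_sum[of "{..<N}" "\<lambda>n x. complex_of_real (cmod (f n x))", OF absf] by (simp add: G_def)
  then have Gi: "integrable haar (\<lambda>x. (G N x)\<^sup>2)" for N
    by (simp add: sq_integrable_def)
  have GC: "(LINT x|haar. (G N x)\<^sup>2) \<le> C\<^sup>2" for N
  proof -
    have "L2_of (\<lambda>x. complex_of_real (G N x)) = (\<Sum>n<N. L2_of (\<lambda>x. complex_of_real (cmod (f n x))))"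
      using L2_of_sum[of "{..<N}" "\<lambda>n x. complex_of_real (cmod (f n x))", OF absf] by (simp add: G_def)
    then have "norm (L2_of (\<lambda>x. complex_of_real (G N x))) \<le> (\<Sum>n<N. norm (g n))"
      using norm_sum[of "\<lambda>n. L2_of (\<lambda>x. complex_of_real (cmod (f n x)))" "{..<N}"] by (simp add: norm_absf)
    also have "\<dots> \<le> C"
      unfolding C_def by (rule sum_le_suminf[OF sum]) auto
    finally have "(norm (L2_of (\<lambda>x. complex_of_real (G N x))))\<^sup>2 \<le> C\<^sup>2"
      by (rule power_mono) simp
    then show ?thesis
      unfolding norm_L2_of[OF G_sq] by simp
  qed
  have Gmono: "incseq (\<lambda>N. G N x)" for x
    unfolding G_def by (intro incseq_SucI) simp
  have G0: "0 \<le> G N x" for N x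
    unfolding G_def by (intro sum_nonneg) simp
  have "(\<integral>\<^sup>+x. (SUP N. ennreal ((G N x)\<^sup>2)) \<partial>haar) = (SUP N. \<integral>\<^sup>+x. ennreal ((G N x)\<^sup>2) \<partial>haar)"
    using Gmono G0 by (intro nn_integral_monotone_convergence_SUP)
      (auto simp: incseq_def le_fun_def intro!: ennreal_leI power_mono)
  also have "\<dots> \<le> ennreal (C\<^sup>2)"
    using GC Gi by (intro SUP_least) (simp add: nn_integral_eq_integral)
  finally have "(\<integral>\<^sup>+x. (SUP N. ennreal ((G N x)\<^sup>2)) \<partial>haar) \<noteq> \<infinity>"
    by (auto simp: top_unique)
  then have "AE x in haar. (SUP N. ennreal ((G N x)\<^sup>2)) \<noteq> \<infinity>"
    by (rule nn_integral_PInf_AE[rotated]) measurable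
  then have ae: "AE x in haar. summable (\<lambda>n. cmod (f n x))"
  proof eventually_elim
    case (elim x)
    then obtain r where r: "r \<ge> 0" "(SUP N. ennreal ((G N x)\<^sup>2)) = ennreal r"
      by (cases "SUP N. ennreal ((G N x)\<^sup>2)") auto
    have "G N x \<le> sqrt r" for N
    proof -
      have "ennreal ((G N x)\<^sup>2) \<le> ennreal r"
        unfolding r(2)[symmetric] by (rule SUP_upper) simp
      then have "(G N x)\<^sup>2 \<le> r"
        using r(1) by simp
      then show ?thesis
        by (rule real_le_rsqrt)
    qed
    then show ?case
      by (intro summableI_nonneg_bounded[of _ "sqrt r"]) (auto simp: G_def)
  qed
  define W where "W x = (\<Sum>n. cmod (f n x))" for x
  define s where "s x = (\<Sum>n. f n x)" for x
  have [measurable]: "W \<in> borel_measurable haar" "s \<in> borel_measurable haar"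
    unfolding W_def s_def by measurable
  have incG: "incseq (\<lambda>N. LINT x|haar. (G N x)\<^sup>2)"
    using Gmono G0 Gi by (intro monoI integral_mono power_mono) (auto simp: incseq_def)
  obtain L where L: "(\<lambda>N. LINT x|haar. (G N x)\<^sup>2) \<longlonglongrightarrow> L"
    using incseq_convergent[OF incG, of "C\<^sup>2"] GC by blast
  have Wi: "integrable haar (\<lambda>x. (W x)\<^sup>2)"
  proof (rule integrable_monotone_convergence[OF Gi _ _ L])
    show "AE x in haar. mono (\<lambda>N. (G N x)\<^sup>2)"
      using Gmono G0 by (intro AE_I2 monoI power_mono) (auto simp: incseq_def)
    show "AE x in haar. (\<lambda>N. (G N x)\<^sup>2) \<longlonglongrightarrow> (W x)\<^sup>2"
      using ae unfolding G_def W_def by eventually_elim (intro tendsto_intros summable_LIMSEQ)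
  qed measurable
  have tail: "AE x in haar. \<forall>N. cmod (s x - (\<Sum>n<N. f n x)) \<le> W x"
    using ae
  proof eventually_elim
    case (elim x)
    have sf: "summable (\<lambda>n. f n x)"
      by (rule summable_norm_cancel[OF elim])
    show ?case
    proof
      fix N
      have "s x - (\<Sum>n<N. f n x) = (\<Sum>n. f (n + N) x)"
        using suminf_minus_initial_segment[OF sf, of N] by (simp add: s_def)
      also have "cmod \<dots> \<le> (\<Sum>n. cmod (f (n + N) x))"
        by (intro summable_norm summable_ignore_initial_segment elim)
      also have "\<dots> \<le> W x"
        using suminf_minus_initial_segment[OF elim, of N] sum_nonneg[of "{..<N}" "\<lambda>n. cmod (f n x)"] by (simp add: W_def)
      finally show "cmod (s x - (\<Sum>n<N. f n x)) \<le> W x" .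
    qed
  qed
  have s: "sq_integrable s"
    unfolding sq_integrable_def
  proof
    show "integrable haar (\<lambda>x. (cmod (s x))\<^sup>2)"
    proof (rule Bochner_Integration.integrable_bound[OF Wi])
      show "AE x in haar. norm ((cmod (s x))\<^sup>2) \<le> norm ((W x)\<^sup>2)"
        using tail
      proof eventually_elim
        case (elim x)
        from elim[rule_format, of 0] have "cmod (s x) \<le> W x"
          by simp
        then show ?case
          by (simp add: power_mono)
      qed
    qed measurable
  qed measurable
  have "(\<lambda>N. LINT x|haar. (cmod (s x - (\<Sum>n<N. f n x)))\<^sup>2) \<longlonglongrightarrow> (LINT x|(haar :: 'g measure). 0)"
  proof (rule integral_dominated_convergence[OF _ _ Wi])
    show "AE x in haar. (\<lambda>N. (cmod (s x - (\<Sum>n<N. f n x)))\<^sup>2) \<longlonglongrightarrow> 0"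
      using ae
    proof eventually_elim
      case (elim x)
      have "(\<lambda>N. \<Sum>n<N. f n x) \<longlonglongrightarrow> s x"
        unfolding s_def by (rule summable_LIMSEQ[OF summable_norm_cancel[OF elim]])
      then have "(\<lambda>N. (cmod (s x - (\<Sum>n<N. f n x)))\<^sup>2) \<longlonglongrightarrow> (cmod (s x - s x))\<^sup>2"
        by (intro tendsto_intros)
      then show ?case
        by simp
    qed
    show "AE x in haar. norm ((cmod (s x - (\<Sum>n<N. f n x)))\<^sup>2) \<le> (W x)\<^sup>2" for N
      using tail by eventually_elim (simp add: power_mono)
  qed measurable
  moreover have "(LINT x|haar. (cmod (s x - (\<Sum>n<N. f n x)))\<^sup>2) = (norm ((\<Sum>n<N. g n) - L2_of s))\<^sup>2" for N
  proof -
    have fs: "sq_integrable (\<lambda>x. \<Sum>n<N. f n x)"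
      by (rule sq_integrable_sum[OF f])
    have "L2_of (\<lambda>x. s x - (\<Sum>n<N. f n x)) = L2_of s - (\<Sum>n<N. g n)"
      by (simp add: L2_of_diff[OF s fs] L2_of_sum f g)
    then show ?thesis
      using norm_L2_of[OF sq_integrable_diff[OF s fs]] by (simp add: norm_minus_commute)
  qed
  ultimately have "(\<lambda>N. (norm ((\<Sum>n<N. g n) - L2_of s))\<^sup>2) \<longlonglongrightarrow> 0"
    by simp
  then have "(\<lambda>N. norm ((\<Sum>n<N. g n) - L2_of s)) \<longlonglongrightarrow> 0"
    using tendsto_real_sqrt[of _ 0] by fastforce
  then have "(\<lambda>N. \<Sum>n<N. g n) \<longlonglongrightarrow> L2_of s"
    by (simp add: tendsto_norm_zero_iff LIM_zero_iff)
  then show ?thesis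
    unfolding summable_def sums_def by blast
qed


section \<open>Fourier coefficients\<close>

lemma power_fun_apply: "(\<psi> ^ n) x = \<psi> x ^ n" for \<psi> :: "'g \<Rightarrow> complex"
  by (induction n) auto

lemma cnj_char_mult_self: "\<psi> \<in> characters \<Longrightarrow> cnj_char \<psi> * \<psi> = 1"
  by (simp add: fun_eq_iff cnj_char_def mult.commute)

lemma cnj_char_mult: "cnj_char (\<psi> * \<xi>) = cnj_char \<psi> * cnj_char \<xi>"
  by (simp add: fun_eq_iff cnj_char_def)

lemma cnj_char_cnj_char: "cnj_char (cnj_char \<psi>) = \<psi>"
  by (simp add: cnj_char_def)

lemma cnj_char_one: "cnj_char 1 = 1"
  by (simp add: fun_eq_iff cnj_char_def)

lemma character_mult_cancel:
  assumes "\<psi> \<in> characters"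
  shows "\<psi> * \<xi> = \<psi> * \<eta> \<longleftrightarrow> \<xi> = \<eta>"
proof
  assume "\<psi> * \<xi> = \<psi> * \<eta>"
  then have "(cnj_char \<psi> * \<psi>) * \<xi> = (cnj_char \<psi> * \<psi>) * \<eta>"
    by (simp only: mult.assoc)
  then show "\<xi> = \<eta>"
    by (simp add: cnj_char_mult_self[OF assms])
qed simp

lemma cinner_characters:
  assumes \<psi>: "\<psi> \<in> characters" and \<xi>: "\<xi> \<in> characters"
  shows "cinner (L2_of \<psi>) (L2_of \<xi>) = (if \<psi> = \<xi> then 1 else 0)"
proof -
  define \<eta> where "\<eta> = \<psi> * cnj_char \<xi>"
  have \<eta>: "\<eta> \<in> characters"
    unfolding \<eta>_def by (intro character_mult character_cnj \<psi> \<xi>)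
  have eq: "cinner (L2_of \<psi>) (L2_of \<xi>) = (LINT x|haar. \<eta> x)"
    by (simp add: cinner_L2_of sq_integrable_character \<psi> \<xi> \<eta>_def cnj_char_def)
  show ?thesis
  proof (cases "\<psi> = \<xi>")
    case True
    then have "\<eta> x = 1" for x
      using \<xi> by (simp add: \<eta>_def cnj_char_def)
    then have "(LINT x|haar. \<eta> x) = 1"
      by simp
    with True show ?thesis
      unfolding eq by simp
  next
    case False
    then obtain z where z: "\<psi> z \<noteq> \<xi> z"
      by blast
    have "\<eta> z \<noteq> 1"
    proof
      assume "\<eta> z = 1"
      then have "\<psi> z * (cnj (\<xi> z) * \<xi> z) = \<xi> z"
        by (simp add: \<eta>_def cnj_char_def mult.assoc[symmetric])
      with z show False
        using character_cnj_mult[OF \<xi>, of z] by (simp add: mult.commute)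
    qed
    moreover have "(LINT x|haar. \<eta> x) = \<eta> z * (LINT x|haar. \<eta> x)"
      using integral_haar_translation[OF continuous_measurable_haar[OF character_continuous[OF \<eta>]], of z]
      by (simp add: character_add[OF \<eta>])
    ultimately show ?thesis
      using False eq by simp
  qed
qed

lemma norm_character: "\<psi> \<in> characters \<Longrightarrow> norm (L2_of \<psi>) = 1"
  using cinner_self[of "L2_of \<psi>"] cinner_characters[of \<psi> \<psi>]
  by (metis of_real_eq_1_iff power2_eq_1_iff norm_ge_zero neg_0_le_iff_le not_one_le_zero)

definition partial_fourier ::
    "('g::compact_connected_ab_group \<Rightarrow> complex) set \<Rightarrow> 'g L2 \<Rightarrow> 'g L2" where
  "partial_fourier F f = (\<Sum>\<psi>\<in>F. cscale (fourier f \<psi>) (L2_of \<psi>))"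

lemma partial_fourier_orthogonal:
  assumes F: "finite F" "F \<subseteq> characters" and g: "g \<in> cs.span (L2_of ` F)"
  shows "cinner (f - partial_fourier F f) g = 0"
proof -
  have base: "cinner (f - partial_fourier F f) (L2_of \<xi>) = 0" if \<xi>: "\<xi> \<in> F" for \<xi>
  proof -
    have "cinner (partial_fourier F f) (L2_of \<xi>) = (\<Sum>\<psi>\<in>F. if \<psi> = \<xi> then fourier f \<xi> else 0)"
      unfolding partial_fourier_def cinner_sum_left
      using F(2) \<xi> by (intro sum.cong) (auto simp: cinner_cscale_left cinner_characters subset_eq)
    also have "\<dots> = cinner f (L2_of \<xi>)"
      using F(1) \<xi> by (simp add: fourier_def)
    finally show ?thesis
      by (simp add: cinner_diff_left)
  qed
  have sub: "cs.subspace {g. cinner (f - partial_fourier F f) g = 0}"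
    by (intro cs.subspaceI) (auto simp: cinner_add_right cinner_cscale_right)
  have "cs.span (L2_of ` F) \<subseteq> {g. cinner (f - partial_fourier F f) g = 0}"
    by (rule cs.span_minimal[OF _ sub]) (use base in auto)
  with g show ?thesis
    by blast
qed

lemma partial_fourier_in_span: "partial_fourier F f \<in> cs.span (L2_of ` F)"
  unfolding partial_fourier_def by (intro cs.span_sum cs.span_scale cs.span_base imageI)

lemma partial_fourier_best:
  assumes F: "finite F" "F \<subseteq> characters" and h: "h \<in> cs.span (L2_of ` F)"
  shows "norm (f - partial_fourier F f) \<le> norm (f - h)"
proof -
  let ?P = "partial_fourier F f"
  have "cinner (f - ?P) (?P - h) = 0"
    by (intro partial_fourier_orthogonal F cs.span_diff partial_fourier_in_span h)
  then have "orthogonal (f - ?P) (?P - h)"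
    by (simp add: orthogonal_def inner_L2_def)
  from norm_add_Pythagorean[OF this]
  have "(norm (f - ?P))\<^sup>2 \<le> (norm (f - h))\<^sup>2"
    by simp
  then show ?thesis
    by (rule power2_le_imp_le) simp
qed

text \<open>
  The approximation is stated for all finite sets beyond some \<open>E\<close>, so that prescribed characters can
  be added to the sum.
\<close>

lemma partial_fourier_dense:
  fixes f :: "'g::compact_connected_ab_group L2"
  assumes e: "e > 0"
  obtains E where "finite E" "E \<subseteq> characters"
    "\<And>F. finite F \<Longrightarrow> E \<subseteq> F \<Longrightarrow> F \<subseteq> characters \<Longrightarrow> norm (f - partial_fourier F f) < e"
proof -
  obtain h where h: "h \<in> cs.span (L2_of ` characters)" "dist h f < e"
    using characters_complete[of f] e unfolding closure_approachable by blast
  obtain t r where t: "finite t" "t \<subseteq> L2_of ` characters" "h = (\<Sum>a\<in>t. cscale (r a) a)"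
    using h(1) unfolding cs.span_explicit by blast
  obtain E where E: "E \<subseteq> characters" "finite E" "t = L2_of ` E"
    using finite_subset_image[OF t(1,2)] by blast
  have hE: "h \<in> cs.span (L2_of ` E)"
    unfolding t(3) E(3) by (intro cs.span_sum cs.span_scale cs.span_base)
  show ?thesis
  proof
    fix F :: "('g \<Rightarrow> complex) set"
    assume F: "finite F" "E \<subseteq> F" "F \<subseteq> characters"
    have "h \<in> cs.span (L2_of ` F)"
      using hE cs.span_mono[OF image_mono[OF F(2)]] by blast
    from partial_fourier_best[OF F(1,3) this, of f] h(2) show "norm (f - partial_fourier F f) < e"
      by (simp add: dist_norm norm_minus_commute)
  qed (use E in auto)
qed

text \<open>
  The element \<open>g\<close> is the product of \<open>\<psi>\<close> and \<open>f\<close>.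
\<close>

lemma modulation:
  fixes f :: "'g::compact_connected_ab_group L2"
  assumes \<psi>: "\<psi> \<in> characters"
  obtains g where "norm g = norm f"
    "\<And>\<xi>. \<xi> \<in> characters \<Longrightarrow> cinner g (L2_of \<xi>) = cinner f (L2_of (cnj_char \<psi> * \<xi>))"
proof -
  obtain u where u: "sq_integrable u" and f: "f = L2_of u"
    by (rule L2_of_cases)
  have [measurable]: "u \<in> borel_measurable haar" "\<psi> \<in> borel_measurable haar"
    using u continuous_measurable_haar[OF character_continuous[OF \<psi>]] by (auto simp: sq_integrable_def)
  have v: "sq_integrable (\<lambda>x. \<psi> x * u x)"
    using u by (simp add: sq_integrable_def norm_mult character_norm[OF \<psi>])
  show ?thesis
  proof
    have "(norm (L2_of (\<lambda>x. \<psi> x * u x)))\<^sup>2 = (norm f)\<^sup>2"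
      unfolding f norm_L2_of[OF v] norm_L2_of[OF u] by (simp add: norm_mult character_norm[OF \<psi>])
    then show "norm (L2_of (\<lambda>x. \<psi> x * u x)) = norm f"
      by (simp add: power2_eq_iff_nonneg)
    fix \<xi> :: "'g \<Rightarrow> complex" assume \<xi>: "\<xi> \<in> characters"
    show "cinner (L2_of (\<lambda>x. \<psi> x * u x)) (L2_of \<xi>) = cinner f (L2_of (cnj_char \<psi> * \<xi>))"
      unfolding f
      by (simp add: cinner_L2_of v u sq_integrable_character \<xi> character_mult character_cnj \<psi>)
        (simp add: cnj_char_def mult_ac)
  qed
qed


section \<open>Bounded operators\<close>

lemma linear_op_diff:
  assumes "linear_op V W A" "cs.subspace V" "f \<in> V" "g \<in> V"
  shows "A (f - g) = A f - A g"
proof -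
  have "A (f + cscale (- 1) g) = A f + cscale (- 1) (A g)"
    using assms(1,3,4) cs.subspace_scale[OF assms(2,4)] unfolding linear_op_def by metis
  then show ?thesis
    by (simp add: uminus_eq_cscale[symmetric])
qed

lemma linear_op_zero: "linear_op V W A \<Longrightarrow> cs.subspace V \<Longrightarrow> A 0 = 0"
  using linear_op_diff[of V W A 0 0] cs.subspace_0[of V] by simp

lemma linear_op_sum:
  assumes A: "linear_op V W A" "cs.subspace V" and "\<And>i. i \<in> I \<Longrightarrow> f i \<in> V"
  shows "A (\<Sum>i\<in>I. cscale (c i) (f i)) = (\<Sum>i\<in>I. cscale (c i) (A (f i)))"
  using assms(3)
proof (induction I rule: infinite_finite_induct)
  case (insert i I)
  have "(\<Sum>i\<in>I. cscale (c i) (f i)) \<in> V" "cscale (c i) (f i) \<in> V"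
    using insert by (auto intro!: cs.subspace_sum[OF A(2)] cs.subspace_scale[OF A(2)])
  then show ?case
    using insert A(1) by (simp add: linear_op_def)
qed (use linear_op_zero[OF A] in simp_all)

lemma op_norm_le:
  assumes "0 \<in> V" "\<And>f. f \<in> V \<Longrightarrow> norm f \<le> 1 \<Longrightarrow> norm (A f) \<le> K"
  shows "op_norm V A \<le> K"
  unfolding op_norm_def by (rule cSUP_least) (use assms in auto)

lemma le_op_norm:
  assumes "\<And>f. f \<in> V \<Longrightarrow> norm f \<le> 1 \<Longrightarrow> norm (A f) \<le> K" "f \<in> V" "norm f \<le> 1"
  shows "norm (A f) \<le> op_norm V A"
  unfolding op_norm_def
  by (rule cSUP_upper) (use assms in \<open>auto intro!: bdd_aboveI[of _ K]\<close>)

lemma bounded_op_bound: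
  assumes "bounded_op V W A"
  obtains K where "K \<ge> 0" "\<And>f. f \<in> V \<Longrightarrow> norm (A f) \<le> K * norm f"
proof -
  obtain K where K: "\<And>f. f \<in> V \<Longrightarrow> norm (A f) \<le> K * norm f"
    using assms unfolding bounded_op_def by blast
  have "norm (A f) \<le> \<bar>K\<bar> * norm f" if "f \<in> V" for f
    by (rule order_trans[OF K[OF that]]) (simp add: mult_right_mono)
  then show ?thesis
    using that[of "\<bar>K\<bar>"] by simp
qed

lemma op_sumsI:
  assumes V: "0 \<in> V" and S: "\<And>n. bounded_op V W (S n)" and A: "bounded_op V W A"
    and r: "0 \<le> r" "r < 1" and C: "C \<ge> 0"
    and est: "\<And>N f. f \<in> V \<Longrightarrow> norm (A f - (\<Sum>n<N. S n f)) \<le> C * r ^ N * norm f"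
  shows "op_sums V W S A"
proof -
  have bd: "norm (A f - (\<Sum>n<N. S n f)) \<le> C * r ^ N" if "f \<in> V" "norm f \<le> 1" for f N
    using est[OF that(1), of N] mult_left_mono[OF that(2), of "C * r ^ N"] C r(1) by simp
  have "(\<lambda>N. op_norm V (\<lambda>f. A f - (\<Sum>n<N. S n f))) \<longlonglongrightarrow> 0"
  proof (rule tendsto_sandwich[OF _ _ tendsto_const])
    have "(\<lambda>N. C * r ^ N) \<longlonglongrightarrow> C * 0"
      using r by (intro tendsto_mult tendsto_const LIMSEQ_power_zero) simp
    then show "(\<lambda>N. C * r ^ N) \<longlonglongrightarrow> 0"
      by simp
    have "op_norm V (\<lambda>f. A f - (\<Sum>n<N. S n f)) \<le> C * r ^ N" for N
      by (rule op_norm_le[OF V bd])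
    then show "\<forall>\<^sub>F N in sequentially. op_norm V (\<lambda>f. A f - (\<Sum>n<N. S n f)) \<le> C * r ^ N"
      by simp
    have "0 \<le> op_norm V (\<lambda>f. A f - (\<Sum>n<N. S n f))" for N
      using le_op_norm[of V "\<lambda>f. A f - (\<Sum>n<N. S n f)" "C * r ^ N" 0, OF bd V]
      by (intro order_trans[OF norm_ge_zero]) auto
    then show "\<forall>\<^sub>F N in sequentially. 0 \<le> op_norm V (\<lambda>f. A f - (\<Sum>n<N. S n f))"
      by simp
  qed
  with S A show ?thesis
    by (simp add: op_sums_def)
qed

text \<open>
  The operator norm is a supremum of reals and dominates the values only if these are bounded;
  for the remainders of the series the bounds of the individual operators provide this.
\<close>

lemma op_sums_pointwise:
  assumes sums: "op_sums V W S A" and f: "f \<in> V" "norm f \<le> 1"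
  shows "(\<lambda>n. S n f) sums A f"
proof -
  have A: "bounded_op V W A" and S: "\<And>n. bounded_op V W (S n)"
      and lim: "(\<lambda>N. op_norm V (\<lambda>f. A f - (\<Sum>n<N. S n f))) \<longlonglongrightarrow> 0"
    using sums by (auto simp: op_sums_def)
  obtain K where K: "\<And>f. f \<in> V \<Longrightarrow> norm (A f) \<le> K * norm f" "K \<ge> 0"
    using bounded_op_bound[OF A] by blast
  have "\<forall>n. \<exists>L. L \<ge> 0 \<and> (\<forall>f\<in>V. norm (S n f) \<le> L * norm f)"
    using bounded_op_bound[OF S] by metis
  then obtain L where L: "\<And>n f. f \<in> V \<Longrightarrow> norm (S n f) \<le> L n * norm f" "\<And>n. L n \<ge> 0"
    by metis
  have "norm (A f - (\<Sum>n<N. S n f)) \<le> op_norm V (\<lambda>f. A f - (\<Sum>n<N. S n f))" for N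
  proof (rule le_op_norm[OF _ f])
    fix f assume f: "f \<in> V" "norm f \<le> 1"
    have "norm (A f - (\<Sum>n<N. S n f)) \<le> norm (A f) + (\<Sum>n<N. norm (S n f))"
      by (rule order_trans[OF norm_triangle_ineq4 add_left_mono[OF norm_sum]])
    also have "\<dots> \<le> K + (\<Sum>n<N. L n)"
      using K(1)[OF f(1)] L(1)[OF f(1)] mult_left_mono[OF f(2) K(2)] mult_left_mono[OF f(2) L(2)]
      by (intro add_mono sum_mono) (auto intro: order_trans)
    finally show "norm (A f - (\<Sum>n<N. S n f)) \<le> K + (\<Sum>n<N. L n)" .
  qed
  then have "(\<lambda>N. A f - (\<Sum>n<N. S n f)) \<longlonglongrightarrow> 0"
    by (intro Lim_null_comparison[OF _ lim]) simp
  from tendsto_diff[OF tendsto_const this, of "A f"] show ?thesis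
    by (simp add: sums_def)
qed

lemma geometric_tail_bound:
  fixes r :: real
  assumes r: "0 \<le> r" "r < 1" and J: "finite J" "J \<subseteq> {N..}"
  shows "(\<Sum>n\<in>J. r ^ n) \<le> r ^ N / (1 - r)"
proof -
  have "J \<subseteq> (\<lambda>k. k + N) ` (\<lambda>n. n - N) ` J"
    using J(2) by (force simp: image_iff)
  then have "(\<Sum>n\<in>J. r ^ n) \<le> (\<Sum>n\<in>(\<lambda>k. k + N) ` (\<lambda>n. n - N) ` J. r ^ n)"
    using J(1) r by (intro sum_mono2) auto
  also have "\<dots> = (\<Sum>k\<in>(\<lambda>n. n - N) ` J. r ^ N * r ^ k)"
    by (subst sum.reindex) (auto simp: inj_on_def power_add mult.commute)
  also have "\<dots> = r ^ N * (\<Sum>k\<in>(\<lambda>n. n - N) ` J. r ^ k)"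
    by (simp add: sum_distrib_left)
  also have "(\<Sum>k\<in>(\<lambda>n. n - N) ` J. r ^ k) \<le> (\<Sum>k. r ^ k)"
    using r J(1) by (intro sum_le_suminf summable_geometric) auto
  also have "(\<Sum>k. r ^ k) = 1 / (1 - r)"
    using r by (intro suminf_geometric) simp
  finally show ?thesis
    using r(1) by (simp add: mult_left_mono)
qed

lemma subspace_H2: "cs.subspace (H2 R)"
  by (intro cs.subspaceI) (auto simp: H2_def fourier_def cinner_add_left cinner_cscale_left)

lemma subspace_H2m: "cs.subspace (H2m R)"
  by (intro cs.subspaceI) (auto simp: H2m_def cinner_add_left cinner_cscale_left)

lemma H2m_sums:
  assumes "\<And>n. s n \<in> H2m R" "s sums f"
  shows "f \<in> H2m R"
proof -
  have "cinner f g = 0" if g: "g \<in> H2 R" for g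
  proof -
    have "(\<lambda>n. cinner (s n) g) sums cinner f g"
      by (rule bounded_linear.sums[OF bounded_linear_cinner_left assms(2)])
    moreover have "(\<lambda>n. cinner (s n) g) = (\<lambda>n. 0)"
      using assms(1) g by (auto simp: H2m_def)
    ultimately show ?thesis
      using sums_unique2 sums_zero by metis
  qed
  then show ?thesis
    by (simp add: H2m_def)
qed


section \<open>The order on the dual group\<close>

locale first_positive_character =
  fixes R :: "('g::compact_connected_ab_group \<Rightarrow> complex) rel" and \<chi>1 :: "'g \<Rightarrow> complex"
  assumes order: "group_order R" and first: "first_positive R \<chi>1"
begin

lemma le_trans: "(\<psi>, \<xi>) \<in> R \<Longrightarrow> (\<xi>, \<eta>) \<in> R \<Longrightarrow> (\<psi>, \<eta>) \<in> R"
  using order unfolding group_order_def linear_order_on_def partial_order_on_def preorder_on_def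
  by (meson transD)

lemma le_antisym: "(\<psi>, \<xi>) \<in> R \<Longrightarrow> (\<xi>, \<psi>) \<in> R \<Longrightarrow> \<psi> = \<xi>"
  using order unfolding group_order_def linear_order_on_def partial_order_on_def
  by (meson antisymD)

lemma le_refl: "\<psi> \<in> characters \<Longrightarrow> (\<psi>, \<psi>) \<in> R"
  using order unfolding group_order_def linear_order_on_def partial_order_on_def preorder_on_def
  by (meson refl_onD)

lemma le_total: "\<psi> \<in> characters \<Longrightarrow> \<xi> \<in> characters \<Longrightarrow> (\<psi>, \<xi>) \<in> R \<or> (\<xi>, \<psi>) \<in> R"
  using order le_refl unfolding group_order_def linear_order_on_def total_on_def by metis

lemma le_mult: "(\<psi>, \<xi>) \<in> R \<Longrightarrow> \<eta> \<in> characters \<Longrightarrow> (\<psi> * \<eta>, \<xi> * \<eta>) \<in> R"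
  using order unfolding group_order_def by blast

lemma Xplus_character: "\<psi> \<in> Xplus R \<Longrightarrow> \<psi> \<in> characters"
  by (simp add: Xplus_def)

lemma one_Xplus: "1 \<in> Xplus R"
  by (simp add: Xplus_def character_one le_refl)

lemma mult_Xplus:
  assumes "\<psi> \<in> Xplus R" "\<xi> \<in> Xplus R"
  shows "\<psi> * \<xi> \<in> Xplus R"
proof -
  have "(1 * \<xi>, \<psi> * \<xi>) \<in> R"
    using assms by (intro le_mult) (auto simp: Xplus_def)
  then have "(1, \<psi> * \<xi>) \<in> R"
    using assms le_trans[of 1 \<xi>] by (simp add: Xplus_def)
  then show ?thesis
    using assms by (simp add: Xplus_def character_mult)
qed

lemma mult_eq_one:
  assumes "\<psi> \<in> Xplus R" "\<xi> \<in> Xplus R" "\<psi> * \<xi> = 1"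
  shows "\<psi> = 1" "\<xi> = 1"
proof -
  have "(1 * \<xi>, \<psi> * \<xi>) \<in> R"
    using assms by (intro le_mult) (auto simp: Xplus_def)
  then show "\<xi> = 1"
    using assms by (intro le_antisym) (auto simp: Xplus_def)
  with assms(3) show "\<psi> = 1"
    by simp
qed

lemma mult_Xplus_nonunit: "\<psi> \<in> Xplus R \<Longrightarrow> \<xi> \<in> Xplus R - {1} \<Longrightarrow> \<psi> * \<xi> \<in> Xplus R - {1}"
  using mult_Xplus[of \<psi> \<xi>] mult_eq_one(2)[of \<psi> \<xi>] by blast

lemma Xminus_eq: "Xminus R = cnj_char ` (Xplus R - {1})"
proof safe
  fix \<psi> assume \<psi>: "\<psi> \<in> Xminus R"
  then have c: "\<psi> \<in> characters" "\<psi> \<notin> Xplus R"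
    by (auto simp: Xminus_def)
  then have "(\<psi>, 1) \<in> R"
    using le_total[OF c(1) character_one] by (auto simp: Xplus_def)
  from le_mult[OF this character_cnj[OF c(1)]] have "(1, cnj_char \<psi>) \<in> R"
    using cnj_char_mult_self[OF c(1)] by (simp add: mult.commute)
  then have "cnj_char \<psi> \<in> Xplus R"
    by (simp add: Xplus_def character_cnj c(1))
  moreover have "cnj_char \<psi> \<noteq> 1"
    using c one_Xplus cnj_char_one cnj_char_cnj_char by metis
  ultimately show "\<psi> \<in> cnj_char ` (Xplus R - {1})"
    by (intro image_eqI[of _ _ "cnj_char \<psi>"]) (auto simp: cnj_char_cnj_char)
next
  fix \<xi> assume \<xi>: "\<xi> \<in> Xplus R" "cnj_char \<xi> \<notin> Xminus R"
  then have "cnj_char \<xi> \<in> Xplus R"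
    by (auto simp: Xminus_def intro: character_cnj Xplus_character)
  from mult_eq_one(2)[OF this \<xi>(1) cnj_char_mult_self[OF Xplus_character[OF \<xi>(1)]]]
  show "\<xi> = 1" .
qed

lemma \<chi>1_Xplus: "\<chi>1 \<in> Xplus R" and \<chi>1_nonunit: "\<chi>1 \<noteq> 1"
  using first by (auto simp: first_positive_def)

lemma \<chi>1_power_Xplus: "\<chi>1 ^ n \<in> Xplus R"
proof (induction n)
  case 0
  show ?case
    by (simp only: power_0 one_Xplus)
next
  case (Suc n)
  show ?case
    by (simp only: power_Suc mult_Xplus[OF \<chi>1_Xplus Suc])
qed

lemma \<chi>1_power_character: "\<chi>1 ^ n \<in> characters"
  by (rule Xplus_character[OF \<chi>1_power_Xplus])

lemma \<chi>1_dvd: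
  assumes "\<psi> \<in> Xplus R" "\<psi> \<noteq> 1"
  obtains \<psi>' where "\<psi>' \<in> Xplus R" "\<psi> = \<chi>1 * \<psi>'"
proof
  note c = Xplus_character[OF \<chi>1_Xplus]
  have "(\<chi>1, \<psi>) \<in> R"
    using first assms by (auto simp: first_positive_def)
  from le_mult[OF this character_cnj[OF c]] have "(1, \<psi> * cnj_char \<chi>1) \<in> R"
    using cnj_char_mult_self[OF c] by (simp add: mult.commute)
  then show "\<psi> * cnj_char \<chi>1 \<in> Xplus R"
    using assms by (simp add: Xplus_def character_mult character_cnj c)
  show "\<psi> = \<chi>1 * (\<psi> * cnj_char \<chi>1)"
    using cnj_char_mult_self[OF c] by (metis mult.commute mult.left_commute mult_1)
qed

text \<open>
  The powers of \<open>\<chi>1\<close> form an initial segment of the positive cone: as long as \<open>\<psi>\<close> is not the unit, a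
  factor \<open>\<chi>1\<close> can be cancelled from it and from the power.
\<close>

lemma factor_of_\<chi>1_power:
  "\<psi> \<in> Xplus R \<Longrightarrow> \<xi> \<in> Xplus R \<Longrightarrow> \<psi> * \<xi> = \<chi>1 ^ n \<Longrightarrow> \<exists>m. \<psi> = \<chi>1 ^ m"
proof (induction n arbitrary: \<psi>)
  case 0
  then have "\<psi> = \<chi>1 ^ 0"
    using mult_eq_one(1)[of \<psi> \<xi>] by (simp only: power_0)
  then show ?case
    by blast
next
  case (Suc n)
  show ?case
  proof (cases "\<psi> = 1")
    case True
    then have "\<psi> = \<chi>1 ^ 0"
      by simp
    then show ?thesis
      by blast
  next
    case False
    obtain \<psi>' where \<psi>': "\<psi>' \<in> Xplus R" "\<psi> = \<chi>1 * \<psi>'"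
      by (rule \<chi>1_dvd[OF Suc.prems(1) False])
    have "\<chi>1 * (\<psi>' * \<xi>) = \<chi>1 * \<chi>1 ^ n"
      using Suc.prems(3) by (simp only: \<psi>'(2) power_Suc mult.assoc)
    then have "\<psi>' * \<xi> = \<chi>1 ^ n"
      by (simp add: character_mult_cancel[OF Xplus_character[OF \<chi>1_Xplus]])
    then obtain m where "\<psi>' = \<chi>1 ^ m"
      using Suc.IH[OF \<psi>'(1) Suc.prems(2)] by blast
    then have "\<psi> = \<chi>1 ^ Suc m"
      using \<psi>'(2) by simp
    then show ?thesis
      by blast
  qed
qed

lemma \<chi>1_power_inject: "\<chi>1 ^ m = \<chi>1 ^ n \<longleftrightarrow> m = n"
proof -
  have no: False if "\<chi>1 ^ m = \<chi>1 ^ (m + Suc k)" for m k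
  proof -
    have "\<chi>1 ^ m * 1 = \<chi>1 ^ m * (\<chi>1 * \<chi>1 ^ k)"
      using that by (simp only: power_add power_Suc mult_1_right)
    then have "\<chi>1 * \<chi>1 ^ k = 1"
      using character_mult_cancel[OF \<chi>1_power_character] by metis
    from mult_eq_one(1)[OF \<chi>1_Xplus \<chi>1_power_Xplus this] show False
      using \<chi>1_nonunit by simp
  qed
  show ?thesis
    using no[of m] no[of n] by (metis less_imp_Suc_add linorder_neqE_nat add_Suc_right)
qed

lemma cyclic_subgroup_Xplus:
  assumes "\<psi> \<in> Xplus R"
  shows "\<psi> \<in> cyclic_subgroup \<chi>1 \<longleftrightarrow> \<psi> \<in> range (\<lambda>n. \<chi>1 ^ n)"
proof
  assume "\<psi> \<in> range (\<lambda>n. \<chi>1 ^ n)"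
  then obtain n where "\<psi> = \<chi>1 ^ n"
    by blast
  then have "\<psi> = (\<lambda>x. \<chi>1 x powi (int n))"
    by (simp add: fun_eq_iff power_fun_apply)
  then show "\<psi> \<in> cyclic_subgroup \<chi>1"
    unfolding cyclic_subgroup_def by blast
next
  assume "\<psi> \<in> cyclic_subgroup \<chi>1"
  then obtain k where k: "\<psi> = (\<lambda>x. \<chi>1 x powi k)"
    unfolding cyclic_subgroup_def by blast
  show "\<psi> \<in> range (\<lambda>n. \<chi>1 ^ n)"
  proof (cases "k \<ge> 0")
    case True
    then have "\<psi> = \<chi>1 ^ nat k"
      by (simp add: k fun_eq_iff power_fun_apply power_int_def)
    then show ?thesis
      by blast
  next
    case False
    have nz: "\<chi>1 x \<noteq> 0" for x
      using character_norm[OF Xplus_character[OF \<chi>1_Xplus], of x] by auto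
    have "\<psi> * \<chi>1 ^ nat (- k) = 1"
      using False nz by (simp add: k fun_eq_iff power_fun_apply power_int_def power_inverse)
    from mult_eq_one(1)[OF assms \<chi>1_power_Xplus this] have "\<psi> = \<chi>1 ^ 0"
      by simp
    then show ?thesis
      by blast
  qed
qed

lemma \<chi>1_power_dvd:
  assumes "\<psi> \<in> Xplus R" "\<psi> \<notin> range (\<lambda>n. \<chi>1 ^ n)"
  shows "\<exists>\<psi>'\<in>Xplus R. \<psi> = \<chi>1 ^ n * \<psi>'"
proof (induction n)
  case 0
  then show ?case
    using assms(1) by auto
next
  case (Suc n)
  then obtain \<psi>' where \<psi>': "\<psi>' \<in> Xplus R" "\<psi> = \<chi>1 ^ n * \<psi>'"
    by blast
  then have "\<psi>' \<noteq> 1"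
    using assms(2) by auto
  then obtain \<psi>'' where "\<psi>'' \<in> Xplus R" "\<psi>' = \<chi>1 * \<psi>''"
    using \<chi>1_dvd[OF \<psi>'(1)] by blast
  with \<psi>'(2) show ?case
    by (intro bexI[of _ \<psi>'']) (simp_all add: mult_ac)
qed


section \<open>Semi-characters\<close>

lemma gen_semichar_one:
  assumes "gen_semichar R \<mu>"
  shows "\<mu> 1 = 1"
proof -
  obtain \<psi> where \<psi>: "\<psi> \<in> Xplus R" "\<mu> \<psi> \<noteq> 0"
    using assms by (auto simp: gen_semichar_def)
  have "\<mu> (1 * \<psi>) = \<mu> 1 * \<mu> \<psi>"
    using assms \<psi>(1) one_Xplus unfolding gen_semichar_def by blast
  with \<psi>(2) show ?thesis
    by simp
qed

lemma gen_semichar_mult: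
  "gen_semichar R \<mu> \<Longrightarrow> \<psi> \<in> Xplus R \<Longrightarrow> \<xi> \<in> Xplus R \<Longrightarrow> \<mu> (\<psi> * \<xi>) = \<mu> \<psi> * \<mu> \<xi>"
  unfolding gen_semichar_def by blast

lemma gen_semichar_power:
  assumes "gen_semichar R \<mu>"
  shows "\<mu> (\<chi>1 ^ n) = \<mu> \<chi>1 ^ n"
proof (induction n)
  case 0
  show ?case
    by (simp only: power_0 gen_semichar_one[OF assms])
next
  case (Suc n)
  show ?case
    by (simp only: power_Suc gen_semichar_mult[OF assms \<chi>1_Xplus \<chi>1_power_Xplus] Suc)
qed

text \<open>
  The function that vanishes outside the powers of \<open>\<chi>1\<close> is multiplicative because a product of
  positive characters is a power of \<open>\<chi>1\<close> only if both factors are.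
\<close>

lemma cyclic_semichar_unique_existence:
  "\<exists>!\<mu>. \<mu> \<in> extensional (Xplus R) \<and> cyclic_semichar R \<chi>1 q \<mu>"
proof (rule ex_ex1I)
  define \<mu> where "\<mu> \<psi> = (if \<psi> \<in> Xplus R then
      if \<psi> \<in> range (\<lambda>n. \<chi>1 ^ n) then q ^ (THE n. \<psi> = \<chi>1 ^ n) else 0 else undefined)" for \<psi>
  have pow: "\<mu> (\<chi>1 ^ n) = q ^ n" for n
    by (simp add: \<mu>_def \<chi>1_power_Xplus \<chi>1_power_inject)
  have other: "\<mu> \<psi> = 0" if "\<psi> \<in> Xplus R" "\<psi> \<notin> range (\<lambda>n. \<chi>1 ^ n)" for \<psi>
    using that by (simp add: \<mu>_def)
  have "\<mu> (\<psi> * \<xi>) = \<mu> \<psi> * \<mu> \<xi>" if \<psi>: "\<psi> \<in> Xplus R" and \<xi>: "\<xi> \<in> Xplus R" for \<psi> \<xi>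
  proof (cases "\<psi> \<in> range (\<lambda>n. \<chi>1 ^ n) \<and> \<xi> \<in> range (\<lambda>n. \<chi>1 ^ n)")
    case True
    then obtain m n where "\<psi> = \<chi>1 ^ m" "\<xi> = \<chi>1 ^ n"
      by blast
    then show ?thesis
      by (simp only: power_add[symmetric] pow)
  next
    case False
    have "\<psi> * \<xi> \<notin> range (\<lambda>n. \<chi>1 ^ n)"
    proof
      assume "\<psi> * \<xi> \<in> range (\<lambda>n. \<chi>1 ^ n)"
      then obtain n where n: "\<psi> * \<xi> = \<chi>1 ^ n"
        by blast
      then have "\<xi> * \<psi> = \<chi>1 ^ n"
        by (simp only: mult.commute)
      with n False factor_of_\<chi>1_power[OF \<psi> \<xi>] factor_of_\<chi>1_power[OF \<xi> \<psi>] show False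
        by blast
    qed
    then have "\<mu> (\<psi> * \<xi>) = 0"
      by (rule other[OF mult_Xplus[OF \<psi> \<xi>]])
    then show ?thesis
      using False other[OF \<psi>] other[OF \<xi>] by auto
  qed
  moreover have "\<mu> 1 \<noteq> 0"
    using pow[of 0] by simp
  ultimately have "gen_semichar R \<mu>"
    using one_Xplus unfolding gen_semichar_def by blast
  moreover have "\<mu> \<in> extensional (Xplus R)"
    by (simp add: extensional_def \<mu>_def)
  ultimately have "\<mu> \<in> extensional (Xplus R) \<and> cyclic_semichar R \<chi>1 q \<mu>"
    using pow[of 1] other cyclic_subgroup_Xplus by (auto simp: cyclic_semichar_def)
  then show "\<exists>\<mu>. \<mu> \<in> extensional (Xplus R) \<and> cyclic_semichar R \<chi>1 q \<mu>"
    by blast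
next
  fix \<mu> \<nu>
  assume \<mu>: "\<mu> \<in> extensional (Xplus R) \<and> cyclic_semichar R \<chi>1 q \<mu>"
    and \<nu>: "\<nu> \<in> extensional (Xplus R) \<and> cyclic_semichar R \<chi>1 q \<nu>"
  show "\<mu> = \<nu>"
  proof (rule extensionalityI[of _ "Xplus R"])
    fix \<psi> assume \<psi>: "\<psi> \<in> Xplus R"
    show "\<mu> \<psi> = \<nu> \<psi>"
    proof (cases "\<psi> \<in> range (\<lambda>n. \<chi>1 ^ n)")
      case True
      then obtain n where "\<psi> = \<chi>1 ^ n"
        by blast
      then show ?thesis
        using \<mu> \<nu> by (simp add: cyclic_semichar_def gen_semichar_power)
    next
      case False
      then have "\<psi> \<in> Xplus R - cyclic_subgroup \<chi>1"
        using \<psi> cyclic_subgroup_Xplus by blast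
      then show ?thesis
        using \<mu> \<nu> by (simp add: cyclic_semichar_def)
    qed
  qed (use \<mu> \<nu> in auto)
qed


section \<open>Hardy spaces\<close>

lemma character_in_H2:
  assumes "\<psi> \<in> Xplus R"
  shows "L2_of \<psi> \<in> H2 R"
proof -
  have "cinner (L2_of \<psi>) (L2_of \<xi>) = 0" if "\<xi> \<in> Xminus R" for \<xi>
  proof -
    have "\<xi> \<in> characters" "\<psi> \<noteq> \<xi>"
      using assms that by (auto simp: Xminus_def)
    then show ?thesis
      using cinner_characters[OF Xplus_character[OF assms]] by simp
  qed
  then show ?thesis
    by (simp add: H2_def fourier_def)
qed

lemma in_H2_iff: "f \<in> H2 R \<longleftrightarrow> (\<forall>\<xi>\<in>Xplus R - {1}. cinner f (L2_of (cnj_char \<xi>)) = 0)"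
  by (simp add: H2_def fourier_def Xminus_eq)

text \<open>
  Such an \<open>f\<close> lies in \<open>H2 R\<close> as well, and is therefore orthogonal to itself.
\<close>

lemma H2m_eq_0:
  assumes "f \<in> H2m R" "\<And>\<xi>. \<xi> \<in> Xplus R - {1} \<Longrightarrow> cinner f (L2_of (cnj_char \<xi>)) = 0"
  shows "f = 0"
proof -
  have "f \<in> H2 R"
    using assms(2) by (simp add: in_H2_iff)
  then have "cinner f f = 0"
    using assms(1) by (simp add: H2m_def)
  then show ?thesis
    by (simp add: cinner_self)
qed

text \<open>
  The shifted coefficients are those of the product of \<open>\<chi>1 ^ n\<close> and \<open>f\<close>, which has the same norm as
  \<open>f\<close>. Hence \<open>g\<close> is the orthogonal projection of this product to \<open>H2m R\<close>.
\<close>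

lemma norm_shifted_coefficients:
  assumes g: "g \<in> H2m R"
    and shift: "\<And>\<xi>. \<xi> \<in> Xplus R - {1} \<Longrightarrow>
      cinner g (L2_of (cnj_char \<xi>)) = cinner f (L2_of (cnj_char (\<chi>1 ^ n * \<xi>)))"
  shows "norm g \<le> norm f"
proof -
  obtain h where h: "norm h = norm f"
    "\<And>\<xi>. \<xi> \<in> characters \<Longrightarrow> cinner h (L2_of \<xi>) = cinner f (L2_of (cnj_char (\<chi>1 ^ n) * \<xi>))"
    using modulation[OF \<chi>1_power_character] by blast
  have "g - h \<in> H2 R"
    unfolding in_H2_iff
  proof
    fix \<xi> assume \<xi>: "\<xi> \<in> Xplus R - {1}"
    then have "cnj_char \<xi> \<in> characters"
      by (intro character_cnj Xplus_character) blast
    from h(2)[OF this] shift[OF \<xi>] show "cinner (g - h) (L2_of (cnj_char \<xi>)) = 0"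
      by (simp add: cinner_diff_left cnj_char_mult)
  qed
  then have "cinner g (g - h) = 0"
    using g by (simp add: H2m_def)
  then have "cinner g g = cinner g h"
    using cinner_cnj[of g "g - h"] cinner_cnj[of g g] cinner_cnj[of g h] by (simp add: cinner_diff_left)
  moreover have "cmod (cinner g g) = (norm g)\<^sup>2"
    by (simp only: cinner_self norm_of_real abs_power2)
  ultimately have "(norm g)\<^sup>2 \<le> norm g * norm f"
    using cinner_bound[of g h] by (simp only: h(1))
  then show ?thesis
    by (cases "norm g = 0") (auto simp: power2_eq_square)
qed

lemma coeff_seq_norm:
  assumes "coeff_seq R \<chi>1 a \<phi>"
  obtains B where "B \<ge> 0" "\<And>n. norm (\<phi> n) \<le> B"
proof -
  obtain B where B: "\<And>n. norm (\<phi> n) \<le> B"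
    using assms by (auto simp: coeff_seq_def bounded_iff)
  then show ?thesis
    using that[of B] order_trans[OF norm_ge_zero B] by blast
qed

lemma H2_partial_fourier_dense:
  assumes f: "f \<in> H2 R" and e: "e > 0" and D: "finite D" "D \<subseteq> Xplus R"
  obtains F where "finite F" "D \<subseteq> F" "F \<subseteq> Xplus R" "norm (f - partial_fourier F f) < e"
proof -
  obtain E where E: "finite E" "E \<subseteq> characters"
    "\<And>F. finite F \<Longrightarrow> E \<subseteq> F \<Longrightarrow> F \<subseteq> characters \<Longrightarrow> norm (f - partial_fourier F f) < e"
    using partial_fourier_dense[OF e, of f] by blast
  have fin: "finite (E \<union> D)" and sub: "E \<union> D \<subseteq> characters"
    using E(1,2) D Xplus_character by auto
  have "partial_fourier (E \<union> D) f = partial_fourier ((E \<union> D) \<inter> Xplus R) f"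
    unfolding partial_fourier_def
  proof (rule sum.mono_neutral_right[OF fin])
    show "\<forall>\<psi>\<in>(E \<union> D) - (E \<union> D) \<inter> Xplus R. cscale (fourier f \<psi>) (L2_of \<psi>) = 0"
    proof
      fix \<psi> assume "\<psi> \<in> (E \<union> D) - (E \<union> D) \<inter> Xplus R"
      then have "\<psi> \<in> Xminus R"
        using sub by (auto simp: Xminus_def)
      then show "cscale (fourier f \<psi>) (L2_of \<psi>) = 0"
        using f by (simp add: H2_def)
    qed
  qed simp
  then show ?thesis
    using that[of "(E \<union> D) \<inter> Xplus R"] E(3)[OF fin _ sub] fin D by auto
qed


section \<open>Series of rank-one operators\<close>

abbreviation series_term :: "complex \<Rightarrow> (nat \<Rightarrow> 'g L2) \<Rightarrow> nat \<Rightarrow> 'g L2 \<Rightarrow> 'g L2" where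
  "series_term q \<phi> n f \<equiv> cscale (q ^ n) (rank_one (\<phi> n) (L2_of (\<chi>1 ^ n)) f)"

lemma norm_series_term:
  assumes "norm (\<phi> n) \<le> B"
  shows "norm (series_term q \<phi> n f) \<le> B * norm f * cmod q ^ n"
proof -
  have "cmod (cinner f (L2_of (\<chi>1 ^ n))) \<le> norm f"
    using cinner_bound[of f "L2_of (\<chi>1 ^ n)"] by (simp add: norm_character \<chi>1_power_character)
  then have "cmod (cinner f (L2_of (\<chi>1 ^ n))) * norm (\<phi> n) \<le> norm f * B"
    using assms by (intro mult_mono) auto
  then have "cmod q ^ n * (cmod (cinner f (L2_of (\<chi>1 ^ n))) * norm (\<phi> n)) \<le> cmod q ^ n * (norm f * B)"
    by (rule mult_left_mono) simp
  then show ?thesis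
    by (simp add: rank_one_def norm_power norm_mult mult_ac)
qed

lemma series_term_linear:
  "series_term q \<phi> n (f + g) = series_term q \<phi> n f + series_term q \<phi> n g"
  "series_term q \<phi> n (cscale c f) = cscale c (series_term q \<phi> n f)"
  by (simp_all add: rank_one_def cinner_add_left cinner_cscale_left cs.scale_left_distrib
      cs.scale_right_distrib mult_ac)

lemma series_term_bounded:
  assumes "\<phi> n \<in> H2m R"
  shows "bounded_op (H2 R) (H2m R) (series_term q \<phi> n)"
  unfolding bounded_op_def linear_op_def
proof (intro conjI)
  show "series_term q \<phi> n ` H2 R \<subseteq> H2m R"
    using assms by (auto simp: rank_one_def intro!: cs.subspace_scale[OF subspace_H2m])
  have "norm (series_term q \<phi> n f) \<le> (norm (\<phi> n) * cmod q ^ n) * norm f" for f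
    by (rule order_trans[OF norm_series_term[OF order_refl]]) (simp add: mult_ac)
  then show "\<exists>K. \<forall>f\<in>H2 R. norm (series_term q \<phi> n f) \<le> K * norm f"
    by blast
qed (simp_all add: series_term_linear)

lemma series_nuclear:
  assumes sums: "op_sums (H2 R) (H2m R) (series_term q \<phi>) A" and q: "cmod q < 1"
    and \<phi>: "\<And>n. \<phi> n \<in> H2m R" "\<And>n. norm (\<phi> n) \<le> B"
  shows "nuclear_op (H2 R) (H2m R) A"
  unfolding nuclear_op_def
proof (intro exI conjI allI)
  let ?f = "\<lambda>n. cscale (q ^ n) (\<phi> n)" and ?y = "\<lambda>n. L2_of (\<chi>1 ^ n)"
  have geo: "summable (\<lambda>n. cmod q ^ n)"
    using q by (intro summable_geometric) simp
  show "?f n \<in> H2m R" for n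
    by (intro cs.subspace_scale[OF subspace_H2m] \<phi>)
  show "?y n \<in> H2 R" for n
    by (rule character_in_H2[OF \<chi>1_power_Xplus])
  have "norm (norm (?f n) * norm (?y n)) \<le> B * cmod q ^ n" for n
    using mult_left_mono[OF \<phi>(2)[of n], of "cmod q ^ n"]
    by (simp add: norm_character \<chi>1_power_character norm_power mult.commute)
  then show "summable (\<lambda>n. norm (?f n) * norm (?y n))"
    by (intro summable_comparison_test'[OF summable_mult[OF geo]])
  have "(\<lambda>n. rank_one (?f n) (?y n)) = series_term q \<phi>"
    by (simp add: fun_eq_iff rank_one_def mult.commute)
  with sums show "op_sums (H2 R) (H2m R) (\<lambda>n. rank_one (?f n) (?y n)) A"
    by simp
qed

lemma series_converges:
  assumes q: "cmod q < 1" and \<phi>: "\<And>n. \<phi> n \<in> H2m R" "B \<ge> 0" "\<And>n. norm (\<phi> n) \<le> B"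
  shows "\<exists>A. op_sums (H2 R) (H2m R) (series_term q \<phi>) A"
proof
  define A where "A f = (\<Sum>n. series_term q \<phi> n f)" for f
  have nt: "norm (series_term q \<phi> n f) \<le> B * norm f * cmod q ^ n" for n f
    by (rule norm_series_term[OF \<phi>(3)])
  have geo: "summable (\<lambda>n. cmod q ^ n)"
    using q by (intro summable_geometric) simp
  have sm: "summable (\<lambda>n. series_term q \<phi> n f)" for f
  proof (rule L2_absolutely_summable)
    show "summable (\<lambda>n. norm (series_term q \<phi> n f))"
      by (rule summable_comparison_test'[OF summable_mult[OF geo]]) (use nt in \<open>simp only: real_norm_def abs_norm_cancel\<close>)
  qed
  have As: "(\<lambda>n. series_term q \<phi> n f) sums A f" for f
    unfolding A_def by (rule summable_sums[OF sm])
  have est: "norm (A f - (\<Sum>n<N. series_term q \<phi> n f)) \<le> B / (1 - cmod q) * cmod q ^ N * norm f" for f N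
  proof -
    have "norm ((\<Sum>n<M. series_term q \<phi> n f) - (\<Sum>n<N. series_term q \<phi> n f)) \<le>
        B / (1 - cmod q) * cmod q ^ N * norm f" if M: "M \<ge> N" for M
    proof -
      have "(\<Sum>n<M. series_term q \<phi> n f) - (\<Sum>n<N. series_term q \<phi> n f) = (\<Sum>n\<in>{N..<M}. series_term q \<phi> n f)"
      proof -
        have "{..<M} - {..<N} = {N..<M}"
          by auto
        then show ?thesis
          using sum_diff[of "{..<M}" "{..<N}" "\<lambda>n. series_term q \<phi> n f"] M by simp
      qed
      also have "norm \<dots> \<le> (\<Sum>n\<in>{N..<M}. B * norm f * cmod q ^ n)"
        by (rule order_trans[OF norm_sum sum_mono[OF nt]])
      also have "\<dots> = B * norm f * (\<Sum>n\<in>{N..<M}. cmod q ^ n)"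
        by (simp add: sum_distrib_left)
      also have "\<dots> \<le> B * norm f * (cmod q ^ N / (1 - cmod q))"
        using q \<phi>(2) by (intro mult_left_mono geometric_tail_bound) auto
      finally show ?thesis
        by (simp add: mult_ac)
    qed
    then have ev: "\<forall>\<^sub>F M in sequentially. norm ((\<Sum>n<M. series_term q \<phi> n f) - (\<Sum>n<N. series_term q \<phi> n f)) \<le>
        B / (1 - cmod q) * cmod q ^ N * norm f"
      unfolding eventually_sequentially by blast
    have "(\<lambda>M. norm ((\<Sum>n<M. series_term q \<phi> n f) - (\<Sum>n<N. series_term q \<phi> n f))) \<longlonglongrightarrow>
        norm (A f - (\<Sum>n<N. series_term q \<phi> n f))"
      by (intro tendsto_intros As[unfolded sums_def])
    from tendsto_upperbound[OF this ev] show ?thesis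
      by simp
  qed
  have bdd: "bounded_op (H2 R) (H2m R) A"
    unfolding bounded_op_def linear_op_def
  proof (intro conjI ballI allI)
    show "A ` H2 R \<subseteq> H2m R"
    proof safe
      fix f assume "f \<in> H2 R"
      show "A f \<in> H2m R"
        by (rule H2m_sums[OF _ As]) (simp add: rank_one_def cs.subspace_scale[OF subspace_H2m] \<phi>(1))
    qed
    show "A (f + g) = A f + A g" for f g
      unfolding A_def series_term_linear by (rule suminf_add[symmetric, OF sm sm])
    show "A (cscale c f) = cscale c (A f)" for c f
      unfolding A_def series_term_linear by (rule bounded_linear.suminf[OF bounded_linear_cscale sm, symmetric])
    have "norm (A f) \<le> B / (1 - cmod q) * norm f" for f
      using est[of f 0] by simp
    then show "\<exists>K. \<forall>f\<in>H2 R. norm (A f) \<le> K * norm f"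
      by blast
  qed
  show "op_sums (H2 R) (H2m R) (series_term q \<phi>) A"
  proof (rule op_sumsI[where r = "cmod q" and C = "B / (1 - cmod q)"])
    show "0 \<in> H2 R"
      by (rule cs.subspace_0[OF subspace_H2])
    show "bounded_op (H2 R) (H2m R) (series_term q \<phi> n)" for n
      by (rule series_term_bounded[OF \<phi>(1)])
    show "bounded_op (H2 R) (H2m R) A"
      by (rule bdd)
    show "0 \<le> B / (1 - cmod q)" "0 \<le> cmod q" "cmod q < 1"
      using q \<phi>(2) by simp_all
    show "norm (A f - (\<Sum>n<N. series_term q \<phi> n f)) \<le> B / (1 - cmod q) * cmod q ^ N * norm f" for N f
      by (rule est)
  qed
qed

text \<open>
  By orthogonality, the series applied to the character \<open>\<chi>1 ^ m\<close> reduces to its term with \<open>n = m\<close>, and it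
  vanishes on the other positive characters, exactly as \<open>\<mu>\<close> does.
\<close>

lemma series_mu_Hankel:
  assumes sums: "op_sums (H2 R) (H2m R) (series_term q \<phi>) A"
    and \<phi>: "coeff_seq R \<chi>1 a \<phi>" and \<mu>: "cyclic_semichar R \<chi>1 q \<mu>"
  shows "bounded_mu_Hankel R \<mu> a A"
proof -
  have bdd: "bounded_op (H2 R) (H2m R) A"
    using sums by (simp add: op_sums_def)
  have val: "series_term q \<phi> n (L2_of \<psi>) = (if \<psi> = \<chi>1 ^ n then cscale (q ^ n) (\<phi> n) else 0)"
    if "\<psi> \<in> Xplus R" for n \<psi>
    using that by (simp add: rank_one_def cinner_characters Xplus_character \<chi>1_power_character)
  have coeff: "cinner (A (L2_of \<psi>)) (L2_of (cnj_char \<xi>)) = \<mu> \<psi> * a (\<psi> * \<xi>)"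
    if \<psi>: "\<psi> \<in> Xplus R" and \<xi>: "\<xi> \<in> Xplus R - {1}" for \<psi> \<xi>
  proof -
    have s: "(\<lambda>n. series_term q \<phi> n (L2_of \<psi>)) sums A (L2_of \<psi>)"
      by (rule op_sums_pointwise[OF sums character_in_H2[OF \<psi>]])
        (simp add: norm_character Xplus_character \<psi>)
    show ?thesis
    proof (cases "\<psi> \<in> range (\<lambda>n. \<chi>1 ^ n)")
      case True
      then obtain m where m: "\<psi> = \<chi>1 ^ m"
        by blast
      have "(\<lambda>n. series_term q \<phi> n (L2_of \<psi>)) = (\<lambda>n. if n = m then cscale (q ^ n) (\<phi> n) else 0)"
        using val[OF \<psi>] by (auto simp: m \<chi>1_power_inject)
      then have "A (L2_of \<psi>) = cscale (q ^ m) (\<phi> m)"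
        using s sums_unique2[OF s, of "cscale (q ^ m) (\<phi> m)"] sums_single[of m "\<lambda>n. cscale (q ^ n) (\<phi> n)"] by simp
      moreover have "\<mu> \<psi> = q ^ m"
        using \<mu> by (simp add: m cyclic_semichar_def gen_semichar_power)
      ultimately show ?thesis
        using \<phi> \<xi> by (simp add: cinner_cscale_left coeff_seq_def m)
    next
      case False
      then have "\<psi> \<noteq> \<chi>1 ^ n" for n
        by blast
      then have "(\<lambda>n. series_term q \<phi> n (L2_of \<psi>)) = (\<lambda>n. 0)"
        by (simp only: val[OF \<psi>] if_False)
      then have "A (L2_of \<psi>) = 0"
        using s sums_unique2[OF s, of 0] by simp
      moreover have "\<mu> \<psi> = 0"
        using \<mu> False \<psi> cyclic_subgroup_Xplus by (auto simp: cyclic_semichar_def)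
      ultimately show ?thesis
        by simp
    qed
  qed
  have "cs.span (L2_of ` Xplus R) \<subseteq> H2 R"
    by (rule cs.span_minimal[OF _ subspace_H2]) (auto intro: character_in_H2)
  then show ?thesis
    using bdd coeff subspace_H2 by (simp add: bounded_mu_Hankel_def mu_Hankel_def bounded_op_def)
qed


section \<open>Bounded \<open>\<mu>\<close>-Hankel operators\<close>

text \<open>
  A bounded operator that vanishes on the positive characters outside the powers of \<open>\<chi>1\<close> is
  determined by its values on these powers. The remainder is estimated on partial Fourier sums.
\<close>

lemma operator_series_estimate:
  assumes A: "bounded_op (H2 R) (H2m R) A"
    and pow: "\<And>n. A (L2_of (\<chi>1 ^ n)) = cscale (q ^ n) (\<phi> n)"
    and other: "\<And>\<psi>. \<psi> \<in> Xplus R \<Longrightarrow> \<psi> \<notin> range (\<lambda>n. \<chi>1 ^ n) \<Longrightarrow> A (L2_of \<psi>) = 0"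
    and q: "cmod q < 1" and B: "B \<ge> 0" "\<And>n. norm (\<phi> n) \<le> B" and f: "f \<in> H2 R"
  shows "norm (A f - (\<Sum>n<N. series_term q \<phi> n f)) \<le> B / (1 - cmod q) * cmod q ^ N * norm f"
proof (rule field_le_epsilon)
  fix e :: real assume e: "e > 0"
  obtain K where K: "K \<ge> 0" "\<And>f. f \<in> H2 R \<Longrightarrow> norm (A f) \<le> K * norm f"
    by (rule bounded_op_bound[OF A]) blast
  have lin: "linear_op (H2 R) (H2m R) A"
    using A by (simp add: bounded_op_def)
  define d where "d = e / (K + 1)"
  have d: "d > 0" "K * d \<le> e"
    using e K(1) by (auto simp: d_def field_simps)
  obtain F where F: "finite F" "(\<lambda>n. \<chi>1 ^ n) ` {..<N} \<subseteq> F" "F \<subseteq> Xplus R"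
      and close: "norm (f - partial_fourier F f) < d"
    by (rule H2_partial_fourier_dense[OF f d(1), of "(\<lambda>n. \<chi>1 ^ n) ` {..<N}"])
      (auto simp: \<chi>1_power_Xplus)
  define J where "J = {n. \<chi>1 ^ n \<in> F}"
  have inj: "inj (\<lambda>n. \<chi>1 ^ n)"
    by (simp add: inj_on_def \<chi>1_power_inject)
  have J: "finite J" "{..<N} \<subseteq> J"
    using finite_vimageI[OF F(1) inj] F(2) by (auto simp: J_def vimage_def)
  have P: "partial_fourier F f \<in> H2 R"
    unfolding partial_fourier_def
    using F(3) by (intro cs.subspace_sum[OF subspace_H2] cs.subspace_scale[OF subspace_H2] character_in_H2) auto
  have "A (partial_fourier F f) = (\<Sum>\<psi>\<in>F. cscale (fourier f \<psi>) (A (L2_of \<psi>)))"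
    unfolding partial_fourier_def
    using F(3) by (intro linear_op_sum[OF lin subspace_H2] character_in_H2) auto
  also have "\<dots> = (\<Sum>\<psi>\<in>(\<lambda>n. \<chi>1 ^ n) ` J. cscale (fourier f \<psi>) (A (L2_of \<psi>)))"
  proof (rule sum.mono_neutral_right[OF F(1)])
    show "\<forall>\<psi>\<in>F - (\<lambda>n. \<chi>1 ^ n) ` J. cscale (fourier f \<psi>) (A (L2_of \<psi>)) = 0"
    proof
      fix \<psi> assume "\<psi> \<in> F - (\<lambda>n. \<chi>1 ^ n) ` J"
      then have "\<psi> \<in> Xplus R" "\<psi> \<notin> range (\<lambda>n. \<chi>1 ^ n)"
        using F(3) by (auto simp: J_def)
      then show "cscale (fourier f \<psi>) (A (L2_of \<psi>)) = 0"
        by (simp add: other)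
    qed
  qed (auto simp: J_def)
  also have "\<dots> = (\<Sum>n\<in>J. series_term q \<phi> n f)"
    by (subst sum.reindex[OF inj_on_subset[OF inj]]) (auto simp: pow fourier_def rank_one_def mult.commute)
  also have "\<dots> = (\<Sum>n<N. series_term q \<phi> n f) + (\<Sum>n\<in>J - {..<N}. series_term q \<phi> n f)"
    using sum.subset_diff[OF J(2,1), of "\<lambda>n. series_term q \<phi> n f"] by (simp add: add.commute)
  finally have AP: "A (partial_fourier F f) =
      (\<Sum>n<N. series_term q \<phi> n f) + (\<Sum>n\<in>J - {..<N}. series_term q \<phi> n f)" .
  have "norm (\<Sum>n\<in>J - {..<N}. series_term q \<phi> n f) \<le> (\<Sum>n\<in>J - {..<N}. B * norm f * cmod q ^ n)"
    by (rule order_trans[OF norm_sum sum_mono[OF norm_series_term[OF B(2)]]])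
  also have "\<dots> = B * norm f * (\<Sum>n\<in>J - {..<N}. cmod q ^ n)"
    by (simp add: sum_distrib_left)
  also have "\<dots> \<le> B * norm f * (cmod q ^ N / (1 - cmod q))"
    using q B(1) J(1) by (intro mult_left_mono geometric_tail_bound) auto
  finally have tail: "norm (\<Sum>n\<in>J - {..<N}. series_term q \<phi> n f) \<le> B / (1 - cmod q) * cmod q ^ N * norm f"
    by (simp add: mult_ac)
  have "A f - (\<Sum>n<N. series_term q \<phi> n f) = A (f - partial_fourier F f) + (\<Sum>n\<in>J - {..<N}. series_term q \<phi> n f)"
    by (simp add: linear_op_diff[OF lin subspace_H2 f P] AP)
  moreover have "norm (A (f - partial_fourier F f)) \<le> e"
  proof -
    have "norm (A (f - partial_fourier F f)) \<le> K * norm (f - partial_fourier F f)"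
      by (rule K(2)[OF cs.subspace_diff[OF subspace_H2 f P]])
    also have "\<dots> \<le> K * d"
      using close K(1) by (intro mult_left_mono) auto
    finally show ?thesis
      using d(2) by simp
  qed
  ultimately show "norm (A f - (\<Sum>n<N. series_term q \<phi> n f)) \<le> B / (1 - cmod q) * cmod q ^ N * norm f + e"
    using norm_triangle_ineq[of "A (f - partial_fourier F f)" "\<Sum>n\<in>J - {..<N}. series_term q \<phi> n f"] tail
    by simp
qed

text \<open>
  A positive character \<open>\<psi>\<close> that is not a power of \<open>\<chi>1\<close> is divisible by every power of \<open>\<chi>1\<close>, so each
  coefficient of the image of \<open>\<psi>\<close> is \<open>\<mu> \<chi>1 ^ n\<close> times another, uniformly bounded coefficient.
\<close>

lemma mu_Hankel_vanishes:
  assumes \<mu>: "gen_semichar R \<mu>" and A: "bounded_mu_Hankel R \<mu> a A" and q: "cmod (\<mu> \<chi>1) < 1"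
    and \<psi>: "\<psi> \<in> Xplus R" "\<psi> \<notin> range (\<lambda>n. \<chi>1 ^ n)"
  shows "A (L2_of \<psi>) = 0"
proof (rule H2m_eq_0)
  have bdd: "bounded_op (H2 R) (H2m R) A"
    and coeff: "\<And>\<psi> \<xi>. \<psi> \<in> Xplus R \<Longrightarrow> \<xi> \<in> Xplus R - {1} \<Longrightarrow>
      cinner (A (L2_of \<psi>)) (L2_of (cnj_char \<xi>)) = \<mu> \<psi> * a (\<psi> * \<xi>)"
    using A by (auto simp: bounded_mu_Hankel_def mu_Hankel_def)
  show "A (L2_of \<psi>) \<in> H2m R"
    using bdd character_in_H2[OF \<psi>(1)] by (auto simp: bounded_op_def linear_op_def)
  obtain K where K: "K \<ge> 0" "\<And>f. f \<in> H2 R \<Longrightarrow> norm (A f) \<le> K * norm f"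
    by (rule bounded_op_bound[OF bdd]) blast
  fix \<xi> assume \<xi>: "\<xi> \<in> Xplus R - {1}"
  let ?v = "cinner (A (L2_of \<psi>)) (L2_of (cnj_char \<xi>))"
  have "cmod ?v \<le> cmod (\<mu> \<chi>1) ^ n * K" for n
  proof -
    obtain \<psi>' where \<psi>': "\<psi>' \<in> Xplus R" "\<psi> = \<chi>1 ^ n * \<psi>'"
      using \<chi>1_power_dvd[OF \<psi>] by blast
    have \<xi>': "\<chi>1 ^ n * \<xi> \<in> Xplus R - {1}"
      by (rule mult_Xplus_nonunit[OF \<chi>1_power_Xplus \<xi>])
    have "?v = \<mu> \<psi> * a (\<psi> * \<xi>)"
      by (rule coeff[OF \<psi>(1) \<xi>])
    also have "\<dots> = \<mu> \<chi>1 ^ n * (\<mu> \<psi>' * a (\<psi>' * (\<chi>1 ^ n * \<xi>)))"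
      unfolding \<psi>'(2) gen_semichar_mult[OF \<mu> \<chi>1_power_Xplus \<psi>'(1)] gen_semichar_power[OF \<mu>]
      by (simp only: mult_ac)
    also have "\<dots> = \<mu> \<chi>1 ^ n * cinner (A (L2_of \<psi>')) (L2_of (cnj_char (\<chi>1 ^ n * \<xi>)))"
      by (simp only: coeff[OF \<psi>'(1) \<xi>'])
    finally have "cmod ?v = cmod (\<mu> \<chi>1) ^ n * cmod (cinner (A (L2_of \<psi>')) (L2_of (cnj_char (\<chi>1 ^ n * \<xi>))))"
      by (simp add: norm_mult norm_power)
    also have "cmod (cinner (A (L2_of \<psi>')) (L2_of (cnj_char (\<chi>1 ^ n * \<xi>)))) \<le> norm (A (L2_of \<psi>')) * 1"
    proof -
      have "cnj_char (\<chi>1 ^ n * \<xi>) \<in> characters"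
        using \<xi>' by (intro character_cnj Xplus_character) blast
      then show ?thesis
        using cinner_bound[of "A (L2_of \<psi>')" "L2_of (cnj_char (\<chi>1 ^ n * \<xi>))"] by (simp add: norm_character)
    qed
    also have "norm (A (L2_of \<psi>')) * 1 \<le> K"
      using K(2)[OF character_in_H2[OF \<psi>'(1)]] by (simp add: norm_character Xplus_character \<psi>'(1))
    finally show ?thesis
      by (simp add: mult_left_mono)
  qed
  moreover have "(\<lambda>n. cmod (\<mu> \<chi>1) ^ n * K) \<longlonglongrightarrow> 0 * K"
    using q by (intro tendsto_mult tendsto_const LIMSEQ_power_zero) simp
  ultimately have "cmod ?v \<le> 0 * K"
    by (intro tendsto_lowerbound[of _ _ sequentially]) auto
  then show "?v = 0"
    by simp
qed

text \<open>
  The functions \<open>\<phi> n\<close> are the images of \<open>\<chi>1 ^ n\<close> divided by \<open>\<mu> \<chi>1 ^ n\<close>; their coefficients are shifts of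
  those of \<open>\<phi> 0\<close>, which bounds their norms.
\<close>

lemma mu_Hankel_expansion:
  assumes \<mu>: "gen_semichar R \<mu>" and A: "bounded_mu_Hankel R \<mu> a A"
    and q0: "0 < cmod (\<mu> \<chi>1)" and q1: "cmod (\<mu> \<chi>1) < 1"
  obtains \<phi> where "coeff_seq R \<chi>1 a \<phi>" "\<And>n. norm (\<phi> n) \<le> norm (\<phi> 0)"
    "\<And>f N. f \<in> H2 R \<Longrightarrow> norm (A f - (\<Sum>n<N. series_term (\<mu> \<chi>1) \<phi> n f)) \<le>
      norm (\<phi> 0) / (1 - cmod (\<mu> \<chi>1)) * cmod (\<mu> \<chi>1) ^ N * norm f"
proof -
  define q where "q = \<mu> \<chi>1"
  have qn: "q ^ n \<noteq> 0" for n
    using q0 by (simp add: q_def)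
  have bdd: "bounded_op (H2 R) (H2m R) A"
    and coeff: "\<And>\<psi> \<xi>. \<psi> \<in> Xplus R \<Longrightarrow> \<xi> \<in> Xplus R - {1} \<Longrightarrow>
      cinner (A (L2_of \<psi>)) (L2_of (cnj_char \<xi>)) = \<mu> \<psi> * a (\<psi> * \<xi>)"
    using A by (auto simp: bounded_mu_Hankel_def mu_Hankel_def)
  define \<phi> where "\<phi> n = cscale (inverse (q ^ n)) (A (L2_of (\<chi>1 ^ n)))" for n
  have \<phi>m: "\<phi> n \<in> H2m R" for n
    unfolding \<phi>_def using bdd character_in_H2[OF \<chi>1_power_Xplus]
    by (intro cs.subspace_scale[OF subspace_H2m]) (auto simp: bounded_op_def linear_op_def)
  have \<phi>c: "cinner (\<phi> n) (L2_of (cnj_char \<xi>)) = a (\<chi>1 ^ n * \<xi>)" if "\<xi> \<in> Xplus R - {1}" for n \<xi>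
    using coeff[OF \<chi>1_power_Xplus that] qn
    by (simp add: \<phi>_def cinner_cscale_left gen_semichar_power[OF \<mu>] q_def[symmetric])
  have le: "norm (\<phi> n) \<le> norm (\<phi> 0)" for n
  proof (rule norm_shifted_coefficients[OF \<phi>m])
    fix \<xi> assume \<xi>: "\<xi> \<in> Xplus R - {1}"
    show "cinner (\<phi> n) (L2_of (cnj_char \<xi>)) = cinner (\<phi> 0) (L2_of (cnj_char (\<chi>1 ^ n * \<xi>)))"
      using \<phi>c[OF \<xi>, of n] \<phi>c[OF mult_Xplus_nonunit[OF \<chi>1_power_Xplus \<xi>], of 0 n] by simp
  qed
  show ?thesis
  proof (rule that[of \<phi>])
    show "coeff_seq R \<chi>1 a \<phi>"
      using \<phi>m \<phi>c le by (auto simp: coeff_seq_def bounded_iff)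
    show "norm (\<phi> n) \<le> norm (\<phi> 0)" for n
      by (rule le)
    show "norm (A f - (\<Sum>n<N. series_term (\<mu> \<chi>1) \<phi> n f)) \<le>
        norm (\<phi> 0) / (1 - cmod (\<mu> \<chi>1)) * cmod (\<mu> \<chi>1) ^ N * norm f" if "f \<in> H2 R" for f N
    proof (rule operator_series_estimate[OF bdd _ _ q1 _ le that])
      show "A (L2_of (\<chi>1 ^ n)) = cscale (\<mu> \<chi>1 ^ n) (\<phi> n)" for n
        using qn[of n] by (simp add: \<phi>_def q_def[symmetric])
      show "A (L2_of \<psi>) = 0" if "\<psi> \<in> Xplus R" "\<psi> \<notin> range (\<lambda>n. \<chi>1 ^ n)" for \<psi>
        by (rule mu_Hankel_vanishes[OF \<mu> A q1 that])
    qed simp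
  qed
qed

theorem mu_Hankel_structure:
  assumes \<mu>: "gen_semichar R \<mu>" and A: "bounded_mu_Hankel R \<mu> a A"
    and q0: "0 < cmod (\<mu> \<chi>1)" and q1: "cmod (\<mu> \<chi>1) < 1"
  shows "(\<exists>\<phi>. coeff_seq R \<chi>1 a \<phi> \<and> op_sums (H2 R) (H2m R) (series_term (\<mu> \<chi>1) \<phi>) A \<and>
      op_norm (H2 R) A \<le> norm (\<phi> 0) / (1 - cmod (\<mu> \<chi>1)))"
    and "\<forall>f\<in>H2_cyclic_perp R \<chi>1. A f = 0"
    and "nuclear_op (H2 R) (H2m R) A"
proof -
  obtain \<phi> where \<phi>: "coeff_seq R \<chi>1 a \<phi>" "\<And>n. norm (\<phi> n) \<le> norm (\<phi> 0)"
    and est: "\<And>f N. f \<in> H2 R \<Longrightarrow> norm (A f - (\<Sum>n<N. series_term (\<mu> \<chi>1) \<phi> n f)) \<le>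
      norm (\<phi> 0) / (1 - cmod (\<mu> \<chi>1)) * cmod (\<mu> \<chi>1) ^ N * norm f"
    using mu_Hankel_expansion[OF assms] by blast
  define C where "C = norm (\<phi> 0) / (1 - cmod (\<mu> \<chi>1))"
  have C: "C \<ge> 0"
    using q1 by (simp add: C_def)
  have \<phi>m: "\<phi> n \<in> H2m R" for n
    using \<phi>(1) by (simp add: coeff_seq_def)
  have bdd: "bounded_op (H2 R) (H2m R) A"
    using A by (simp add: bounded_mu_Hankel_def)
  have sums: "op_sums (H2 R) (H2m R) (series_term (\<mu> \<chi>1) \<phi>) A"
  proof (rule op_sumsI[where r = "cmod (\<mu> \<chi>1)" and C = C])
    show "0 \<in> H2 R"
      by (rule cs.subspace_0[OF subspace_H2])
    show "bounded_op (H2 R) (H2m R) (series_term (\<mu> \<chi>1) \<phi> n)" for n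
      by (rule series_term_bounded[OF \<phi>m])
    show "norm (A f - (\<Sum>n<N. series_term (\<mu> \<chi>1) \<phi> n f)) \<le> C * cmod (\<mu> \<chi>1) ^ N * norm f"
      if "f \<in> H2 R" for N f
      unfolding C_def by (rule est[OF that])
  qed (use bdd q1 C in simp_all)
  have "op_norm (H2 R) A \<le> C"
  proof (rule op_norm_le[OF cs.subspace_0[OF subspace_H2]])
    fix f assume "f \<in> H2 R" "norm f \<le> 1"
    then show "norm (A f) \<le> C"
      using est[of f 0] mult_left_mono[of "norm f" 1 C] C by (simp add: C_def)
  qed
  with \<phi>(1) sums show "\<exists>\<phi>. coeff_seq R \<chi>1 a \<phi> \<and> op_sums (H2 R) (H2m R) (series_term (\<mu> \<chi>1) \<phi>) A \<and>
      op_norm (H2 R) A \<le> norm (\<phi> 0) / (1 - cmod (\<mu> \<chi>1))"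
    unfolding C_def by blast
  show "\<forall>f\<in>H2_cyclic_perp R \<chi>1. A f = 0"
  proof
    fix f assume f: "f \<in> H2_cyclic_perp R \<chi>1"
    have "L2_of (\<chi>1 ^ n) \<in> H2_cyclic \<chi>1" for n
      unfolding H2_cyclic_def by (rule subsetD[OF closure_subset]) (intro cs.span_base rangeI)
    then have z: "series_term (\<mu> \<chi>1) \<phi> n f = 0" for n
      using f by (simp add: H2_cyclic_perp_def rank_one_def)
    have "norm (A f) \<le> C * cmod (\<mu> \<chi>1) ^ N * norm f" for N
      using est[of f N] f unfolding z sum.neutral_const diff_0_right C_def by (simp add: H2_cyclic_perp_def)
    moreover have "(\<lambda>N. C * cmod (\<mu> \<chi>1) ^ N * norm f) \<longlonglongrightarrow> C * 0 * norm f"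
      using q1 by (intro tendsto_mult tendsto_const LIMSEQ_power_zero) simp
    ultimately have "norm (A f) \<le> C * 0 * norm f"
      by (intro tendsto_lowerbound[of _ _ sequentially]) auto
    then show "A f = 0"
      by simp
  qed
  show "nuclear_op (H2 R) (H2m R) A"
    by (rule series_nuclear[OF sums q1 \<phi>m \<phi>(2)])
qed

end

theorem theorem10:
  fixes R :: "('g::compact_connected_ab_group \<Rightarrow> complex) rel"
    and \<chi>1 :: "'g \<Rightarrow> complex"
  assumes "group_order R"
    and "first_positive R \<chi>1"
  shows "(\<forall>\<mu> a A. gen_semichar R \<mu> \<and> bounded_mu_Hankel R \<mu> a A \<and>
            0 < cmod (\<mu> \<chi>1) \<and> cmod (\<mu> \<chi>1) < 1 \<longrightarrow>
          (\<exists>\<phi>. coeff_seq R \<chi>1 a \<phi> \<and>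
               op_sums (H2 R) (H2m R)
                 (\<lambda>n f. cscale ((\<mu> \<chi>1) ^ n) (rank_one (\<phi> n) (L2_of (\<chi>1 ^ n)) f)) A \<and>
               op_norm (H2 R) A \<le> norm (\<phi> 0) / (1 - cmod (\<mu> \<chi>1))) \<and>
          (\<forall>f \<in> H2_cyclic_perp R \<chi>1. A f = 0) \<and>
          nuclear_op (H2 R) (H2m R) A) \<and>
         (\<forall>\<phi> a q. coeff_seq R \<chi>1 a \<phi> \<and> cmod q < 1 \<longrightarrow>
          (\<exists>A. op_sums (H2 R) (H2m R)
                 (\<lambda>n f. cscale (q ^ n) (rank_one (\<phi> n) (L2_of (\<chi>1 ^ n)) f)) A) \<and>
          (\<exists>!\<mu>. \<mu> \<in> extensional (Xplus R) \<and> cyclic_semichar R \<chi>1 q \<mu>) \<and>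
          (\<forall>A. op_sums (H2 R) (H2m R)
                 (\<lambda>n f. cscale (q ^ n) (rank_one (\<phi> n) (L2_of (\<chi>1 ^ n)) f)) A \<longrightarrow>
               nuclear_op (H2 R) (H2m R) A \<and>
               (\<forall>\<mu>. cyclic_semichar R \<chi>1 q \<mu> \<longrightarrow> bounded_mu_Hankel R \<mu> a A)))"
proof -
  interpret first_positive_character R \<chi>1
    by unfold_locales (rule assms)+
  show ?thesis
  proof (intro conjI[of "\<forall>\<mu> a A. _ \<mu> a A"] allI impI, goal_cases)
    case (1 \<mu> a A)
    then show ?case
      using mu_Hankel_structure[of \<mu> a A] by blast
  next
    case (2 \<phi> a q)
    then have \<phi>: "coeff_seq R \<chi>1 a \<phi>" and q: "cmod q < 1"
      by auto
    have \<phi>m: "\<phi> n \<in> H2m R" for n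
      using \<phi> by (simp add: coeff_seq_def)
    obtain B where B: "B \<ge> 0" "\<And>n. norm (\<phi> n) \<le> B"
      using coeff_seq_norm[OF \<phi>] by blast
    show ?case
    proof (intro conjI[OF _ conjI] allI impI)
      show "\<exists>A. op_sums (H2 R) (H2m R) (series_term q \<phi>) A"
        by (rule series_converges[OF q \<phi>m B])
      show "\<exists>!\<mu>. \<mu> \<in> extensional (Xplus R) \<and> cyclic_semichar R \<chi>1 q \<mu>"
        by (rule cyclic_semichar_unique_existence)
      fix A assume sums: "op_sums (H2 R) (H2m R) (series_term q \<phi>) A"
      show "nuclear_op (H2 R) (H2m R) A \<and> (\<forall>\<mu>. cyclic_semichar R \<chi>1 q \<mu> \<longrightarrow> bounded_mu_Hankel R \<mu> a A)"
        using series_nuclear[OF sums q \<phi>m B(2)] series_mu_Hankel[OF sums \<phi>] by blast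
    qed
  qed
qed

end
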